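(* For every integer $n\ge 1$, the monadic submonoid $[\![\binom{x}{n}]\!]$ of $\operatorname{Int}(\mathbb{Z})$ is factorial. In particular, it has trivial divisor class group.
   Context: $\operatorname{Int}(\mathbb{Z})=\{f\in\mathbb{Q}[x]\mid f(\mathbb{Z})\subseteq\mathbb{Z}\}$ and $\binom{x}{n}=\frac{x(x-1)\cdots(x-n+1)}{n!}$. For $f\in\operatorname{Int}(\mathbb{Z})$, the monadic submonoid generated by $f$ is the multiplicative monoid $[\![f]\!]=\{g\in\operatorname{Int}(\mathbb{Z})\mid g\text{ divides } f^m\text{ in }\operatorname{Int}(\mathbb{Z})\text{ for some } m\in\mathbb{N}\}$. A (commutative, cancellative) monoid is factorial if each of its non-units is a product of irreducible elements, uniquely up to order and units. The divisor class group of a Krull monoid is the group of its divisorial fractional ideals modulo the principal fractional ideals. *)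

theory Defs
  imports
    "HOL-Algebra.Divisibility"
    "HOL-Algebra.Elementary_Groups"
    "HOL-Algebra.Ring"
    "HOL-Computational_Algebra.Polynomial_Factorial"
begin

section \<open>Integer-valued polynomials and monadic submonoids\<close>

definition Int_Z :: "rat poly ring" where
  "Int_Z = \<lparr>carrier = {f. \<forall>z::int. poly f (of_int z) \<in> \<int>},
            mult = (*), one = 1, zero = 0, add = (+)\<rparr>"

definition binom_poly :: "nat \<Rightarrow> rat poly" where
  "binom_poly n = smult (1 / fact n) (\<Prod>i<n. [:- of_nat i, 1:])"

definition monadic_submonoid :: "('a, 'b) monoid_scheme \<Rightarrow> 'a \<Rightarrow> 'a monoid" where
  "monadic_submonoid R f =
     \<lparr>carrier = {g \<in> carrier R. \<exists>m::nat. g divides\<^bsub>R\<^esub> (f [^]\<^bsub>R\<^esub> m)},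
      mult = mult R, one = one R\<rparr>"

section \<open>Divisorial ideals, Krull monoids and divisor class groups\<close>

text \<open>A (commutative, cancellative) monoid is represented here by a multiplicatively closed
  subset \<open>H\<close> of a field with \<open>1 \<in> H\<close> and \<open>0 \<notin> H\<close>; its quotient group is realised in that field.
  For a monoid of polynomials, \<open>H\<close> is its image in the field of fractions under \<open>to_fract\<close>.\<close>

definition mult_submonoid :: "'a::field set \<Rightarrow> bool" where
  "mult_submonoid H \<longleftrightarrow> 1 \<in> H \<and> 0 \<notin> H \<and> (\<forall>x\<in>H. \<forall>y\<in>H. x * y \<in> H)"

definition quotient_group :: "'a::field set \<Rightarrow> 'a set" where
  "quotient_group H = {a / b | a b. a \<in> H \<and> b \<in> H}"

definition ideal_inverse :: "'a::field set \<Rightarrow> 'a set \<Rightarrow> 'a set" where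
  "ideal_inverse H J = {x \<in> quotient_group H. \<forall>y\<in>J. x * y \<in> H}"

definition v_closure :: "'a::field set \<Rightarrow> 'a set \<Rightarrow> 'a set" where
  "v_closure H J = ideal_inverse H (ideal_inverse H J)"

text \<open>The condition \<open>v_closure H J = J\<close> already makes \<open>J\<close> stable under multiplication
  by \<open>H\<close>.\<close>

definition divisorial_fractional_ideal :: "'a::field set \<Rightarrow> 'a set \<Rightarrow> bool" where
  "divisorial_fractional_ideal H J \<longleftrightarrow>
     J \<noteq> {} \<and> J \<subseteq> quotient_group H \<and> (\<exists>c\<in>H. \<forall>x\<in>J. c * x \<in> H) \<and> v_closure H J = J"

definition principal_fractional_ideals :: "'a::field set \<Rightarrow> 'a set set" where
  "principal_fractional_ideals H = {(\<lambda>x. a * x) ` H | a. a \<in> quotient_group H}"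

definition divisorial_group :: "'a::field set \<Rightarrow> 'a set monoid" where
  "divisorial_group H =
     \<lparr>carrier = {J. divisorial_fractional_ideal H J},
      mult = (\<lambda>I J. v_closure H {x * y | x y. x \<in> I \<and> y \<in> J}),
      one = H\<rparr>"

definition divisor_class_group :: "'a::field set \<Rightarrow> 'a set set monoid" where
  "divisor_class_group H = divisorial_group H Mod principal_fractional_ideals H"

definition completely_integrally_closed :: "'a::field set \<Rightarrow> bool" where
  "completely_integrally_closed H \<longleftrightarrow>
     (\<forall>x\<in>quotient_group H. (\<exists>c\<in>H. \<forall>k::nat. c * x ^ k \<in> H) \<longrightarrow> x \<in> H)"

definition acc_divisorial_ideals :: "'a::field set \<Rightarrow> bool" where
  "acc_divisorial_ideals H \<longleftrightarrow>
     (\<forall>J :: nat \<Rightarrow> 'a set.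
        (\<forall>i. divisorial_fractional_ideal H (J i) \<and> J i \<subseteq> H \<and> J i \<subseteq> J (Suc i))
        \<longrightarrow> (\<exists>N. \<forall>i\<ge>N. J i = J N))"

definition krull_monoid :: "'a::field set \<Rightarrow> bool" where
  "krull_monoid H \<longleftrightarrow>
     mult_submonoid H \<and> completely_integrally_closed H \<and> acc_divisorial_ideals H"

end

(*
  The binomial polynomial f = binom(x, n) is absolutely irreducible (Rissner, Windisch): the
  only divisors of its powers in Int(Z) are +-f^k, so the monadic submonoid is {+-f^k}, which
  is {+-1} times a free monoid of rank one.

  Let g * h = f^m in Int(Z), g = c * prod_{i<n} (x - i)^(a_i). If a prime p does not divide
  binom(z, n), then neither does it divide g(z); comparing with z = n shows that
  sum_{i<n} a_i v_p(z - i) has the same value for all such z. These linear equations force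
  the a_i to be equal. The largest prime q <= n gives a_i = c for n - q <= i < q; and if
  a_i = c is known except for k indices at either end, a prime p > 2k dividing n - r with r < k
  shows a_i = c except for r indices at either end.

  Such a p exists whenever n > 10, k >= 2 and n, n - 1, ..., n - k + 1 are composite: otherwise
  k * binom(n, k), in which every prime power is at most n, would be too small. Long windows,
  with 5 * k > n, contain a prime by Chebyshev's estimates; small n are checked by
  certificates.
*)
theory Submission
  imports Defs
    "HOL-Number_Theory.Prime_Powers"
    "HOL-Analysis.Harmonic_Numbers"
    "HOL-Analysis.Convex"
begin

text \<open>The factor 2 in p > 2k comes from the two ends: up to 2k unknown exponents must have
  distinct residues modulo p and leave one residue free. This is Sylvester's theorem with 2k in
  place of k. It fails for the windows 9, 8 and 10, 9, 8, and for k = 1 when n is a power of 2;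
  there the equations at the primes 2, 3 and 5 are solved directly. The size estimate charges a
  factor n to every prime up to 2k. This is affordable while k^2 <= 4n, since the sieve bound for
  these primes is about 16k/35 < k/2 and n is at least k^2/4. For longer windows only primes up to
  sqrt n are charged n, and the rest enters through \<open>psi (2 * k)\<close>. Near k = n/5 a bound
  of \<open>psi\<close> with slope ln 4 would be too weak, hence Chebyshev's combination of five
  factorials. The slopes 0.9212 and 1.1057 that it gives are also close enough to yield a prime
  between 4n/5 and n, which confines k to n/5. The error terms are under control from n = 40000
  on.\<close>

hide_const (open) Divisibility.prime Divisibility.irreducible

section \<open>Chebyshev's estimates\<close>

definition psi :: "nat \<Rightarrow> real" where
  "psi n = (\<Sum>d = 1..n. mangoldt d)"

lemma psi_mono: "m \<le> n \<Longrightarrow> psi m \<le> psi n"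
  unfolding psi_def by (intro sum_mono2) (auto simp: mangoldt_nonneg)

text \<open>Each \<open>ln m\<close> with m <= n is the sum of \<open>mangoldt d\<close> over the
  divisors d of m, and d divides \<open>n div d\<close> of these m. The free bound \<open>N\<close>
  lets factorials of different arguments share one range of summation; terms beyond n
  vanish.\<close>

lemma ln_fact_mangoldt:
  assumes "n \<le> N"
  shows "ln (fact n) = (\<Sum>d = 1..N. mangoldt d * real (n div d))"
  using assms
proof (induction n)
  case (Suc n)
  have div_Suc: "Suc n div d = n div d + (if d dvd Suc n then 1 else 0)" if "d \<ge> 1" for d
    using that by (auto simp: Suc_div_eq_add3_div div_Suc dvd_eq_mod_eq_0)
  have "ln (fact (Suc n) :: real) = ln (real (Suc n)) + ln (fact n)"
    by (simp add: ln_mult del: of_nat_Suc)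
  also have "ln (real (Suc n)) = (\<Sum>d | d dvd Suc n. mangoldt d)"
    by (subst mangoldt_sum) auto
  also have "\<dots> = (\<Sum>d = 1..N. if d dvd Suc n then mangoldt d else 0)"
  proof -
    have "{d. d dvd Suc n} = {1..N} \<inter> {d. d dvd Suc n}"
      using Suc.prems dvd_imp_le[of _ "Suc n"] by (fastforce simp: Suc_le_eq intro: Nat.gr0I)
    thus ?thesis using sum.inter_restrict[of "{1..N}" mangoldt "{d. d dvd Suc n}"] by simp
  qed
  also have "ln (fact n) = (\<Sum>d = 1..N. mangoldt d * real (n div d))"
    using Suc by simp
  finally show ?case
    by (simp add: sum.distrib[symmetric] div_Suc del: of_nat_Suc)
       (intro sum.cong, auto simp: div_Suc algebra_simps)
qed auto

text \<open>As \<open>1 - 1/2 - 1/3 - 1/5 + 1/30 = 0\<close>, the terms of order \<open>n * ln n\<close> in \<open>chebD\<close> below cancel.\<close>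

definition cheb :: "nat \<Rightarrow> int" where
  "cheb x = int x - int (x div 2) - int (x div 3) - int (x div 5) + int (x div 30)"

text \<open>Since 30 - 15 - 10 - 6 + 1 = 0, the value depends only on x modulo 30, which leaves
  thirty cases.\<close>

lemma cheb_bounds: "0 \<le> cheb x" "cheb x \<le> 1"
proof -
  define q r where "q = x div 30" and "r = x mod 30"
  have x: "x = 30 * q + r" by (simp add: q_def r_def)
  have "x div 2 = 15 * q + r div 2" "x div 3 = 10 * q + r div 3" "x div 5 = 6 * q + r div 5"
    unfolding x by auto
  hence c: "cheb x = int r - int (r div 2) - int (r div 3) - int (r div 5)"
    unfolding cheb_def q_def[symmetric] by (simp add: x)
  have "\<forall>r\<in>{..<30::nat}. 0 \<le> int r - int (r div 2) - int (r div 3) - int (r div 5) \<and>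
          int r - int (r div 2) - int (r div 3) - int (r div 5) \<le> 1"
    by code_simp
  hence "0 \<le> cheb x \<and> cheb x \<le> 1" unfolding c by (simp add: r_def)
  thus "0 \<le> cheb x" "cheb x \<le> 1" by auto
qed

lemma cheb_eq_1: "1 \<le> x \<Longrightarrow> x < 6 \<Longrightarrow> cheb x = 1"
  by (cases "x = 1 \<or> x = 2 \<or> x = 3 \<or> x = 4 \<or> x = 5") (auto simp: cheb_def)

definition chebD :: "nat \<Rightarrow> real" where
  "chebD n = ln (fact n) - ln (fact (n div 2)) - ln (fact (n div 3)) - ln (fact (n div 5))
             + ln (fact (n div 30))"

lemma chebD_eq: "chebD n = (\<Sum>d = 1..n. mangoldt d * of_int (cheb (n div d)))"
proof -
  have *: "n div a div d = n div d div a" for a d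
    by (simp add: div_mult2_eq[symmetric] mult.commute)
  show ?thesis unfolding chebD_def
    by (subst (1 2 3 4 5) ln_fact_mangoldt[where N = n])
       (simp_all add: cheb_def * sum.distrib sum_subtractf algebra_simps)
qed

lemma chebD_le_psi: "chebD n \<le> psi n"
  unfolding chebD_eq psi_def
proof (rule sum_mono)
  fix d
  show "mangoldt d * of_int (cheb (n div d)) \<le> (mangoldt d :: real)"
    using mult_left_mono[of "of_int (cheb (n div d))" 1 "mangoldt d :: real"] cheb_bounds[of "n div d"]
    by (simp add: mangoldt_nonneg)
qed

text \<open>For d > n/6 the quotient \<open>n div d\<close> lies between 1 and 5, where
  \<open>cheb\<close> is 1, so \<open>chebD n\<close> contains \<open>mangoldt d\<close> in full.
  The other d are paid by \<open>psi (n div 6)\<close>; iterating this costs the factor 1 + 1/6 +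
  1/36 + ... = 6/5.\<close>

lemma psi_le_chebD: "psi n \<le> psi (n div 6) + chebD n"
proof -
  have "psi n = (\<Sum>d\<in>{1..n}. mangoldt d)" by (simp add: psi_def)
  also have "\<dots> \<le> (\<Sum>d\<in>{1..n}. (if d \<le> n div 6 then mangoldt d else 0)
                      + mangoldt d * of_int (cheb (n div d)))"
  proof (rule sum_mono)
    fix d assume d: "d \<in> {1..n}"
    show "(mangoldt d :: real) \<le> (if d \<le> n div 6 then mangoldt d else 0) + mangoldt d * of_int (cheb (n div d)) "
    proof (cases "d \<le> n div 6")
      case True
      thus ?thesis using cheb_bounds[of "n div d"]
        mult_nonneg_nonneg[OF mangoldt_nonneg, of "of_int (cheb (n div d))" d] by simp
    next
      case False
      have "n div d \<ge> 1" using d by (simp add: Suc_le_eq div_greater_zero_iff)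
      moreover have "n div d < 6"
      proof (rule ccontr)
        assume "\<not> n div d < 6"
        hence "6 * d \<le> n" using d by (simp add: not_less less_eq_div_iff_mult_less_eq)
        hence "d \<le> n div 6" by (simp add: less_eq_div_iff_mult_less_eq mult.commute)
        thus False using False by simp
      qed
      ultimately show ?thesis using False by (simp add: cheb_eq_1)
    qed
  qed
  also have "\<dots> = (\<Sum>d\<in>{1..n}. (if d \<le> n div 6 then mangoldt d else 0)) + chebD n"
    by (simp add: sum.distrib chebD_eq)
  also have "(\<Sum>d\<in>{1..n}. (if d \<le> n div 6 then mangoldt d else 0)) = psi (n div 6)"
    unfolding psi_def by (rule sum.mono_neutral_cong_right) auto
  finally show ?thesis .
qed

section \<open>Stirling bounds for factorials\<close>

definition xlnx :: "real \<Rightarrow> real" where "xlnx x = x * ln x - x"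

lemma xlnx_mono: "1 \<le> x \<Longrightarrow> x \<le> y \<Longrightarrow> xlnx x \<le> xlnx y"
proof -
  assume "1 \<le> x" "x \<le> y"
  have "\<exists>d. (xlnx has_real_derivative d) (at t) \<and> d \<ge> 0" if "x \<le> t" "t \<le> y" for t
    using that \<open>1 \<le> x\<close> unfolding xlnx_def
    by (intro exI[of _ "ln t"] conjI) (auto intro!: derivative_eq_intros)
  thus ?thesis using DERIV_nonneg_imp_nondecreasing[OF \<open>x \<le> y\<close>] by blast
qed

lemma real_div_le: "real (n div m) \<le> n / m"
  by (metis of_nat_div_le_of_nat)

text \<open>The area under 1/x over [n, n + 1] lies between 1/(n + 1) and 1/n. The induction steps
  of the two Stirling bounds need exactly these inequalities.\<close>

lemma ln_diff_bounds:
  assumes "n \<ge> 1"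
  shows "real n * (ln (real n + 1) - ln n) \<le> 1" "(real n + 1) * (ln (real n + 1) - ln n) \<ge> 1"
proof -
  have "ln (1 + 1 / real n) \<le> 1 / n" using assms by (intro ln_add_one_self_le_self) auto
  moreover have eq: "ln (real n + 1) - ln n = ln (1 + 1 / real n)"
    using assms ln_div[of "real n + 1" n] by (simp add: add_divide_distrib)
  ultimately have "ln (real n + 1) - ln n \<le> 1 / n" by simp
  thus "real n * (ln (real n + 1) - ln n) \<le> 1" using assms by (simp add: field_simps)
  have "1 + (- 1 / (real n + 1)) = real n / (real n + 1)" by (simp add: field_simps)
  hence "ln (real n) - ln (real n + 1) = ln (1 + (- 1 / (real n + 1)))"
    using assms by (simp add: ln_div)
  also have "\<dots> \<le> - 1 / (real n + 1)"
    using assms by (intro ln_add_one_self_le_self2) (auto simp: field_simps)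
  finally show "(real n + 1) * (ln (real n + 1) - ln n) \<ge> 1" using assms by (simp add: field_simps)
qed

lemma ln_fact_ge: "n \<ge> 1 \<Longrightarrow> ln (fact n) \<ge> xlnx n + 1"
proof (induction n rule: nat_induct_at_least)
  case (Suc n)
  have "ln (fact (Suc n) :: real) = ln (real (Suc n)) + ln (fact n)"
    by (simp add: ln_mult del: of_nat_Suc)
  thus ?case using Suc ln_diff_bounds(1)[of n] by (simp add: xlnx_def algebra_simps)
qed (simp add: xlnx_def)

lemma ln_fact_le: "n \<ge> 1 \<Longrightarrow> ln (fact n) \<le> xlnx n + ln n + 1"
proof (induction n rule: nat_induct_at_least)
  case (Suc n)
  have "ln (fact (Suc n) :: real) = ln (real (Suc n)) + ln (fact n)"
    by (simp add: ln_mult del: of_nat_Suc)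
  thus ?case using Suc ln_diff_bounds(2)[of n] by (simp add: xlnx_def algebra_simps)
qed (simp add: xlnx_def)

lemma ln_fact_div_le:
  assumes "m \<ge> 1" "m \<le> n"
  shows "ln (fact (n div m)) \<le> xlnx (n / m) + ln (n / m) + 1"
proof -
  have "n div m \<ge> 1" using assms by (simp add: Suc_le_eq div_greater_zero_iff)
  moreover have "real (n div m) \<le> n / m" by (rule real_div_le)
  ultimately show ?thesis
    using ln_fact_le[of "n div m"] xlnx_mono[of "n div m" "n / m"] ln_mono[of "n div m" "n / m"]
    by linarith
qed

text \<open>Rounding down goes the wrong way here, so n/m is compared with q + 1, where
  \<open>q = n div m\<close>. Passing from (q + 1)! back to q! costs ln (q + 1) <= ln q + 1, and
  this 1 is offset by the constant in \<open>ln_fact_ge\<close>.\<close>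

lemma ln_fact_div_ge:
  assumes "m \<ge> 1" "m \<le> n"
  shows "ln (fact (n div m)) \<ge> xlnx (n / m) - ln (n / m)"
proof -
  define q where "q = n div m"
  have q: "q \<ge> 1" using assms by (simp add: Suc_le_eq div_greater_zero_iff q_def)
  have "real q \<le> n / m" unfolding q_def by (rule real_div_le)
  have "n < m + q * m" using assms dividend_less_div_times[of m n] unfolding q_def by simp
  hence "real n < real (m + q * m)" by linarith
  hence less: "n / m < real q + 1" using assms by (simp add: field_simps)
  have "xlnx (n / m) \<le> xlnx (real (Suc q))"
    using less q \<open>real q \<le> n / m\<close> by (intro xlnx_mono) auto
  also have "\<dots> \<le> ln (fact (Suc q)) - 1" using ln_fact_ge[of "Suc q"] by simp
  also have "\<dots> = ln (real q + 1) + ln (fact q) - 1"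
    using ln_mult[of "real q + 1" "fact q"] by (simp add: algebra_simps)
  also have "ln (real q + 1) \<le> ln q + 1"
  proof -
    have "1 * (ln (real q + 1) - ln q) \<le> q * (ln (real q + 1) - ln q)"
      using q by (intro mult_right_mono) auto
    thus ?thesis using ln_diff_bounds(1)[OF q] by (simp add: add.commute)
  qed
  also have "ln (real q) \<le> ln (n / m)" using \<open>real q \<le> n / m\<close> q by (intro ln_mono) auto
  finally show ?thesis by (simp add: q_def)
qed

text \<open>Chebyshev's constant 0.9212..., the linear growth rate of \<open>chebD\<close>.\<close>

definition chebB :: real where
  "chebB = ln 2 / 2 + ln 3 / 3 + ln 5 / 5 - ln 30 / 30"

lemma xlnx_comb:
  "x > 0 \<Longrightarrow> xlnx x - xlnx (x / 2) - xlnx (x / 3) - xlnx (x / 5) + xlnx (x / 30) = chebB * x"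
  by (simp add: xlnx_def chebB_def ln_div field_simps)

lemma chebD_bounds:
  assumes "n \<ge> 30"
  shows "chebD n \<le> chebB * n + 5 * ln n" "chebD n \<ge> chebB * n - 5 * ln n"
proof -
  have ln30: "ln (30::real) = ln 2 + ln 3 + ln 5"
    using ln_mult[of 2 3] ln_mult[of 6 5] by simp
  \<comment> \<open>Besides 5 ln n, the estimates leave an excess of 2 - 2 ln 30 in the upper and of
    3 - 2 ln 30 in the lower bound; neither is positive once ln 30 >= 3/2.\<close>
  have e: "exp (3 / 2) \<le> (30 :: real)"
  proof -
    have "exp (3 / 2 :: real) \<le> exp 2" by simp
    also have "\<dots> = exp 1 * exp (1::real)" by (simp add: exp_add[symmetric])
    also have "\<dots> \<le> 3 * 3" by (intro mult_mono exp_le) auto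
    finally show ?thesis by simp
  qed
  hence l: "3 / 2 \<le> ln (30::real)" using ln_ge_iff[of "30::real" "3 / 2"] by simp
  have up: "ln (fact (n div m)) \<le> xlnx (n / m) + (ln n - ln m) + 1"
    and lo: "ln (fact (n div m)) \<ge> xlnx (n / m) - (ln n - ln m)" if "0 < m" "m \<le> 30" for m
    using ln_fact_div_le[of m n] ln_fact_div_ge[of m n] that assms by (simp_all add: ln_div)
  have pos: "ln (2::real) > 0" "ln (3::real) > 0" "ln (5::real) > 0" by simp_all
  have x: "xlnx n - xlnx (n / 2) - xlnx (n / 3) - xlnx (n / 5) + xlnx (n / 30) = chebB * n"
    using assms by (intro xlnx_comb) auto
  show "chebD n \<le> chebB * n + 5 * ln n"
    using up[of 1] up[of 30] lo[of 2] lo[of 3] lo[of 5] x l ln30 pos unfolding chebD_def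
    by simp
  show "chebD n \<ge> chebB * n - 5 * ln n"
    using lo[of 1] lo[of 30] up[of 2] up[of 3] up[of 5] x l ln30 pos unfolding chebD_def
    by simp
qed

lemma ln_numeral_bounds:
  "(6931 / 10000) \<le> ln (2::real)" "ln (2::real) \<le> (6932 / 10000)"
  "(10986 / 10000) \<le> ln (3::real)" "ln (3::real) \<le> (10987 / 10000)"
  "(16094 / 10000) \<le> ln (5::real)" "ln (5::real) \<le> (16095 / 10000)"
proof -
  have 2: "ln (2::real) \<in> {0.69314..0.69315}"
    using ln_approx_bounds[of 2 5] by (simp add: eval_nat_numeral)
  have 32: "ln (3 / 2::real) \<in> {0.40546..0.40547}"
    using ln_approx_bounds[of "3 / 2" 4] by (simp add: eval_nat_numeral)
  have 54: "ln (5 / 4::real) \<in> {0.22314..0.22315}"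
    using ln_approx_bounds[of "5 / 4" 3] by (simp add: eval_nat_numeral)
  have "ln (3::real) = ln (3 / 2) + ln 2" "ln (5::real) = ln (5 / 4) + ln 2 + ln 2"
    using ln_mult[of "3 / 2" "2 :: real"] ln_mult[of "5 / 4" "4 :: real"] ln_mult[of 2 "2::real"] by simp_all
  thus "(6931 / 10000) \<le> ln (2::real)" "ln (2::real) \<le> (6932 / 10000)"
    "(10986 / 10000) \<le> ln (3::real)" "ln (3::real) \<le> (10987 / 10000)"
    "(16094 / 10000) \<le> ln (5::real)" "ln (5::real) \<le> (16095 / 10000)"
    using 2 32 54 by auto
qed

lemma ln_30: "ln (30::real) = ln 2 + ln 3 + ln 5"
  using ln_mult[of 2 3] ln_mult[of 6 5] by simp

lemma chebB_numeric: "(9212 / 10000) \<le> chebB" "chebB \<le> (9214 / 10000)"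
proof -
  have "chebB = 14 / 30 * ln 2 + 9 / 30 * ln 3 + 5 / 30 * ln 5"
    unfolding chebB_def ln_30 by (simp add: field_simps)
  thus "(9212 / 10000) \<le> chebB" "chebB \<le> (9214 / 10000)"
    using ln_numeral_bounds by linarith+
qed

text \<open>Induction through \<open>n div 6\<close>. The slope 1.1057 exceeds 6/5 of 0.9214, and
  the squared logarithm absorbs the error 5 ln n made in each of about log_6 n rounds. The constant
  75 covers n < 30, where psi n <= ln (29!).\<close>

lemma psi_le:
  assumes "n \<ge> 1"
  shows "psi n \<le> (11057 / 10000) * n + 2 * (ln n)\<^sup>2 + 75"
  using assms
proof (induction n rule: less_induct)
  case (less n)
  show ?case
  proof (cases "n < 30")
    case True
    have "psi n \<le> psi 29" using True by (intro psi_mono) auto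
    also have "psi 29 \<le> ln (fact 29)"
      unfolding psi_def ln_fact_mangoldt[OF order.refl]
    proof (rule sum_mono)
      fix d :: nat assume "d \<in> {1..29}"
      hence "1 \<le> 29 div d" by (simp add: Suc_le_eq div_greater_zero_iff)
      thus "mangoldt d \<le> mangoldt d * real (29 div d)"
        using mult_left_mono[of 1 "real (29 div d)" "mangoldt d"] by (simp add: mangoldt_nonneg)
    qed
    also have "\<dots> \<le> xlnx 29 + ln 29 + 1" using ln_fact_le[of 29] by simp
    also have "\<dots> \<le> 75"
    proof -
      have "ln (29::real) \<le> ln 30" by simp
      hence "ln (29::real) \<le> (3402 / 1000)" using ln_numeral_bounds unfolding ln_30 by linarith
      thus ?thesis unfolding xlnx_def by simp
    qed
    finally have "psi n \<le> 75" .
    moreover have "0 \<le> (11057 / 10000) * real n + 2 * (ln (real n))\<^sup>2" by simp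
    ultimately show ?thesis by linarith
  next
    case False
    define L where "L = ln (real n)"
    define l6 :: real where "l6 = ln 6"
    have l6: "l6 = ln 2 + ln 3" using ln_mult[of 2 "3::real"] by (simp add: l6_def)
    have n6: "n div 6 \<ge> 1" using False by simp
    have "ln (real (n div 6)) \<le> ln (n / 6)"
      using n6 real_div_le[of n 6] by (intro ln_mono) auto
    also have "\<dots> = L - l6" using False by (simp add: ln_div L_def l6_def)
    finally have "(ln (real (n div 6)))\<^sup>2 \<le> (L - l6)\<^sup>2" using n6 by (intro power_mono) auto
    moreover have "psi (n div 6) \<le> (11057 / 10000) * real (n div 6) + 2 * (ln (real (n div 6)))\<^sup>2 + 75"
      using less.IH[of "n div 6"] False n6 by simp
    moreover have "real (n div 6) \<le> n / 6" using real_div_le[of n 6] by simp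
    moreover have "psi n \<le> psi (n div 6) + chebB * n + 5 * L"
      using psi_le_chebD[of n] chebD_bounds(1)[of n] False by (simp add: L_def)
    moreover have "chebB * n \<le> (9214 / 10000) * n" using chebB_numeric by (intro mult_right_mono) auto
    \<comment> \<open>After expansion this is \<open>2 * l6^2 \<le> L * (4 * l6 - 5)\<close>, which
      holds from L = 3.4 on; n >= 30 provides that.\<close>
    moreover have "5 * L + 2 * (L - l6)\<^sup>2 \<le> 2 * L\<^sup>2"
    proof -
      have "L \<ge> ln 30" using False unfolding L_def by (intro ln_mono) auto
      hence L: "L \<ge> (34 / 10)" using ln_numeral_bounds unfolding ln_30 by linarith
      have l: "(179 / 100) \<le> l6" "l6 \<le> (1792 / 1000)" using ln_numeral_bounds unfolding l6 by auto
      have "2 * l6\<^sup>2 \<le> 2 * (1792 / 1000)\<^sup>2" using l by (intro mult_left_mono power_mono) auto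
      also have "\<dots> \<le> (34 / 10) * (216 / 100)" by (simp add: power2_eq_square)
      also have "\<dots> \<le> L * (4 * l6 - 5)" using L l by (intro mult_mono) auto
      finally show ?thesis by (simp add: power2_eq_square algebra_simps)
    qed
    ultimately show ?thesis unfolding L_def[symmetric] by linarith
  qed
qed

lemma psi_ge: "n \<ge> 30 \<Longrightarrow> psi n \<ge> (9212 / 10000) * n - 5 * ln n"
  using chebD_le_psi[of n] chebD_bounds(2)[of n] mult_right_mono[OF chebB_numeric(1), of "real n"]
  by linarith

lemma ln_tangent: "x > 0 \<Longrightarrow> a > 0 \<Longrightarrow> ln x \<le> ln a + (x - a) / (a::real)"
  using ln_le_minus_one[of "x / a"] by (simp add: ln_div field_simps)

text \<open>The tangent to ln at 200, where ln 200 - 1 < 4.3. Applied to s = sqrt n with n >= 40000,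
  it turns logarithmic estimates into inequalities between quadratic polynomials in s.\<close>

lemma ln_le_near_200: "s \<ge> 200 \<Longrightarrow> ln s \<le> (43 / 10) + s / (200::real)"
proof -
  assume s: "s \<ge> 200"
  have "ln (200::real) = ln 8 + 2 * ln 5"
    using ln_mult[of 8 "25 :: real"] ln_realpow[of "5::real" 2] by simp
  also have "ln (8::real) = 3 * ln 2" using ln_realpow[of "2::real" 3] by simp
  finally show ?thesis using ln_tangent[of s 200] s ln_numeral_bounds by (simp add: field_simps)
qed

text \<open>Only proper prime powers remain between m and n. Two powers of one prime differ by a
  factor of at least 2, which n <= 2m + 1 forbids, so each prime p <= sqrt n contributes at most
  once, and then ln p <= ln n / 2.\<close>

lemma sum_mangoldt_no_primes:
  assumes "\<And>p. prime p \<Longrightarrow> m < p \<Longrightarrow> p \<le> n \<Longrightarrow> False" and "n \<le> 2 * m + 1"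
  shows "psi n \<le> psi m + sqrt n * (ln n / 2)"
proof (cases "m \<le> n")
  case False
  thus ?thesis using psi_mono[of n m] by (cases "n = 0") (auto intro!: add_increasing2)
next
  case True
  define S where "S = {d\<in>{m<..n}. primepow d}"
  have S: "\<exists>p a. prime p \<and> a \<ge> 2 \<and> d = p ^ a" if "d \<in> S" for d
  proof -
    from that obtain p a where pa: "prime p" "a > 0" "d = p ^ a" "m < d" "d \<le> n"
      by (auto simp: S_def primepow_def)
    hence "a \<noteq> 1" using assms(1)[of p] by auto
    thus ?thesis using pa by (intro exI[of _ p] exI[of _ a]) auto
  qed
  have "psi n = psi m + (\<Sum>d\<in>{m<..n}. mangoldt d)"
  proof -
    have "{1..n} = {1..m} \<union> {m<..n}" using True by auto
    thus ?thesis unfolding psi_def by (simp add: sum.union_disjoint ivl_disj_int)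
  qed
  also have "(\<Sum>d\<in>{m<..n}. mangoldt d) = (\<Sum>d\<in>S. mangoldt d :: real)"
    unfolding S_def by (intro sum.mono_neutral_right) (auto simp: mangoldt_def)
  also have "\<dots> \<le> (\<Sum>d\<in>S. ln n / 2)"
  proof (rule sum_mono)
    fix d assume d: "d \<in> S"
    obtain p a where pa: "prime p" "a \<ge> 2" "d = p ^ a" using S[OF d] by blast
    have p0: "p > 0" using pa prime_gt_0_nat by blast
    have "p ^ 2 \<le> p ^ a" using pa p0 by (intro power_increasing) auto
    also have "\<dots> \<le> n" using d pa by (auto simp: S_def)
    finally have "ln (real (p ^ 2)) \<le> ln n" using p0 by (intro ln_mono) (auto simp del: of_nat_power)
    thus "mangoldt d \<le> ln n / 2" using pa p0 by (simp add: ln_realpow)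
  qed
  also have "\<dots> = card S * (ln n / 2)" by simp
  also have "card S \<le> card {1..nat \<lfloor>sqrt n\<rfloor>}"
  proof (rule card_inj_on_le[of aprimedivisor])
    show "inj_on aprimedivisor S"
    proof (rule inj_onI)
      have less: False if "prime p" "p ^ a \<in> S" "p ^ b \<in> S" "a < b" for p a b
      proof -
        have "2 * p ^ a \<le> p * p ^ a" using prime_ge_2_nat[OF that(1)] by simp
        also have "\<dots> = p ^ Suc a" by simp
        also have "\<dots> \<le> p ^ b" using that prime_gt_0_nat[OF that(1)] by (intro power_increasing) auto
        finally show False using that assms(2) by (auto simp: S_def)
      qed
      fix d e assume de: "d \<in> S" "e \<in> S" "aprimedivisor d = aprimedivisor e"
      obtain p a q b where pq: "prime p" "a \<ge> 2" "d = p ^ a" "prime q" "b \<ge> 2" "e = q ^ b"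
        using S de by metis
      have "p = q" using de(3) pq by (simp add: aprimedivisor_prime_power)
      thus "d = e" using less[of p a b] less[of p b a] pq de by (cases a b rule: linorder_cases) auto
    qed
    show "aprimedivisor ` S \<subseteq> {1..nat \<lfloor>sqrt n\<rfloor>}"
    proof safe
      fix d assume d: "d \<in> S"
      obtain p a where pa: "prime p" "a \<ge> 2" "d = p ^ a" using S[OF d] by blast
      have p0: "p > 0" using pa prime_gt_0_nat by blast
      have "p ^ 2 \<le> p ^ a" using pa p0 by (intro power_increasing) auto
      also have "\<dots> \<le> n" using d pa by (auto simp: S_def)
      finally have "real (p\<^sup>2) \<le> real n" by (rule of_nat_mono)
      hence "real p \<le> sqrt n" by (intro real_le_rsqrt) simp
      hence "p \<le> nat \<lfloor>sqrt n\<rfloor>" by (simp add: le_nat_floor)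
      thus "aprimedivisor d \<in> {1..nat \<lfloor>sqrt n\<rfloor>}"
        using pa p0 by (simp add: aprimedivisor_prime_power)
    qed
  qed simp
  hence "real (card S) * (ln n / 2) \<le> sqrt n * (ln n / 2)"
  proof (intro mult_right_mono)
    assume "card S \<le> card {1..nat \<lfloor>sqrt n\<rfloor>}"
    hence "real (card S) \<le> real (nat \<lfloor>sqrt n\<rfloor>)" by (subst of_nat_le_iff) simp
    also have "\<dots> \<le> sqrt n" by (intro of_nat_floor) simp
    finally show "real (card S) \<le> sqrt n" .
  qed (cases "n = 0", auto)
  finally show ?thesis by simp
qed

text \<open>Without such a prime, \<open>psi\<close> grows by at most sqrt n * ln n / 2 between 4n/5
  and n, whereas its bounds force a growth of (0.9212 - 0.8 * 1.1057) n > 0.036 n up to lower order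
  terms.\<close>

lemma exists_prime_four_fifths:
  fixes n :: nat
  assumes "n \<ge> 40000"
  shows "\<exists>p. prime p \<and> p \<le> n \<and> 4 * n < 5 * p"
proof (rule ccontr)
  assume *: "\<not> ?thesis"
  define m where "m = 4 * n div 5"
  define s where "s = sqrt n"
  have "sqrt 40000 \<le> s" using assms unfolding s_def by (intro real_sqrt_le_mono) simp
  moreover have "sqrt 40000 = (200::real)" by (rule real_sqrt_unique) auto
  ultimately have s: "s \<ge> 200" by simp
  have n: "real n = s\<^sup>2" by (simp add: s_def)
  define l where "l = ln s"
  have lnn: "ln (real n) = 2 * l" unfolding n l_def using s by (simp add: ln_realpow)
  have l0: "0 \<le> l" "l \<le> (43 / 10) + s / 200" using s ln_le_near_200[of s] by (simp_all add: l_def)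
  have "psi n \<le> psi m + s * l"
  proof -
    have "psi n \<le> psi m + sqrt n * (ln n / 2)"
    proof (rule sum_mangoldt_no_primes)
      show "n \<le> 2 * m + 1" unfolding m_def by linarith
    next
      fix p assume "prime p" "m < p" "p \<le> n"
      thus False using * unfolding m_def by (metis less_mult_imp_div_less mult.commute not_le less_imp_not_less div_less_iff_less_mult zero_less_numeral)
    qed
    thus ?thesis by (simp add: lnn s_def)
  qed
  moreover have "psi n \<ge> (9212 / 10000) * n - 10 * l" using psi_ge[of n] assms by (simp add: lnn)
  moreover have "psi m \<le> (11057 / 10000) * m + 2 * (ln m)\<^sup>2 + 75"
    using assms by (intro psi_le) (simp add: m_def)
  moreover have "real m \<le> 4 / 5 * n" unfolding m_def using real_div_le[of "4 * n" 5] by simp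
  moreover have "(ln (real m))\<^sup>2 \<le> (2 * l)\<^sup>2"
    using assms unfolding lnn[symmetric] m_def by (intro power_mono ln_mono) auto
  ultimately have "(9212 / 10000) * s\<^sup>2 - 10 * l \<le> (11057 / 10000) * (4 / 5) * s\<^sup>2 + 8 * l\<^sup>2 + 75 + s * l"
    unfolding n[symmetric] by (simp add: power_mult_distrib)
  also have "8 * l\<^sup>2 \<le> 8 * ((43 / 10) + s / 200)\<^sup>2" using l0 by (intro mult_left_mono power_mono) auto
  also have "s * l \<le> s * ((43 / 10) + s / 200)" using s l0 by (intro mult_left_mono) auto
  finally have "(9212 / 10000) * s\<^sup>2 - 10 * ((43 / 10) + s / 200) \<le>
      (11057 / 10000) * (4 / 5) * s\<^sup>2 + 8 * ((43 / 10) + s / 200)\<^sup>2 + 75 + s * ((43 / 10) + s / 200)"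
    using l0 by simp
  \<comment> \<open>The bound 4.3 + s/200 for the logarithm takes 0.005 + 0.0002 from the leading
    coefficient 0.0366. With s >= 200 the remaining inequality would give s <= 180.\<close>
  hence "(31 / 1000) * s\<^sup>2 \<le> (47 / 10) * s + 270" using zero_le_square[of s] s
    by (simp add: power2_eq_square algebra_simps)
  moreover have "(31 / 1000) * s\<^sup>2 \<ge> (31 / 1000) * (200 * s)" using s unfolding power2_eq_square
    by (intro mult_left_mono mult_right_mono) auto
  ultimately show False using s by simp
qed

section \<open>Large prime factors in short intervals\<close>

definition rough :: "nat \<Rightarrow> bool" where
  "rough i \<longleftrightarrow> i mod 2 \<noteq> 0 \<and> i mod 3 \<noteq> 0 \<and> i mod 5 \<noteq> 0 \<and> i mod 7 \<noteq> 0"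

primrec rough_count :: "nat \<Rightarrow> nat" where
  "rough_count 0 = 0"
| "rough_count (Suc x) = rough_count x + (if rough (Suc x) then 1 else 0)"

lemma rough_add: "rough (x + 210) = rough x"
proof -
  have "(x + 210) mod 2 = x mod 2" "(x + 210) mod 3 = x mod 3"
       "(x + 210) mod 5 = x mod 5" "(x + 210) mod 7 = x mod 7"
    by presburger+
  thus ?thesis by (simp add: rough_def)
qed

text \<open>One pass through a period: c accumulates the count up to a, and \<open>None\<close>
  signals a violated inequality. The 53 is the maximum of \<open>35 * rough_count x - 8 * x\<close>,
  attained at x = 199.\<close>

primrec rough_scan :: "nat \<Rightarrow> nat \<Rightarrow> nat \<Rightarrow> nat option" where
  "rough_scan 0 a c = Some c"
| "rough_scan (Suc n) a c = (if 35 * c \<le> 8 * a + 53 then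
     rough_scan n (a + 1) (if rough (a + 1) then c + 1 else c) else None)"

lemma rough_scan_numeral:
  "rough_scan (numeral v) a c = (if 35 * c \<le> 8 * a + 53 then
     rough_scan (pred_numeral v) (a + 1) (if rough (a + 1) then c + 1 else c) else None)"
  by (simp add: numeral_eq_Suc)

lemma rough_scan_eq_SomeD:
  assumes "rough_scan n a (rough_count a) = Some c"
  shows "rough_count (a + n) = c" "x < n \<Longrightarrow> 35 * rough_count (a + x) \<le> 8 * (a + x) + 53"
proof -
  from assms have "rough_count (a + n) = c \<and> (\<forall>x<n. 35 * rough_count (a + x) \<le> 8 * (a + x) + 53)"
  proof (induction n arbitrary: a)
    case (Suc n)
    have "rough_scan n (Suc a) (rough_count (Suc a)) = Some c" "35 * rough_count a \<le> 8 * a + 53"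
      using Suc.prems by (auto split: if_splits)
    thus ?case using Suc.IH[of "Suc a"] by (auto simp: less_Suc_eq_0_disj)
  qed simp
  thus "rough_count (a + n) = c" "x < n \<Longrightarrow> 35 * rough_count (a + x) \<le> 8 * (a + x) + 53" by auto
qed

lemma rough_scan_210: "rough_scan 210 0 0 = Some 48"
  by (simp add: rough_scan_numeral rough_def)

lemma rough_count_add: "rough_count (x + 210) = rough_count x + 48"
proof (induction x)
  case 0
  show ?case using rough_scan_eq_SomeD(1)[of 210 0 48] rough_scan_210 by simp
next
  case (Suc x)
  show ?case using Suc rough_add[of "Suc x"] unfolding add_Suc rough_count.simps by simp
qed

lemma rough_count_le: "35 * rough_count x \<le> 8 * x + 53"
proof (induction x rule: less_induct)
  case (less x)
  show ?case
  proof (cases "x < 210")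
    case True
    thus ?thesis using rough_scan_eq_SomeD(2)[of 210 0 48 x] rough_scan_210 by simp
  next
    case False
    then obtain y where "x = y + 210" by (metis le_add_diff_inverse2 not_less)
    thus ?thesis using less.IH[of y] rough_count_add[of y] by simp
  qed
qed

lemma rough_count_card: "rough_count x = card {i\<in>{1..x}. rough i}"
proof (induction x)
  case (Suc x)
  have "{i\<in>{1..Suc x}. rough i} = (if rough (Suc x) then insert (Suc x) {i\<in>{1..x}. rough i} else {i\<in>{1..x}. rough i})"
    by (auto simp: le_Suc_eq)
  thus ?case using Suc by simp
qed simp

text \<open>A prime is 2, 3, 5, 7, or coprime to 210 and not 1, whence 158 = 53 + 3 * 35. The
  density 48/210 = 8/35 gives about 16k/35 < k/2 primes up to 2k, as \<open>mid_window_prime\<close>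
  requires; sieving by 2, 3, 5 alone would give 8k/15.\<close>

lemma prime_count_le: "35 * card {p::nat. prime p \<and> p \<le> x} \<le> 8 * x + 158"
proof (cases "x = 0")
  case False
  have sub: "{p::nat. prime p \<and> p \<le> x} \<subseteq> {2,3,5,7} \<union> ({i\<in>{1..x}. rough i} - {1})"
  proof
    fix p assume "p \<in> {p::nat. prime p \<and> p \<le> x}"
    hence p: "prime p" "p \<le> x" by auto
    have "q = p" if "p mod q = 0" "q \<noteq> 1" for q
      using that p(1) mod_0_imp_dvd[of p q] unfolding prime_nat_iff by blast
    from this[of 2] this[of 3] this[of 5] this[of 7]
    have "p mod 2 = 0 \<longrightarrow> p = 2" "p mod 3 = 0 \<longrightarrow> p = 3" "p mod 5 = 0 \<longrightarrow> p = 5" "p mod 7 = 0 \<longrightarrow> p = 7"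
      by auto
    hence "p \<in> {2,3,5,7} \<or> rough p" unfolding rough_def by blast
    thus "p \<in> {2,3,5,7} \<union> ({i\<in>{1..x}. rough i} - {1})" using p prime_gt_1_nat[OF p(1)] by auto
  qed
  have "card {p::nat. prime p \<and> p \<le> x} \<le> card ({2,3,5,7} \<union> ({i\<in>{1..x}. rough i} - {1}))"
    by (rule card_mono[OF _ sub]) auto
  also have "\<dots> \<le> card {2,3,5,7::nat} + card ({i\<in>{1..x}. rough i} - {1})"
    by (rule card_Un_le)
  also have "card ({i\<in>{1..x}. rough i} - {1}) = rough_count x - 1"
    using False unfolding rough_count_card by (subst card_Diff_singleton) (auto simp: rough_def)
  finally have "card {p::nat. prime p \<and> p \<le> x} \<le> 4 + (rough_count x - 1)" by simp
  moreover have "rough_count x \<ge> 1"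
  proof -
    have "card {1::nat} \<le> card {i\<in>{1..x}. rough i}"
      using False by (intro card_mono) (auto simp: rough_def)
    thus ?thesis by (simp add: rough_count_card)
  qed
  ultimately show ?thesis using rough_count_le[of x] by linarith
next
  case True
  hence e: "{p. prime p \<and> p \<le> x} = {}" by auto
  show ?thesis unfolding e by simp
qed

text \<open>The denominators of the Leibniz harmonic triangle, \<open>leibniz n k = k * (n choose k)\<close>.\<close>

definition leibniz :: "nat \<Rightarrow> nat \<Rightarrow> nat" where
  "leibniz n k = n * ((n - 1) choose (k - 1))"

lemma leibniz_fact:
  assumes "1 \<le> k" "k \<le> n"
  shows "leibniz n k * fact (k - 1) * fact (n - k) = fact n"
proof -
  have "fact (k - 1) * fact (n - 1 - (k - 1)) * ((n - 1) choose (k - 1)) = (fact (n - 1) :: nat)"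
    using assms by (intro binomial_fact_lemma) auto
  moreover have "fact n = n * (fact (n - 1) :: nat)" using assms by (simp add: fact_reduce)
  moreover have "n - 1 - (k - 1) = n - k" using assms by simp
  ultimately show ?thesis by (simp add: leibniz_def mult_ac)
qed

lemma leibniz_pos: "1 \<le> k \<Longrightarrow> k \<le> n \<Longrightarrow> leibniz n k > 0"
  by (auto simp: leibniz_def)

lemma prod_window:
  assumes "1 \<le> k" "k \<le> n"
  shows "\<Prod>{n - k<..n} = leibniz n k * fact (k - 1)"
proof -
  have "{1..n} = {1..n - k} \<union> {n - k<..n}" using assms by auto
  hence "fact n = fact (n - k) * \<Prod>{n - k<..n}"
    unfolding fact_prod of_nat_id by (simp add: prod.union_disjoint ivl_disj_int)
  thus ?thesis using leibniz_fact[OF assms] by (simp add: mult_ac)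
qed

lemma multiplicity_le_diff:
  assumes "prime p" "multiplicity p a \<le> multiplicity p b" "a \<noteq> b" "a > 0" "b > 0"
  shows "multiplicity p (a::nat) \<le> multiplicity p (if a < b then b - a else a - b)"
proof (rule multiplicity_geI)
  have "p ^ multiplicity p a dvd a" by (rule multiplicity_dvd)
  moreover have "p ^ multiplicity p a dvd b" by (rule multiplicity_dvd'[OF assms(2)])
  ultimately show "p ^ multiplicity p a dvd (if a < b then b - a else a - b)"
    by (simp add: dvd_diff_nat)
qed (use assms in \<open>auto simp: prime_gt_1_nat\<close>)

text \<open>In a window of \<open>k\<close> consecutive numbers keep an element \<open>m\<close> of maximal valuation: the
  valuation of any other element is at most that of its distance to \<open>m\<close>.\<close>

lemma leibniz_prime_power_le:
  assumes "prime p" "1 \<le> k" "k \<le> n"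
  shows "p ^ multiplicity p (leibniz n k) \<le> n"
proof -
  define W where "W = {n - k<..n}"
  let ?v = "multiplicity p"
  have W: "finite W" "W \<noteq> {}" using assms by (auto simp: W_def)
  have "Max (?v ` W) \<in> ?v ` W" using W by (intro Max_in) auto
  then obtain m where "m \<in> W" "?v m = Max (?v ` W)" by auto
  hence m: "m \<in> W" "\<And>a. a \<in> W \<Longrightarrow> ?v a \<le> ?v m" using W by auto
  have v_prod: "?v (\<Prod>A) = sum ?v A" if "finite A" "0 \<notin> A" for A
    using prime_elem_multiplicity_prod_distrib[of p id A] that assms by auto
  have v_fact: "sum ?v {1..j} = ?v (fact j)" for j :: nat
    using v_prod[of "{1..j}"] by (simp add: fact_prod)
  have "sum ?v (W - {m}) = sum ?v {n - k<..<m} + sum ?v {m<..n}"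
  proof -
    have "W - {m} = {n - k<..<m} \<union> {m<..n}" using m by (auto simp: W_def)
    moreover have "{n - k<..<m} \<inter> {m<..n} = {}" by auto
    ultimately show ?thesis by (simp add: sum.union_disjoint)
  qed
  also have "sum ?v {n - k<..<m} \<le> (\<Sum>a\<in>{n - k<..<m}. ?v (m - a))"
  proof (rule sum_mono)
    fix a assume "a \<in> {n - k<..<m}"
    thus "?v a \<le> ?v (m - a)" using multiplicity_le_diff[of p a m] m(2)[of a] m(1) assms(1) by (auto simp: W_def)
  qed
  also have "\<dots> = sum ?v {1..m - (n - k) - 1}"
    using m by (intro sum.reindex_bij_witness[of _ "\<lambda>x. m - x" "\<lambda>x. m - x"]) (auto simp: W_def)
  also have "\<dots> = ?v (fact (m - (n - k) - 1))" by (rule v_fact)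
  also have "sum ?v {m<..n} \<le> (\<Sum>a\<in>{m<..n}. ?v (a - m))"
  proof (rule sum_mono)
    fix a assume "a \<in> {m<..n}"
    thus "?v a \<le> ?v (a - m)" using multiplicity_le_diff[of p a m] m(2)[of a] m(1) assms(1) by (auto simp: W_def)
  qed
  also have "\<dots> = sum ?v {1..n - m}"
    using m by (intro sum.reindex_bij_witness[of _ "\<lambda>x. m + x" "\<lambda>x. x - m"]) (auto simp: W_def)
  also have "\<dots> = ?v (fact (n - m))" by (rule v_fact)
  also have "?v (fact (m - (n - k) - 1)) + ?v (fact (n - m)) = ?v (fact (m - (n - k) - 1) * fact (n - m))"
    using assms by (subst prime_elem_multiplicity_mult_distrib) auto
  \<comment> \<open>The distances to m on both sides make two factorials whose arguments add up to k
    - 1. Their product divides (k - 1)!, the factor by which \<open>leibniz n k\<close> is smaller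
    than the window product, so only the valuation of m survives.\<close>
  also have "\<dots> \<le> ?v (fact (k - 1))"
  proof (rule dvd_imp_multiplicity_le)
    have "m - (n - k) - 1 + (n - m) = k - 1" using m assms by (auto simp: W_def)
    thus "fact (m - (n - k) - 1) * fact (n - m) dvd (fact (k - 1) :: nat)"
      using fact_fact_dvd_fact[of "m - (n - k) - 1" "n - m"] by metis
  qed simp
  finally have le: "sum ?v (W - {m}) \<le> ?v (fact (k - 1))" by simp
  have "?v (leibniz n k) + ?v (fact (k - 1)) = ?v (\<Prod>W)"
    using assms leibniz_pos[of k n] unfolding W_def prod_window[OF assms(2,3)]
    by (subst prime_elem_multiplicity_mult_distrib) auto
  also have "\<dots> = sum ?v W" using W by (intro v_prod) (auto simp: W_def)
  also have "\<dots> = ?v m + sum ?v (W - {m})" using W m by (simp add: sum.remove)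
  finally have "?v (leibniz n k) \<le> ?v m" using le by simp
  hence "p ^ ?v (leibniz n k) dvd m" by (rule multiplicity_dvd')
  moreover have "0 < m" "m \<le> n" using m by (auto simp: W_def)
  ultimately show ?thesis by (meson dvd_imp_le le_trans)
qed

lemma window_power_le:
  assumes "1 \<le> k" "k \<le> n"
  shows "(n - k + 1) ^ k \<le> leibniz n k * fact (k - 1)"
proof -
  have "(n - k + 1) ^ k = (\<Prod>m\<in>{n - k<..n}. n - k + 1)" using assms by simp
  also have "\<dots> \<le> \<Prod>{n - k<..n}" by (intro prod_mono) auto
  finally show ?thesis using prod_window[OF assms] by simp
qed

lemma leibniz_le_power_prime_count:
  assumes "1 \<le> k" "k \<le> n" and smooth: "\<And>p. prime p \<Longrightarrow> p dvd leibniz n k \<Longrightarrow> p \<le> y"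
  shows "leibniz n k \<le> n ^ card {p. prime p \<and> p \<le> y}"
proof -
  have "leibniz n k = (\<Prod>p\<in>prime_factors (leibniz n k). p ^ multiplicity p (leibniz n k))"
    using leibniz_pos[OF assms(1,2)] by (intro prime_factorization_nat) auto
  also have "\<dots> \<le> (\<Prod>p\<in>prime_factors (leibniz n k). n)"
    using leibniz_prime_power_le assms by (intro prod_mono) (auto simp: in_prime_factors_iff)
  also have "\<dots> = n ^ card (prime_factors (leibniz n k))" by simp
  also have "\<dots> \<le> n ^ card {p. prime p \<and> p \<le> y}"
    using assms by (intro power_increasing card_mono) (auto simp: in_prime_factors_iff)
  finally show ?thesis .
qed

text \<open>A prime with p^2 > n occurs at most once, because its power in
  \<open>leibniz n k\<close> is at most n; such primes contribute ln p and are collected by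
  \<open>psi y\<close>. Only primes up to sqrt n are charged a full ln n.\<close>

lemma ln_leibniz_le:
  assumes "1 \<le> k" "k \<le> n" and smooth: "\<And>p. prime p \<Longrightarrow> p dvd leibniz n k \<Longrightarrow> p \<le> y"
  shows "ln (leibniz n k) \<le> card {p. prime p \<and> p\<^sup>2 \<le> n} * ln n + psi y"
proof -
  define P where "P = prime_factors (leibniz n k)"
  have P: "finite P" "\<And>p. p \<in> P \<Longrightarrow> prime p \<and> p \<le> y"
    using smooth by (auto simp: P_def in_prime_factors_iff)
  have pos: "p > 0" if "p \<in> P" for p using P that prime_gt_0_nat by blast
  have fin: "finite {p::nat. prime p \<and> p\<^sup>2 \<le> n}"
    by (rule finite_subset[of _ "{..n}"]) (auto dest: power2_nat_le_imp_le)
  have "leibniz n k = (\<Prod>p\<in>P. p ^ multiplicity p (leibniz n k))"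
    unfolding P_def using leibniz_pos[OF assms(1,2)] by (intro prime_factorization_nat) auto
  hence "ln (real (leibniz n k)) = ln (\<Prod>p\<in>P. real (p ^ multiplicity p (leibniz n k)))"
    by (metis of_nat_prod)
  also have "\<dots> = (\<Sum>p\<in>P. ln (real (p ^ multiplicity p (leibniz n k))))"
    using pos by (intro ln_prod) (auto simp: P)
  also have "\<dots> \<le> (\<Sum>p\<in>P. (if p\<^sup>2 \<le> n then ln n else 0) + ln p)"
  proof (rule sum_mono)
    fix p assume p: "p \<in> P"
    let ?e = "multiplicity p (leibniz n k)"
    have le: "p ^ ?e \<le> n" using leibniz_prime_power_le[of p k n] P(2)[OF p] assms by auto
    show "ln (real (p ^ ?e)) \<le> (if p\<^sup>2 \<le> n then ln n else 0) + ln p"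
    proof (cases "p\<^sup>2 \<le> n")
      case True
      have "ln (real (p ^ ?e)) \<le> ln n" using le pos[OF p] by (intro ln_mono) (auto simp del: of_nat_power)
      moreover have "ln (real p) \<ge> 0" using pos[OF p] by simp
      ultimately show ?thesis using True by simp
    next
      case False
      have "?e < 2"
      proof (rule ccontr)
        assume "\<not> ?e < 2"
        hence "p ^ 2 \<le> p ^ ?e" using pos[OF p] by (intro power_increasing) auto
        thus False using le False by simp
      qed
      hence "p ^ ?e \<le> p ^ 1" using pos[OF p] by (intro power_increasing) auto
      hence "ln (real (p ^ ?e)) \<le> ln p" using pos[OF p] by (intro ln_mono) (auto simp del: of_nat_power)
      thus ?thesis using False by simp
    qed
  qed
  also have "\<dots> = (\<Sum>p\<in>P. if p\<^sup>2 \<le> n then ln n else 0) + (\<Sum>p\<in>P. ln p)"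
    by (simp add: sum.distrib)
  also have "(\<Sum>p\<in>P. if p\<^sup>2 \<le> n then ln n else 0) = card {p\<in>P. p\<^sup>2 \<le> n} * ln n"
    using P by (simp add: sum.inter_filter[symmetric])
  also have "\<dots> \<le> card {p. prime p \<and> p\<^sup>2 \<le> n} * ln n"
    using P assms fin by (intro mult_right_mono of_nat_mono card_mono) auto
  also have "(\<Sum>p\<in>P. ln (real p)) = (\<Sum>p\<in>P. mangoldt p)" using P by (intro sum.cong) auto
  also have "\<dots> \<le> psi y"
    unfolding psi_def using P pos by (intro sum_mono2) (auto simp: mangoldt_nonneg Suc_le_eq)
  finally show ?thesis by simp
qed

section \<open>Primality certificates and tables of windows\<close>

definition primes_211 :: "nat list" where "primes_211 =
  [2, 3, 5, 7, 11, 13, 17, 19, 23, 29, 31, 37, 41, 43, 47, 53, 59, 61, 67, 71, 73, 79, 83, 89,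
   97, 101, 103, 107, 109, 113, 127, 131, 137, 139, 149, 151, 157, 163, 167, 173, 179, 181,
   191, 193, 197, 199]"

primrec trial :: "nat \<Rightarrow> nat list \<Rightarrow> bool" where
  "trial n [] = True"
| "trial n (q # qs) = (if n < q * q then True else if n mod q = 0 then False else trial n qs)"

lemma trial_not_dvd:
  assumes "trial n qs" "sorted qs" "d \<in> set qs" "d * d \<le> n"
  shows "\<not> d dvd n"
  using assms
proof (induction qs)
  case (Cons q qs)
  have "q * q \<le> n"
  proof -
    have "q \<le> d" using Cons.prems by auto
    hence "q * q \<le> d * d" by (intro mult_mono) auto
    thus ?thesis using Cons.prems(4) by simp
  qed
  hence "n mod q \<noteq> 0" "trial n qs" using Cons.prems(1) by (auto split: if_splits)
  thus ?case using Cons by (auto simp: dvd_eq_mod_eq_0)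
qed simp

text \<open>Used to show that \<open>primes_211\<close> is complete: as 17^2 > 211, a number below
  211 without a prime factor up to 13 is itself a prime, so it has to be in the list.\<close>

primrec covered :: "nat list \<Rightarrow> nat list \<Rightarrow> bool" where
  "covered [] qs = True"
| "covered (x # xs) qs = ((x mod 2 = 0 \<or> x mod 3 = 0 \<or> x mod 5 = 0 \<or> x mod 7 = 0 \<or>
      x mod 11 = 0 \<or> x mod 13 = 0 \<or> x \<in> set qs) \<and> covered xs qs)"

lemma prime_less_211:
  assumes "prime d" "d < 211"
  shows "d \<in> set primes_211"
proof -
  have cov: "covered [2..<211] primes_211"
    by (simp add: upt_rec_numeral primes_211_def)
  have covD: "d \<in> set qs \<or> (\<exists>q\<in>{2,3,5,7,11,13}. d mod q = 0)"
    if "covered xs qs" "d \<in> set xs" for xs qs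
    using that
  proof (induction xs)
    case (Cons x xs)
    thus ?case by (cases "d = x") auto
  qed simp
  have "d \<in> set [2..<211]" using assms prime_ge_2_nat[of d] unfolding set_upt by simp
  from covD[OF cov this]
  have "d \<in> set primes_211 \<or> (\<exists>q\<in>{2,3,5,7,11,13}. d mod q = 0)" .
  moreover have "d = q" if "d mod q = 0" "q \<noteq> 1" for q
    using that assms(1) mod_0_imp_dvd[of d q] unfolding prime_nat_iff by blast
  ultimately show ?thesis unfolding primes_211_def by fastforce
qed

text \<open>A composite n below 211^2 has a prime divisor d < 211 with d^2 <= n, and trial division
  meets it. 211^2 = 44521 exceeds every number that is certified below.\<close>

lemma prime_by_trial_division:
  assumes "1 < n" "n < 211 * 211" "trial n primes_211"
  shows "prime n"
proof (rule ccontr)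
  assume "\<not> prime n"
  then obtain a b where ab: "n = a * b" "a \<noteq> 1" "b \<noteq> 1"
    using assms(1) unfolding prime_nat_iff by (metis dvd_def mult.right_neutral)
  have *: False if ab: "n = a * b" "a \<noteq> 1" "a \<le> b" for a b
  proof -
    obtain d where d: "prime d" "d dvd a" using prime_factor_nat[OF ab(2)] by blast
    have "a > 0" using ab assms(1) by (cases a) auto
    hence "d \<le> a" using d by (intro dvd_imp_le) auto
    hence dd: "d * d \<le> n" using ab by (simp add: mult_mono)
    have "d < 211"
    proof (rule ccontr)
      assume "\<not> d < 211"
      hence "211 * 211 \<le> d * d" by (intro mult_mono) auto
      thus False using assms(2) dd by simp
    qed
    moreover have "sorted primes_211" by (simp add: primes_211_def)
    ultimately show False
      using trial_not_dvd[OF assms(3) _ prime_less_211[OF d(1)] dd] d ab by auto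
  qed
  show False
    using *[of a b] *[of b a] ab by (cases "a \<le> b") (auto simp: mult.commute)
qed

lemma successively_cover:
  assumes "successively R xs" "xs \<noteq> []" "hd xs \<le> n" "n < last xs"
  shows "\<exists>a\<in>set xs. \<exists>b\<in>set xs. R a b \<and> a \<le> n \<and> n < (b::nat)"
  using assms
proof (induction xs rule: induct_list012)
  case (3 x y xs)
  show ?case
  proof (cases "n < y")
    case True
    thus ?thesis using 3 by auto
  next
    case False
    thus ?thesis using "3.IH"(2) "3.prems" by auto
  qed
qed auto

text \<open>Gaps are at most 20 up to 907 and at most 2 sqrt p from there on. A prime-free window
  ending at n has length k <= n - p for the preceding entry p, so either k < 20, or k^2 < 4n and n
  >= 900; these are the two ranges of k treated by other means.\<close>

definition prime_list :: "nat list" where "prime_list =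
  [2, 3, 5, 7, 13, 23, 43, 61, 79, 97, 113, 131, 151, 167, 181, 199, 211, 229, 241, 257, 277,
   293, 313, 331, 349, 367, 383, 401, 421, 439, 457, 467, 487, 503, 523, 541, 557, 577, 593,
   613, 631, 647, 661, 677, 691, 709, 727, 743, 761, 773, 787, 797, 811, 829, 839, 859, 877,
   887, 907, 967, 1021, 1069, 1129, 1193, 1259, 1327, 1399, 1471, 1543, 1621, 1699, 1777,
   1861, 1933, 2017, 2099, 2179, 2269, 2357, 2447, 2543, 2633, 2731, 2833, 2939, 3041, 3137,
   3229, 3331, 3433, 3547, 3659, 3779, 3889, 4013, 4139, 4261, 4391, 4523, 4657, 4793, 4931,
   5059, 5197, 5333, 5479, 5623, 5749, 5897, 6047, 6199, 6353, 6491, 6637, 6793, 6949, 7109,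
   7253, 7417, 7589, 7759, 7933, 8111, 8291, 8467, 8647, 8831, 9013, 9199, 9377, 9551, 9743,
   9931, 10111, 10303, 10501, 10691, 10891, 11093, 11299, 11503, 11717, 11933, 12149, 12347,
   12569, 12791, 13009, 13229, 13457, 13687, 13913, 14143, 14369, 14593, 14831, 15073, 15313,
   15559, 15803, 16033, 16273, 16519, 16763, 17021, 17257, 17519, 17783, 18049, 18313, 18583,
   18839, 19087, 19333, 19609, 19889, 20161, 20443, 20719, 21001, 21283, 21569, 21859, 22153,
   22447, 22741, 23041, 23339, 23633, 23929, 24229, 24533, 24841, 25153, 25469, 25771, 26083,
   26399, 26723, 27043, 27367, 27697, 28027, 28351, 28687, 29023, 29363, 29683, 30013, 30347,
   30689, 31039, 31391, 31741, 32089, 32443, 32803, 33161, 33521, 33871, 34231, 34591, 34961,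
   35327, 35677, 36037, 36389, 36767, 37139, 37517, 37897, 38281, 38671, 39047, 39439, 39829,
   40213]"

primrec prime_checks :: "nat list \<Rightarrow> bool" where
  "prime_checks [] = True"
| "prime_checks (p # ps) = (1 < p \<and> p < 211 * 211 \<and> trial p primes_211 \<and> prime_checks ps)"

lemma prime_list_prime: "p \<in> set prime_list \<Longrightarrow> prime p"
proof -
  have "prime_checks prime_list" unfolding prime_list_def by (simp add: primes_211_def)
  moreover have "prime_checks xs \<Longrightarrow> p \<in> set xs \<Longrightarrow> prime p" for xs
    by (induction xs) (auto intro: prime_by_trial_division)
  moreover assume "p \<in> set prime_list"
  ultimately show ?thesis by blast
qed

lemma prime_below:
  fixes n :: nat
  assumes "2 \<le> n" "n < 40000"
  shows "\<exists>p. prime p \<and> p \<le> n \<and> n < 2 * p \<and> (n < p + 20 \<or> 900 \<le> n \<and> (n - p)\<^sup>2 < 4 * n)"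
proof -
  have "successively (\<lambda>a b. b \<le> 2 * a \<and> (b \<le> a + 20 \<or> 900 \<le> a \<and> (b - a)\<^sup>2 \<le> 4 * a)) prime_list"
    unfolding prime_list_def by simp
  moreover have "prime_list \<noteq> []" "hd prime_list \<le> n" "n < last prime_list"
    using assms by (auto simp: prime_list_def)
  ultimately obtain a b where ab: "a \<in> set prime_list" "a \<le> n" "n < b" "b \<le> 2 * a"
      "b \<le> a + 20 \<or> 900 \<le> a \<and> (b - a)\<^sup>2 \<le> 4 * a"
    using successively_cover[of _ prime_list n] by blast
  have "(n - a)\<^sup>2 < (b - a)\<^sup>2" using ab by (intro power_strict_mono) auto
  thus ?thesis using ab prime_list_prime[of a] by (intro exI[of _ a]) auto
qed

text \<open>An entry \<open>(k, xs)\<close> lists pairs \<open>(m, p)\<close> with \<open>p\<close> a prime divisor of \<open>m\<close>, where the numbers \<open>m\<close> start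
  at 11 and leave no gap larger than \<open>k\<close>. From the end of the list on, a window of length \<open>k \<ge> 5\<close> is
  treated by \<open>small_window_contradiction\<close>.\<close>

definition window_table :: "(nat \<times> (nat \<times> nat) list) list" where "window_table =
  [(2, [(11,11), (13,13), (15,5), (17,17), (19,19), (21,7), (23,23), (25,5), (26,13), (28,7),
     (30,5)]),
   (3, [(11,11), (14,7), (17,17), (19,19), (22,11), (23,23), (26,13), (29,29)]),
   (4, [(11,11), (13,13), (17,17), (19,19), (23,23), (26,13), (29,29)]),
   (5, [(11,11), (13,13), (17,17), (22,11), (26,13), (31,31), (34,17), (39,13)]),
   (6, [(11,11), (17,17), (23,23), (29,29), (34,17), (39,13), (43,43), (47,47), (53,53), (59,59),
     (65,13), (71,71), (76,19), (82,41), (87,29), (93,31), (97,97), (103,103), (109,109),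
     (115,23), (119,17), (124,31), (130,13), (136,17), (142,71)]),
   (7, [(11,11), (17,17), (23,23), (29,29), (34,17), (41,41), (47,47), (53,53), (59,59), (62,31),
     (69,23), (76,19), (83,83), (89,89), (95,19), (102,17), (109,109), (116,29), (123,41),
     (129,43), (136,17), (142,71), (149,149), (155,31), (161,23), (167,167), (174,29),
     (181,181), (188,47), (194,97), (201,67), (207,23), (214,107), (221,17), (228,19),
     (235,47), (241,241), (248,31), (255,17), (262,131), (269,269), (276,23), (283,283),
     (290,29), (296,37), (303,101), (310,31), (317,317), (323,19), (329,47), (335,67),
     (342,19), (349,349), (356,89), (362,181), (369,41), (376,47), (383,383), (389,389),
     (395,79), (402,67), (409,409), (415,83), (422,211), (428,107), (435,29), (442,17),
     (449,449), (456,19), (463,463), (470,47), (477,53), (483,23), (489,163), (496,31),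
     (503,503), (510,17), (517,47), (524,131), (531,59), (538,269), (545,109), (552,23),
     (559,43), (566,283), (573,191), (580,29), (587,587), (593,593), (599,599), (606,101),
     (613,613), (620,31), (627,19), (634,317), (641,641), (647,647), (654,109), (661,661),
     (668,167), (674,337), (681,227), (688,43), (695,139), (701,701), (708,59), (714,17),
     (721,103), (727,727), (734,367), (741,19), (748,17), (755,151)]),
   (8, [(11,11), (19,19), (23,23), (31,31), (38,19), (46,23), (53,53), (61,61), (69,23), (76,19),
     (83,83), (89,89)]),
   (9, [(11,11), (19,19), (23,23), (31,31), (38,19), (47,47), (53,53), (62,31), (71,71), (79,79),
     (87,29), (95,19), (103,103), (111,37), (118,59), (127,127), (134,67), (142,71),
     (151,151), (159,53), (167,167), (174,29), (183,61), (191,191), (199,199), (207,23),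
     (215,43), (223,223), (232,29)]),
   (10, [(11,11), (19,19), (29,29), (37,37), (47,47), (53,53), (62,31), (71,71), (79,79), (89,89),
     (97,97), (107,107), (116,29), (124,31), (134,67), (142,71), (151,151), (161,23),
     (167,167), (177,59), (186,31), (194,97), (203,29), (213,71), (223,223), (233,233),
     (241,241), (251,251), (261,29), (271,271), (281,281), (291,97), (301,43), (311,311),
     (321,107), (331,331), (341,31), (349,349), (359,359), (369,41), (379,379), (389,389),
     (398,199), (407,37), (417,139), (427,61), (437,23), (447,149), (457,457), (467,467),
     (477,53), (487,487), (497,71), (506,23), (516,43), (526,263), (536,67), (545,109),
     (555,37), (565,113), (575,23), (584,73), (593,593), (603,67), (613,613), (623,89),
     (633,211), (643,643)]),
   (11, [(11,11), (19,19), (29,29), (37,37), (47,47), (58,29), (69,23), (79,79), (89,89), (97,97),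
     (107,107), (118,59), (129,43), (139,139), (149,149), (159,53), (167,167), (178,89)]),
   (12, [(11,11), (23,23), (31,31), (43,43), (53,53), (62,31), (74,37), (86,43), (97,97),
     (109,109), (118,59), (129,43), (141,47), (151,151), (163,163), (174,29), (186,31),
     (197,197), (206,103), (218,109), (229,229), (241,241), (251,251), (263,263), (274,137),
     (284,71), (296,37), (307,307), (319,29), (331,331), (341,31), (353,353), (365,73),
     (377,29)]),
   (13, [(11,11), (23,23), (31,31), (43,43), (53,53), (62,31), (74,37), (87,29), (97,97),
     (109,109), (122,61), (134,67), (146,73), (159,53), (172,43)]),
   (14, [(11,11), (23,23), (37,37), (47,47), (61,61), (74,37), (87,29), (101,101), (113,113)]),
   (15, [(11,11), (23,23), (37,37), (47,47), (62,31), (74,37), (89,89), (103,103), (118,59),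
     (131,131), (146,73), (159,53), (173,173), (188,47)]),
   (16, [(11,11), (23,23), (37,37), (53,53), (67,67), (83,83), (97,97), (113,113), (129,43),
     (142,71), (158,79), (173,173), (188,47), (202,101), (218,109), (233,233), (249,83),
     (265,53), (281,281), (296,37)]),
   (17, [(11,11), (23,23), (37,37), (53,53), (67,67), (83,83), (97,97), (113,113), (129,43),
     (146,73), (163,163), (179,179), (194,97)]),
   (18, [(11,11), (29,29), (47,47), (61,61), (79,79), (97,97), (113,113), (131,131), (149,149)]),
   (19, [(11,11), (29,29), (47,47), (61,61), (79,79), (97,97), (113,113), (131,131), (149,149),
     (167,167), (183,61), (202,101), (219,73)])]"

fun window_checks :: "nat \<Rightarrow> (nat \<times> nat) list \<Rightarrow> bool" where
  "window_checks k [] = True"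
| "window_checks k ((m, p) # xs) = (m mod p = 0 \<and> (if 2 * k < p then True else p = m) \<and> 1 < p \<and>
      p < 211 * 211 \<and> trial p primes_211 \<and> window_checks k xs)"

fun table_checks :: "(nat \<times> (nat \<times> nat) list) list \<Rightarrow> bool" where
  "table_checks [] = True"
| "table_checks ((k, xs) # ys) = (xs \<noteq> [] \<and> fst (hd xs) = 11 \<and>
      successively (\<lambda>a b. fst b \<le> fst a + k) xs \<and> window_checks k xs \<and> table_checks ys)"

lemma window_checksD:
  "window_checks k xs \<Longrightarrow> (m, p) \<in> set xs \<Longrightarrow> m mod p = 0 \<and> (2 * k < p \<or> p = m) \<and> prime p"
  by (induction k xs rule: window_checks.induct) (auto intro: prime_by_trial_division split: if_splits)

lemma table_checksD:
  "table_checks ys \<Longrightarrow> (k, xs) \<in> set ys \<Longrightarrow> xs \<noteq> [] \<and> fst (hd xs) = 11 \<and>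
      successively (\<lambda>a b. fst b \<le> fst a + k) xs \<and> window_checks k xs"
  by (induction ys rule: table_checks.induct) auto

lemma window_table_correct:
  assumes "(k, xs) \<in> set window_table" "11 \<le> n" "n < fst (last xs) + k"
  shows "\<exists>m p. n < m + k \<and> m \<le> n \<and> prime p \<and> p dvd m \<and> (2 * k < p \<or> p = m)"
proof -
  have "table_checks window_table" unfolding window_table_def by (simp add: primes_211_def)
  from table_checksD[OF this assms(1)]
  have xs: "xs \<noteq> []" "fst (hd xs) = 11" "successively (\<lambda>a b. fst b \<le> fst a + k) xs"
    and mp: "\<And>m p. (m, p) \<in> set xs \<Longrightarrow> m mod p = 0 \<and> (2 * k < p \<or> p = m) \<and> prime p"
    using window_checksD by blast+
  have "\<exists>m\<in>set (map fst xs). n < m + k \<and> m \<le> n"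
  proof (cases "n < last (map fst xs)")
    case True
    have "successively (\<lambda>a b. b \<le> a + k) (map fst xs)" using xs by (simp add: successively_map)
    from successively_cover[OF this _ _ True] xs assms(2) show ?thesis
      by (force simp: hd_map)
  next
    case False
    thus ?thesis using assms xs by (intro bexI[of _ "last (map fst xs)"]) (auto simp: last_map)
  qed
  then obtain m p where "(m, p) \<in> set xs" "n < m + k" "m \<le> n" by auto
  thus ?thesis using mp[of m p] mod_0_imp_dvd[of m p] by blast
qed

text \<open>The quotient (n + 1 - k)/n does not decrease with n, and for j <= k neither does (n + 1
  - k)^k / n^j. One numerical check at \<open>N\<close> thus settles all larger n.\<close>

lemma power_window_mono:
  fixes N n k c j :: nat
  assumes "c * N ^ j < (N + 1 - k) ^ k" "j \<le> k" "N \<le> n" "k \<le> N" "1 \<le> k"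
  shows "c * n ^ j < (n + 1 - k) ^ k"
proof -
  have "(N + 1 - k) * n \<le> (n + 1 - k) * N"
  proof -
    obtain d e where "N = k + d" "n = N + e" using assms by (metis le_iff_add)
    thus ?thesis using assms(5) by (cases k) (auto simp: algebra_simps)
  qed
  hence "((N + 1 - k) * n) ^ j \<le> ((n + 1 - k) * N) ^ j" by (intro power_mono) auto
  moreover have "(N + 1 - k) ^ (k - j) \<le> (n + 1 - k) ^ (k - j)" using assms by (intro power_mono) auto
  ultimately have "((N + 1 - k) * n) ^ j * (N + 1 - k) ^ (k - j) \<le> ((n + 1 - k) * N) ^ j * (n + 1 - k) ^ (k - j)"
    by (rule mult_mono) auto
  hence "(N + 1 - k) ^ k * n ^ j \<le> (n + 1 - k) ^ k * N ^ j"
    using assms(2) by (simp add: power_mult_distrib mult_ac power_add[symmetric] flip: mult.assoc)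
  moreover have "(c * N ^ j) * n ^ j < (N + 1 - k) ^ k * n ^ j"
    using assms by (intro mult_strict_right_mono) auto
  ultimately have "(c * n ^ j) * N ^ j < (n + 1 - k) ^ k * N ^ j" unfolding mult.assoc
    using mult.commute[of "n ^ j" "N ^ j"] by (metis order.strict_trans2)
  thus ?thesis by (rule mult_right_less_imp_less) simp
qed

text \<open>If all prime factors were at most 2k, then \<open>(n - k + 1) ^ k \<le> fact (k - 1) *
  leibniz n k \<le> fact (k - 1) * n ^ j\<close>, against the check at \<open>N\<close> carried over
  to n.\<close>

lemma small_window_contradiction:
  assumes "1 \<le> k" "k \<le> N" "N \<le> n" "card {p. prime p \<and> p \<le> 2 * k} \<le> j" "j \<le> k"
    and "fact (k - 1) * N ^ j < (N + 1 - k) ^ k"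
  shows "\<exists>p. prime p \<and> p dvd leibniz n k \<and> 2 * k < p"
proof (rule ccontr)
  assume "\<not> ?thesis"
  hence "leibniz n k \<le> n ^ card {p. prime p \<and> p \<le> 2 * k}"
    using assms by (intro leibniz_le_power_prime_count) (auto simp: not_less)
  also have "\<dots> \<le> n ^ j" using assms by (intro power_increasing) auto
  finally have "leibniz n k * fact (k - 1) \<le> n ^ j * fact (k - 1)" by simp
  moreover have "(n - k + 1) ^ k \<le> leibniz n k * fact (k - 1)" using assms by (intro window_power_le) auto
  moreover have "fact (k - 1) * n ^ j < (n + 1 - k) ^ k"
    by (rule power_window_mono[OF assms(6,5,3,2,1)])
  moreover have "n + 1 - k = n - k + 1" using assms by simp
  ultimately show False by (metis mult.commute not_le order.strict_trans2 order.trans)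
qed

lemma leibniz_dvd_window:
  assumes "1 \<le> k" "k \<le> n" "prime p" "p dvd leibniz n k"
  shows "\<exists>m. n < m + k \<and> m \<le> n \<and> p dvd m"
proof -
  have "p dvd (\<Prod>m\<in>{n - k<..n}. m)" using assms prod_window[of k n] by simp
  then obtain m where "m \<in> {n - k<..n}" "p dvd m" using assms(3) by (auto simp: prime_dvd_prod_iff)
  thus ?thesis using assms by (intro exI[of _ m]) auto
qed

text \<open>\<open>fst (last xs) + k\<close> is the first n that the table leaves open. Lengths
  below 5 are skipped: for k = 2, 3, 4 there are exactly k primes up to 2k, so the estimate gains no
  power of n and never holds.\<close>

fun power_checks :: "nat list \<Rightarrow> (nat \<times> (nat \<times> nat) list) list \<Rightarrow> bool" where
  "power_checks cs [] = True"
| "power_checks cs ((k, xs) # ys) = ((if k < 5 then True else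
      length (filter (\<lambda>p. p \<le> 2 * k) cs) \<le> k \<and>
      fact (k - 1) * (fst (last xs) + k) ^ length (filter (\<lambda>p. p \<le> 2 * k) cs) < (fst (last xs) + k + 1 - k) ^ k)
      \<and> power_checks cs ys)"

lemma power_checksD:
  "power_checks cs ys \<Longrightarrow> (k, xs) \<in> set ys \<Longrightarrow> 5 \<le> k \<Longrightarrow> length (filter (\<lambda>p. p \<le> 2 * k) cs) \<le> k \<and>
      fact (k - 1) * (fst (last xs) + k) ^ length (filter (\<lambda>p. p \<le> 2 * k) cs) < (fst (last xs) + k + 1 - k) ^ k"
  by (induction cs ys rule: power_checks.induct) (auto split: if_splits)

lemma window_5_20:
  fixes k n :: nat
  assumes "5 \<le> k" "k < 20" "11 \<le> n" "k \<le> n"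
  shows "\<exists>m p. n < m + k \<and> m \<le> n \<and> prime p \<and> p dvd m \<and> (2 * k < p \<or> p = m)"
proof -
  define cs :: "nat list" where "cs = [2, 3, 5, 7, 11, 13, 17, 19, 23, 29, 31, 37]"
  have count: "card {p::nat. prime p \<and> p \<le> 2 * k} \<le> length (filter (\<lambda>p. p \<le> 2 * k) cs)"
  proof -
    have "{p::nat. prime p \<and> p \<le> 2 * k} \<subseteq> set (filter (\<lambda>p. p \<le> 2 * k) cs)"
    proof
      fix p assume "p \<in> {p::nat. prime p \<and> p \<le> 2 * k}"
      hence p: "prime p" "p \<le> 2 * k" by auto
      have "p \<in> set primes_211" using p assms by (intro prime_less_211) auto
      hence "p \<in> set cs" using p assms by (auto simp: primes_211_def cs_def)
      thus "p \<in> set (filter (\<lambda>p. p \<le> 2 * k) cs)" using p by simp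
    qed
    hence "card {p::nat. prime p \<and> p \<le> 2 * k} \<le> card (set (filter (\<lambda>p. p \<le> 2 * k) cs))"
      by (intro card_mono) auto
    thus ?thesis using card_length le_trans by blast
  qed
  have power: "power_checks cs window_table"
    unfolding window_table_def cs_def by (simp add: fact_numeral)
  have "\<exists>xs. (k, xs) \<in> set window_table"
  proof -
    have "k \<in> set [5..<20]" using assms unfolding set_upt by simp
    also have "set [5..<20] \<subseteq> fst ` set window_table" by (simp add: upt_rec_numeral window_table_def)
    finally show ?thesis by force
  qed
  then obtain xs where xs: "(k, xs) \<in> set window_table"
     "length (filter (\<lambda>p. p \<le> 2 * k) cs) \<le> k"
     "fact (k - 1) * (fst (last xs) + k) ^ length (filter (\<lambda>p. p \<le> 2 * k) cs) < (fst (last xs) + k + 1 - k) ^ k"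
    using assms(1) power_checksD[OF power] by fastforce
  show ?thesis
  proof (cases "n < fst (last xs) + k")
    case True
    thus ?thesis using window_table_correct[OF xs(1) assms(3)] by blast
  next
    case False
    have "\<exists>p. prime p \<and> p dvd leibniz n k \<and> 2 * k < p"
      by (rule small_window_contradiction[OF _ _ _ count xs(2,3)]) (use assms False in auto)
    then obtain p where p: "prime p" "p dvd leibniz n k" "2 * k < p" by blast
    thus ?thesis using leibniz_dvd_window[of k n p] assms by auto
  qed
qed

text \<open>The exponent is the sieve bound for the number of primes up to 2k. The base is a lower
  bound for n: 900 below k = 60, and from there on k^2/4, which is then at least 900.\<close>

primrec checks_20_60 :: "nat list \<Rightarrow> bool" where
  "checks_20_60 [] = True"
| "checks_20_60 (k # ks) = ((16 * k + 158) div 35 \<le> k \<and>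
      fact (k - 1) * 900 ^ ((16 * k + 158) div 35) < (900 + 1 - k) ^ k \<and> checks_20_60 ks)"

primrec checks_60_70 :: "nat list \<Rightarrow> bool" where
  "checks_60_70 [] = True"
| "checks_60_70 (k # ks) = ((16 * k + 158) div 35 \<le> k \<and> k \<le> k * k div 4 \<and>
      fact (k - 1) * (k * k div 4) ^ ((16 * k + 158) div 35) < (k * k div 4 + 1 - k) ^ k \<and> checks_60_70 ks)"

lemma checks_20_60D: "checks_20_60 ks \<Longrightarrow> k \<in> set ks \<Longrightarrow> (16 * k + 158) div 35 \<le> k \<and>
      fact (k - 1) * 900 ^ ((16 * k + 158) div 35) < (900 + 1 - k) ^ k"
  by (induction ks) auto

lemma checks_60_70D: "checks_60_70 ks \<Longrightarrow> k \<in> set ks \<Longrightarrow> (16 * k + 158) div 35 \<le> k \<and> k \<le> k * k div 4 \<and>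
      fact (k - 1) * (k * k div 4) ^ ((16 * k + 158) div 35) < (k * k div 4 + 1 - k) ^ k"
  by (induction ks) auto

lemma window_20_70:
  fixes k n :: nat
  assumes "20 \<le> k" "k < 70" "k\<^sup>2 \<le> 4 * n" "900 \<le> n" "k \<le> n"
  shows "\<exists>m p. n < m + k \<and> m \<le> n \<and> prime p \<and> p dvd m \<and> 2 * k < p"
proof -
  define j where "j = (16 * k + 158) div 35"
  have card: "card {p::nat. prime p \<and> p \<le> 2 * k} \<le> j"
    unfolding j_def using prime_count_le[of "2 * k"] by (simp add: less_eq_div_iff_mult_less_eq mult.commute)
  have *: "checks_20_60 [20..<60]" and **: "checks_60_70 [60..<70]"
    by (simp_all add: upt_rec_numeral fact_numeral)
  have "\<exists>p. prime p \<and> p dvd leibniz n k \<and> 2 * k < p"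
  proof (cases "k < 60")
    case True
    hence "k \<in> set [20..<60]" using assms unfolding set_upt by simp
    hence "j \<le> k \<and> fact (k - 1) * 900 ^ j < (900 + 1 - k) ^ k"
      using checks_20_60D[OF *] unfolding j_def by blast
    thus ?thesis using small_window_contradiction[of k 900 n j] card assms True by simp
  next
    case False
    hence "k \<in> set [60..<70]" using assms unfolding set_upt by simp
    hence "j \<le> k \<and> k \<le> k * k div 4 \<and> fact (k - 1) * (k * k div 4) ^ j < (k * k div 4 + 1 - k) ^ k"
      using checks_60_70D[OF **] unfolding j_def by blast
    moreover have "k * k div 4 \<le> n" using assms(3) by (simp add: power2_eq_square)
    ultimately show ?thesis using small_window_contradiction[of k "k * k div 4" n j] card assms by simp
  qed
  thus ?thesis using leibniz_dvd_window[of k n] assms by (metis le_trans one_le_numeral)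
qed

section \<open>Analytic estimates for long windows\<close>

lemma entropy_ge_min:
  fixes n a b x c :: real
  assumes "0 < a" "a \<le> x" "x \<le> b" "b < n"
  defines "f \<equiv> \<lambda>x. n * ln n - x * ln x - (n - x) * ln (n - x) - c * x"
  shows "f x \<ge> min (f a) (f b)"
proof -
  have "concave_on {a..b} f"
  proof (rule f''_le0_imp_concave)
    fix y assume y: "y \<in> {a..b}"
    show "(f has_real_derivative (ln (n - y) - ln y - c)) (at y)"
      unfolding f_def using y assms by (auto intro!: derivative_eq_intros)
    show "((\<lambda>y. ln (n - y) - ln y - c) has_real_derivative (- 1 / (n - y) - 1 / y)) (at y)"
      using y assms by (auto intro!: derivative_eq_intros simp: field_simps)
    show "- 1 / (n - y) - 1 / y \<le> 0" using y assms by (auto simp: field_simps)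
  qed simp
  thus ?thesis using concave_on_ge_min[of a b f x] assms(2,3) by auto
qed

lemma ln_leibniz_ge:
  assumes "1 \<le> k" "k < n"
  shows "ln (leibniz n k) \<ge> n * ln n - k * ln k - real (n - k) * ln (real (n - k)) - ln n - 1"
proof -
  have "real (leibniz n k) * fact (k - 1) * fact (n - k) = fact n"
    using leibniz_fact[of k n] assms by (metis less_imp_le of_nat_fact of_nat_mult)
  hence "ln (fact n :: real) = ln (real (leibniz n k) * fact (k - 1) * fact (n - k))" by simp
  also have "\<dots> = ln (real (leibniz n k)) + ln (fact (k - 1)) + ln (fact (n - k))"
    using leibniz_pos[of k n] assms by (simp add: ln_mult)
  finally have *: "ln (real (leibniz n k)) = ln (fact n) - ln (fact (k - 1)) - ln (fact (n - k))" by simp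
  have "ln (fact k :: real) = ln k + ln (fact (k - 1))"
    using assms by (cases k) (simp_all add: ln_mult del: of_nat_Suc)
  moreover have "ln (fact k :: real) \<le> xlnx k + ln k + 1" using assms by (intro ln_fact_le) auto
  moreover have "ln (fact n :: real) \<ge> xlnx n + 1" using assms by (intro ln_fact_ge) auto
  moreover have "ln (fact (n - k) :: real) \<le> xlnx (real (n - k)) + ln (real (n - k)) + 1"
    using assms by (intro ln_fact_le) auto
  moreover have "ln (real (n - k)) \<le> ln n" using assms by (intro ln_mono) auto
  moreover have "real (n - k) = real n - real k" using assms by simp
  ultimately show ?thesis unfolding * xlnx_def by simp
qed

text \<open>Otherwise ln (leibniz n k) is at most \<open>psi (2 * k)\<close> plus an error of order
  sqrt n * ln n, while Stirling's bounds give the entropy of k in n as main term from below. The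
  difference \<open>f\<close> of the main terms is concave in k, so only the ends k = 2 sqrt n and k
  = n/5 need an estimate.\<close>

lemma large_window_prime:
  assumes "4 * n < k\<^sup>2" "5 * k \<le> n" "n \<ge> 40000"
  shows "\<exists>p. prime p \<and> p dvd leibniz n k \<and> 2 * k < p"
proof (rule ccontr)
  assume neg: "\<not> ?thesis"
  define s where "s = sqrt n"
  have "sqrt 40000 \<le> s" using assms unfolding s_def by (intro real_sqrt_le_mono) simp
  moreover have "sqrt 40000 = (200::real)" by (rule real_sqrt_unique) auto
  ultimately have s: "s \<ge> 200" by simp
  have n: "real n = s\<^sup>2" by (simp add: s_def)
  define l where "l = ln s"
  have lnn: "ln (real n) = 2 * l" unfolding n l_def using s by (simp add: ln_realpow)
  have "ln (200::real) = ln 8 + 2 * ln 5"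
    using ln_mult[of 8 "25 :: real"] ln_realpow[of "5::real" 2] by simp
  moreover have "ln (8::real) = 3 * ln 2" using ln_realpow[of "2::real" 3] by simp
  moreover have "ln 200 \<le> l" unfolding l_def using s by (intro ln_mono) auto
  ultimately have l: "529 / 100 \<le> l" "l \<le> 43 / 10 + s / 200"
    using ln_le_near_200[of s] s ln_numeral_bounds unfolding l_def by linarith+
  have k1: "1 \<le> k" using assms by (cases k) auto
  have "(2 * s)\<^sup>2 \<le> (real k)\<^sup>2"
  proof -
    have "real (4 * n) \<le> real (k\<^sup>2)" using assms(1) by (intro of_nat_mono) simp
    thus ?thesis using n by (simp add: power_mult_distrib)
  qed
  hence k2: "2 * s \<le> k" by (rule power2_le_imp_le) simp
  have k5: "real k \<le> s\<^sup>2 / 5"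
  proof -
    have "real (5 * k) \<le> real n" using assms(2) by (rule of_nat_mono)
    thus ?thesis using n by simp
  qed

  have up: "ln (leibniz n k) \<le> (8 * s + 158) / 35 * (2 * l) + 11057 / 10000 * (2 * k) + 8 * l\<^sup>2 + 75"
  proof -
    have "ln (leibniz n k) \<le> card {p. prime p \<and> p\<^sup>2 \<le> n} * ln n + psi (2 * k)"
      using neg assms k1 by (intro ln_leibniz_le) (auto simp: not_less)
    also have "real (card {p. prime p \<and> p\<^sup>2 \<le> n}) * ln n \<le> (8 * s + 158) / 35 * (2 * l)"
      unfolding lnn
    proof (rule mult_right_mono)
      define r where "r = nat \<lfloor>s\<rfloor>"
      have "p\<^sup>2 \<le> n \<longleftrightarrow> p \<le> r" for p
      proof -
        have "p\<^sup>2 \<le> n \<longleftrightarrow> (real p)\<^sup>2 \<le> s\<^sup>2" unfolding n[symmetric] by (metis of_nat_le_iff of_nat_power)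
        also have "\<dots> \<longleftrightarrow> real p \<le> s" using s by (simp add: power2_le_iff_abs_le)
        also have "\<dots> \<longleftrightarrow> p \<le> r" unfolding r_def using s by (simp add: le_nat_iff le_floor_iff)
        finally show ?thesis .
      qed
      hence "real (35 * card {p. prime p \<and> p\<^sup>2 \<le> n}) \<le> real (8 * r + 158)"
        using prime_count_le[of r] by (simp only: of_nat_le_iff)
      moreover have "real r \<le> s" unfolding r_def using s by (intro of_nat_floor) simp
      ultimately show "real (card {p. prime p \<and> p\<^sup>2 \<le> n}) \<le> (8 * s + 158) / 35" by simp
    qed (use l in simp)
    also have "psi (2 * k) \<le> 11057 / 10000 * real (2 * k) + 2 * (ln (real (2 * k)))\<^sup>2 + 75"
      using k1 by (intro psi_le) simp
    also have "(ln (real (2 * k)))\<^sup>2 \<le> (2 * l)\<^sup>2"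
      unfolding lnn[symmetric] using assms k1 by (intro power_mono ln_mono) auto
    finally show ?thesis by (simp add: power_mult_distrib)
  qed

  \<comment> \<open>The coefficient 2.2114 is twice the slope of \<open>psi_le\<close>, because the
    primes run up to 2x; s^2 stands for n.\<close>
  define f where "f = (\<lambda>x. s\<^sup>2 * ln (s\<^sup>2) - x * ln x - (s\<^sup>2 - x) * ln (s\<^sup>2 - x) - 22114 / 10000 * x)"
  have lo: "f k \<le> (8 * s + 158) / 35 * (2 * l) + 8 * l\<^sup>2 + 76 + 2 * l"
    using up ln_leibniz_ge[of k n] k1 assms lnn n unfolding f_def by (simp add: of_nat_diff)
  \<comment> \<open>This bound of the error serves the end k = n/5; at the other end the error is
    compared with s * l directly.\<close>
  have err: "(8 * s + 158) / 35 * (2 * l) + 8 * l\<^sup>2 + 76 + 2 * l \<le> 5 / 100 * s\<^sup>2"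
  proof -
    have "(8 * s + 158) / 35 * (2 * l) \<le> (8 * s + 158) / 35 * (2 * (43 / 10 + s / 200))"
      using l s by (intro mult_left_mono) auto
    moreover have "8 * l\<^sup>2 \<le> 8 * (43 / 10 + s / 200)\<^sup>2" using l s by (intro mult_left_mono power_mono) auto
    ultimately have "(8 * s + 158) / 35 * (2 * l) + 8 * l\<^sup>2 + 76 + 2 * l \<le>
      (8 * s + 158) / 35 * (2 * (43 / 10 + s / 200)) + 8 * (43 / 10 + s / 200)\<^sup>2 + 76 + 2 * (43 / 10 + s / 200)"
      using l by (intro add_mono) auto
    also have "\<dots> \<le> 3 / 1000 * s\<^sup>2 + 3 * s + 300"
      using s zero_le_square[of s] by (simp add: power2_eq_square field_simps)
    also have "\<dots> \<le> 5 / 100 * s\<^sup>2"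
    proof -
      have "200 * s \<le> s\<^sup>2" unfolding power2_eq_square using s by (intro mult_right_mono) auto
      thus ?thesis using s by linarith
    qed
    finally show ?thesis .
  qed
  \<comment> \<open>The margin is ln 5 - 1.6 ln 2 - 0.4423 > 0.05 for each unit of s^2. With ln 4 in
    place of 1.1057 it would be negative.\<close>
  have "f (s\<^sup>2 / 5) > 5 / 100 * s\<^sup>2"
  proof -
    have s0: "s\<^sup>2 > 0" using s by simp
    have e1: "s\<^sup>2 - s\<^sup>2 / 5 = s\<^sup>2 * 4 / 5" by simp
    have e2: "ln (s\<^sup>2 * 4 / 5) = ln (s\<^sup>2) + 2 * ln 2 - ln 5"
    proof -
      have "ln (s\<^sup>2 * 4 / 5) = ln (s\<^sup>2 * 4) - ln 5" using s0 ln_div[of "s\<^sup>2 * 4" 5] by auto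
      also have "ln (s\<^sup>2 * 4) = ln (s\<^sup>2) + ln (2\<^sup>2)" using s0 ln_mult[of "s\<^sup>2" 4] by auto
      also have "ln (2\<^sup>2 :: real) = 2 * ln 2" using ln_realpow[of "2::real" 2] by simp
      finally show ?thesis by simp
    qed
    have e3: "ln (s\<^sup>2 / 5) = ln (s\<^sup>2) - ln 5" using s0 by (simp add: ln_div)
    have "f (s\<^sup>2 / 5) = s\<^sup>2 * (ln 5 - 8 / 5 * ln 2 - 22114 / 50000)"
      unfolding f_def e1 e2 e3 by (simp add: field_simps)
    also have "\<dots> > s\<^sup>2 * (5 / 100)"
      using s0 ln_numeral_bounds by (intro mult_strict_left_mono) linarith+
    finally show ?thesis by (simp add: mult.commute)
  qed
  \<comment> \<open>The leading terms are 2 s l on the left and (16/35 + 0.04) s l on the right; l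
    >= 5.29 and s >= 200 dispose of the rest.\<close>
  moreover have "f (2 * s) > (8 * s + 158) / 35 * (2 * l) + 8 * l\<^sup>2 + 76 + 2 * l"
  proof -
    have s2: "s\<^sup>2 - 2 * s > 0" using s by (simp add: power2_eq_square)
    have "ln (s\<^sup>2 - 2 * s) = ln (s\<^sup>2) + ln (1 - 2 / s)"
    proof -
      have "s\<^sup>2 - 2 * s = s\<^sup>2 * (1 - 2 / s)" using s by (simp add: field_simps power2_eq_square)
      thus ?thesis using s by (simp only:) (subst ln_mult; simp)
    qed
    moreover have "ln (1 - 2 / s) \<le> - 2 / s" using ln_add_one_self_le_self2[of "- 2 / s"] s by simp
    ultimately have "(s\<^sup>2 - 2 * s) * ln (s\<^sup>2 - 2 * s) \<le> (s\<^sup>2 - 2 * s) * (2 * l - 2 / s)"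
      using s2 s by (intro mult_left_mono) (auto simp: l_def ln_realpow)
    also have "\<dots> = (s\<^sup>2 - 2 * s) * (2 * l) - 2 * s + 4"
      using s by (simp add: field_simps power2_eq_square)
    finally have "f (2 * s) \<ge> s\<^sup>2 * (2 * l) - 2 * s * (ln 2 + l) - ((s\<^sup>2 - 2 * s) * (2 * l) - 2 * s + 4) - 22114 / 10000 * (2 * s)"
      unfolding f_def using s by (simp add: l_def ln_realpow ln_mult)
    hence "f (2 * s) \<ge> 2 * s * l - 2 * s * ln 2 + 2 * s - 4 - 22114 / 5000 * s"
      by (simp add: algebra_simps)
    moreover have "s * ln 2 \<le> s * (6932 / 10000)" using s ln_numeral_bounds by (intro mult_left_mono) auto
    ultimately have f: "f (2 * s) \<ge> 2 * (s * l) - 382 / 100 * s - 4" using s by linarith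
    have "8 * l\<^sup>2 \<le> 8 * (l * (43 / 10 + s / 200))"
      unfolding power2_eq_square using l by (intro mult_left_mono) auto
    hence l2: "8 * l\<^sup>2 \<le> 344 / 10 * l + 4 / 100 * (s * l)" by (simp add: algebra_simps)
    have sl: "529 / 100 * s \<le> s * l" using l(1) s mult_left_mono[of "529 / 100" l s] by simp
    have sl2: "200 * l \<le> s * l" using l s by (intro mult_right_mono) auto
    have "(8 * s + 158) / 35 * (2 * l) = 16 / 35 * (s * l) + 316 / 35 * l" by (simp add: field_simps)
    thus ?thesis using f l2 sl sl2 s l by linarith
  qed
  moreover have "f k \<ge> min (f (2 * s)) (f (s\<^sup>2 / 5))"
    unfolding f_def using s k2 k5 by (intro entropy_ge_min) auto
  ultimately show False using lo err by linarith
qed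

text \<open>The crude estimate in logarithms. After division by \<open>n ^ j\<close> about 19k/35
  factors n remain, each at least k^2/4, and since 2 * 19/35 > 1 they outweigh (k - 1)!.\<close>

lemma mid_window_prime:
  assumes "k \<ge> 70" "k\<^sup>2 \<le> 4 * n"
  shows "\<exists>p. prime p \<and> p dvd leibniz n k \<and> 2 * k < p"
proof (rule ccontr)
  assume neg: "\<not> ?thesis"
  have kn: "70 * k \<le> 4 * n"
    using assms(2) mult_le_mono1[OF assms(1), of k] unfolding power2_eq_square by linarith
  define j where "j = card {p::nat. prime p \<and> p \<le> 2 * k}"
  define L where "L = ln (real n)"
  define l where "l = ln (real k)"
  have j: "35 * real j \<le> 16 * k + 158"
  proof -
    have "real (35 * j) \<le> real (8 * (2 * k) + 158)" using prime_count_le[of "2 * k"] unfolding j_def by (rule of_nat_mono)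
    thus ?thesis by simp
  qed
  have pos: "leibniz n k > 0" using kn assms by (intro leibniz_pos) auto
  have "leibniz n k \<le> n ^ j" unfolding j_def
    using neg assms kn by (intro leibniz_le_power_prime_count) (auto simp: not_less)
  hence "real (leibniz n k) \<le> real (n ^ j)" by (rule of_nat_mono)
  hence "ln (real (leibniz n k)) \<le> ln (real (n ^ j))" using pos by (intro ln_mono) auto
  hence 1: "ln (real (leibniz n k)) \<le> j * L" using kn assms by (simp add: L_def ln_realpow)
  have "real ((n - k + 1) ^ k) \<le> real (leibniz n k * fact (k - 1))"
    using assms kn by (intro of_nat_mono window_power_le) auto
  hence "ln (real ((n - k + 1) ^ k)) \<le> ln (real (leibniz n k * fact (k - 1)))" by (intro ln_mono) auto
  hence 2: "k * ln (real (n - k + 1)) \<le> ln (real (leibniz n k)) + ln (fact (k - 1))"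
    using pos by (simp add: ln_realpow ln_mult del: of_nat_Suc of_nat_add of_nat_diff)
  have "ln (fact k :: real) = l + ln (fact (k - 1))"
    unfolding l_def using assms by (cases k) (simp_all add: ln_mult del: of_nat_Suc)
  moreover have "ln (fact k :: real) \<le> xlnx k + l + 1" unfolding l_def using assms by (intro ln_fact_le) auto
  ultimately have 3: "ln (fact (k - 1) :: real) \<le> k * l - k + 1" by (simp add: xlnx_def l_def)
  \<comment> \<open>Replacing n - k + 1 by n costs at most k^2/(n - k), which is at most 5 because
    k^2 <= 4n and 70k <= 4n.\<close>
  have 4: "k * ln (real (n - k + 1)) \<ge> k * L - 5"
  proof -
    have nk: "real (n - k) > 0" "real (n - k) = real n - real k" using kn assms by auto
    have "L - ln (real (n - k)) = ln (n / real (n - k))" using nk kn assms by (simp add: L_def ln_div)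
    also have "\<dots> \<le> n / real (n - k) - 1" using nk kn assms by (intro ln_le_minus_one) auto
    also have "\<dots> = k / (real n - k)" using nk by (simp add: field_simps)
    finally have "k * (L - ln (real (n - k))) \<le> k * (k / (real n - k))" by (intro mult_left_mono) auto
    also have "\<dots> \<le> 5"
    proof -
      have "real (k\<^sup>2) \<le> real (4 * n)" using assms(2) by (rule of_nat_mono)
      moreover have "real (70 * k) \<le> real (4 * n)" using kn by (rule of_nat_mono)
      ultimately have "real k * k \<le> 5 * (real n - k)" by (simp add: power2_eq_square)
      thus ?thesis using nk by (simp add: divide_le_eq)
    qed
    finally have "k * L - k * ln (real (n - k)) \<le> 5" by (simp add: algebra_simps)
    moreover have "k * ln (real (n - k)) \<le> k * ln (real (n - k + 1))"
      using nk by (intro mult_left_mono ln_mono) auto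
    ultimately show ?thesis by linarith
  qed
  have L: "L \<ge> 2 * l - 13864 / 10000"
  proof -
    have "real (k\<^sup>2) \<le> real (4 * n)" using assms(2) by (rule of_nat_mono)
    hence "ln (real (k\<^sup>2)) \<le> ln (real (4 * n))" using assms by (intro ln_mono) auto
    moreover have "ln (real (k\<^sup>2)) = 2 * l" using assms by (simp add: l_def ln_realpow)
    moreover have "ln (real (4 * n)) = 2 * ln 2 + L"
      using ln_realpow[of "2::real" 2] assms kn by (simp add: L_def ln_mult)
    ultimately show ?thesis using ln_numeral_bounds by linarith
  qed
  have "(k - real j) * L \<le> k * l - k + 6" using 1 2 3 4 by (simp add: algebra_simps)
  moreover have "(19 * real k - 158) / 35 * (2 * l - 13864 / 10000) \<le> (k - real j) * L"
  proof (rule mult_mono)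
    show "(19 * real k - 158) / 35 \<le> real k - real j" using j by simp
    show "0 \<le> real k - real j" using j assms by simp
    have "ln 3 \<le> l" unfolding l_def using assms by (intro ln_mono) auto
    thus "0 \<le> 2 * l - 13864 / 10000" using ln_numeral_bounds by linarith
  qed (use L in auto)
  ultimately have "(19 * real k - 158) / 35 * (2 * l - 13864 / 10000) \<le> k * l - k + 6" by linarith
  hence main: "(3 * real k - 316) * l + 86 / 10 * k \<le> 0" by (simp add: field_simps)
  show False
  proof (cases "3 * real k \<ge> 316")
    case True
    have "l \<ge> 0" using assms by (simp add: l_def)
    hence "(3 * real k - 316) * l \<ge> 0" using True by (intro mult_nonneg_nonneg) auto
    thus False using main assms by simp
  next
    case False
    \<comment> \<open>Here k <= 105 < 2^7. The bound 4.86 for l would give 23.18 k <= 1535.76, so k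
      <= 66, against k >= 70.\<close>
    have "l \<le> ln 128" unfolding l_def using False assms by (intro ln_mono) auto
    also have "ln (128::real) = 7 * ln 2" using ln_realpow[of "2::real" 7] by simp
    finally have "l \<le> 486 / 100" using ln_numeral_bounds by linarith
    hence "(316 - 3 * real k) * l \<le> (316 - 3 * real k) * (486 / 100)" using False by (intro mult_left_mono) auto
    thus False using main assms by (simp add: algebra_simps)
  qed
qed

section \<open>Numbers of the form 2^a 3^b at small distance\<close>

lemma power3_mod8: "(3::nat) ^ b mod 8 = (if even b then 1 else 3)"
proof (induction b)
  case (Suc b)
  have "(3::nat) ^ Suc b mod 8 = (3 * (3 ^ b mod 8)) mod 8" by (simp add: mod_mult_right_eq)
  thus ?case using Suc by simp
qed simp

lemma power2_mod8: "a \<ge> 3 \<Longrightarrow> (2::nat) ^ a mod 8 = 0"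
proof -
  assume "a \<ge> 3"
  hence "(2::nat) ^ 3 dvd 2 ^ a" by (rule le_imp_power_dvd)
  thus ?thesis by simp
qed

text \<open>The right-hand side is 2 or 4 modulo 8, which leaves a <= 2.\<close>

lemma power2_eq_power3_plus_1: "(2::nat) ^ a = 3 ^ b + 1 \<Longrightarrow> b \<le> 1"
proof -
  assume eq: "(2::nat) ^ a = 3 ^ b + 1"
  have "(3 ^ b + 1) mod 8 = (3 ^ b mod 8 + 1) mod (8::nat)" by (simp only: mod_add_left_eq)
  hence "(3 ^ b + 1) mod 8 \<noteq> (0::nat)" unfolding power3_mod8 by (simp split: if_splits)
  hence "a < 3" using power2_mod8[of a] eq by (cases "a \<ge> 3") auto
  hence "(2::nat) ^ a \<le> 2 ^ 2" by (intro power_increasing) auto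
  hence "(3::nat) ^ b < 3 ^ 2" using eq by simp
  hence "b < 2" by (rule power_less_imp_less_exp[rotated]) simp
  thus ?thesis by simp
qed

text \<open>For a >= 3, reduction modulo 8 gives b = 2e. Then 3^e + 1 divides 2^a, so it is a power
  of 2 and the previous equation yields e <= 1.\<close>

lemma power3_eq_power2_plus_1: "(3::nat) ^ b = 2 ^ a + 1 \<Longrightarrow> b \<le> 2"
proof -
  assume eq: "(3::nat) ^ b = 2 ^ a + 1"
  show ?thesis
  proof (cases "a \<ge> 3")
    case True
    have "(3::nat) ^ b mod 8 = (2 ^ a mod 8 + 1) mod 8" unfolding eq by (simp only: mod_add_left_eq)
    hence "(3::nat) ^ b mod 8 = 1" using power2_mod8[OF True] by simp
    hence "(if even b then 1 else 3) = (1::nat)" by (simp only: power3_mod8)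
    hence "even b" by (simp split: if_splits)
    then obtain e where e: "b = 2 * e" by auto
    have "2 ^ a = (3 ^ e + 1) * (3 ^ e - 1 :: nat)"
    proof -
      have "(3::nat) ^ b = 3 ^ e * 3 ^ e" by (simp add: e mult_2 power_add)
      hence "2 ^ a = (3 ^ e * 3 ^ e - 1 :: nat)" using eq by simp
      thus ?thesis by (simp add: algebra_simps)
    qed
    hence "3 ^ e + 1 dvd (2::nat) ^ a" by (rule dvdI)
    then obtain i where "3 ^ e + 1 = (2::nat) ^ i" using divides_primepow_nat[of 2] two_is_prime_nat by blast
    hence "e \<le> 1" using power2_eq_power3_plus_1[of i e] by simp
    thus ?thesis using e by simp
  next
    case False
    hence "(2::nat) ^ a \<le> 2 ^ 2" by (intro power_increasing) auto
    hence "(3::nat) ^ b < 3 ^ 2" using eq by simp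
    hence "b < 2" by (rule power_less_imp_less_exp[rotated]) simp
    thus ?thesis by simp
  qed
qed

definition smooth3 :: "nat \<Rightarrow> bool" where
  "smooth3 x \<longleftrightarrow> (\<exists>a b. x = 2 ^ a * 3 ^ b)"

lemma smooth3I:
  assumes "x > 0" "\<And>p. prime p \<Longrightarrow> p dvd x \<Longrightarrow> p = 2 \<or> p = 3"
  shows "smooth3 x"
  using assms
proof (induction x rule: less_induct)
  case (less x)
  show ?case
  proof (cases "x = 1")
    case True
    thus ?thesis unfolding smooth3_def by (intro exI[of _ 0]) auto
  next
    case False
    then obtain p where p: "prime p" "p dvd x" using prime_factor_nat by blast
    then obtain y where y: "x = p * y" by auto
    have "smooth3 y"
    proof (rule less.IH)
      show "y < x" using y less.prems(1) prime_gt_1_nat[OF p(1)] by simp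
      show "y > 0" using y less.prems(1) by simp
      show "q = 2 \<or> q = 3" if "prime q" "q dvd y" for q using less.prems(2)[of q] that y by simp
    qed
    then obtain a b where ab: "y = 2 ^ a * 3 ^ b" unfolding smooth3_def by auto
    have "p = 2 \<or> p = 3" using less.prems(2)[OF p] .
    thus ?thesis
    proof
      assume "p = 2"
      thus ?thesis unfolding smooth3_def y ab by (intro exI[of _ "Suc a"] exI[of _ b]) simp
    next
      assume "p = 3"
      thus ?thesis unfolding smooth3_def y ab by (intro exI[of _ a] exI[of _ "Suc b"]) simp
    qed
  qed
qed

lemma smooth3_odd: "smooth3 x \<Longrightarrow> odd x \<Longrightarrow> \<exists>b. x = 3 ^ b"
proof -
  assume "smooth3 x" "odd x"
  then obtain a b where ab: "x = 2 ^ a * 3 ^ b" unfolding smooth3_def by auto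
  hence "a = 0" using \<open>odd x\<close> by (cases a) auto
  thus ?thesis using ab by auto
qed

lemma smooth3_not_3_dvd: "smooth3 x \<Longrightarrow> \<not> 3 dvd x \<Longrightarrow> \<exists>a. x = 2 ^ a"
proof -
  assume "smooth3 x" "\<not> 3 dvd x"
  then obtain a b where ab: "x = 2 ^ a * 3 ^ b" unfolding smooth3_def by auto
  hence "b = 0" using \<open>\<not> 3 dvd x\<close> by (cases b) auto
  thus ?thesis using ab by auto
qed

lemma smooth3_div: "smooth3 x \<Longrightarrow> q dvd x \<Longrightarrow> prime q \<Longrightarrow> smooth3 (x div q)"
proof (rule smooth3I)
  assume x: "smooth3 x" "q dvd x" "prime q"
  then obtain a b where ab: "x = 2 ^ a * 3 ^ b" unfolding smooth3_def by auto
  have "x > 0" using ab by simp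
  thus "x div q > 0" using x by (metis dvd_div_eq_0_iff gr0I)
  fix p assume p: "prime p" "p dvd x div q"
  hence "p dvd 2 ^ a * 3 ^ b" using x(2) ab by (metis dvd_div_mult_self dvd_mult2)
  hence "p dvd 2 \<or> p dvd 3" using p(1) by (auto simp: prime_dvd_mult_iff dest: prime_dvd_power)
  thus "p = 2 \<or> p = 3" using p(1) primes_dvd_imp_eq[of p 2] primes_dvd_imp_eq[of p 3] by auto
qed

text \<open>The odd one of the two is a power of 3. Unless it is 1, the other is prime to 3 and
  hence a power of 2, and the two exponential equations apply; the last pair is 8, 9.\<close>

lemma smooth3_consecutive:
  assumes "smooth3 x" "smooth3 (x + 1)"
  shows "x + 1 \<le> 9"
proof (cases "odd x")
  case True
  then obtain b where b: "x = 3 ^ b" using smooth3_odd assms by blast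
  show ?thesis
  proof (cases "b = 0")
    case False
    hence "3 dvd x" unfolding b by simp
    hence "\<not> 3 dvd x + 1" by presburger
    then obtain c where "x + 1 = 2 ^ c" using smooth3_not_3_dvd assms by blast
    hence "b \<le> 1" using power2_eq_power3_plus_1[of c b] b by simp
    hence "(3::nat) ^ b \<le> 3 ^ 1" by (intro power_increasing) auto
    thus ?thesis using b by simp
  qed (use b in auto)
next
  case False
  hence "odd (x + 1)" by simp
  then obtain d where d: "x + 1 = 3 ^ d" using smooth3_odd assms by blast
  have x: "x > 0" using assms(1) by (auto simp: smooth3_def)
  hence "d \<noteq> 0" using d by (cases d) auto
  hence "3 dvd x + 1" unfolding d by simp
  hence "\<not> 3 dvd x" by presburger
  then obtain c where "x = 2 ^ c" using smooth3_not_3_dvd assms by blast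
  hence "d \<le> 2" using power3_eq_power2_plus_1[of d c] d by simp
  hence "(3::nat) ^ d \<le> 3 ^ 2" by (intro power_increasing) auto
  thus ?thesis using d by simp
qed

text \<open>At distance 2 or 3 the distance divides both numbers or neither. In the first case
  division leads to consecutive numbers, whence 27 = 3 * 9. In the second both are powers of 3, or
  both powers of 2, and one of them is 1.\<close>

lemma smooth3_close:
  assumes "smooth3 x" "smooth3 y" "x < y" "y \<le> x + 3"
  shows "y \<le> 27"
proof -
  consider "y = x + 1" | "y = x + 2" | "y = x + 3" using assms by linarith
  thus ?thesis
  proof cases
    case 1
    thus ?thesis using smooth3_consecutive[of x] assms by simp
  next
    case 2
    show ?thesis
    proof (cases "even x")
      case True
      have "smooth3 (x div 2)" "smooth3 (y div 2)"
        using smooth3_div[OF assms(1), of 2] smooth3_div[OF assms(2), of 2] True 2 two_is_prime_nat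
        by simp_all
      moreover have "y div 2 = x div 2 + 1" using 2 by simp
      ultimately have "y div 2 \<le> 9" using smooth3_consecutive[of "x div 2"] by simp
      thus ?thesis by simp
    next
      case False
      then obtain b d where bd: "x = 3 ^ b" "y = 3 ^ d" using smooth3_odd assms 2 by (metis even_add even_numeral)
      have "d \<noteq> 0" using bd(2) 2 by (cases d) auto
      hence "3 dvd y" unfolding bd by simp
      hence "\<not> 3 dvd x" using 2 by presburger
      hence "b = 0" using bd by (cases b) auto
      thus ?thesis using bd 2 by simp
    qed
  next
    case 3
    show ?thesis
    proof (cases "3 dvd x")
      case True
      hence "3 dvd y" using 3 by presburger
      have "smooth3 (x div 3)" "smooth3 (y div 3)"
        using smooth3_div[OF assms(1), of 3] smooth3_div[OF assms(2), of 3] True \<open>3 dvd y\<close> by simp_all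
      moreover have "y div 3 = x div 3 + 1" using 3 by simp
      ultimately have "y div 3 \<le> 9" using smooth3_consecutive[of "x div 3"] by simp
      thus ?thesis using \<open>3 dvd y\<close> by auto
    next
      case False
      hence "\<not> 3 dvd y" using 3 by presburger
      then obtain a c where ac: "x = 2 ^ a" "y = 2 ^ c" using smooth3_not_3_dvd assms False by metis
      have "even x \<noteq> even y" using 3 by simp
      hence "a = 0 \<or> c = 0" using ac by auto
      thus ?thesis using ac 3 by auto
    qed
  qed
qed

text \<open>For n >= 31 without such a prime, the members of the window have prime factors at most
  7; 5 occurs only for k >= 3, 7 only for k = 4, and each divides at most one member. So two members
  are of the form 2^a 3^b, at distance at most 3 and above 27.\<close>

lemma window_2_4:
  fixes k n :: nat
  assumes "2 \<le> k" "k < 5" "11 \<le> n"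
  shows "\<exists>m p. n < m + k \<and> m \<le> n \<and> prime p \<and> p dvd m \<and> (2 * k < p \<or> p = m)"
proof (cases "n < 31")
  case True
  have "\<exists>xs. (k, xs) \<in> set window_table \<and> 31 \<le> fst (last xs) + k"
  proof -
    consider "k = 2" | "k = 3" | "k = 4" using assms by linarith
    thus ?thesis by cases (auto simp: window_table_def)
  qed
  thus ?thesis using window_table_correct[of k _ n] assms True by force
next
  case False
  show ?thesis
  proof (rule ccontr)
    assume neg: "\<not> ?thesis"
    have sm: "p \<le> 2 * k" if "n < m + k" "m \<le> n" "prime p" "p dvd m" for m p
      using neg that not_le by blast
    have s3: "smooth3 m" if "n < m + k" "m \<le> n" "k \<le> 2 \<or> \<not> 5 dvd m" "k \<le> 3 \<or> \<not> 7 dvd m" for m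
    proof (rule smooth3I)
      show "m > 0" using that False assms by simp
      fix p assume p: "prime p" "p dvd m"
      have "p \<le> 2 * k" using sm[of m p] that p by simp
      hence "p \<in> {0..8}" using assms by simp
      hence "p \<in> {0,1,2,3,4,5,6,7,8}" by (auto simp: numeral_eq_Suc le_Suc_eq)
      moreover have "\<not> prime (4::nat)" "\<not> prime (6::nat)" "\<not> prime (8::nat)" by simp_all
      moreover have "p \<noteq> 0" "p \<noteq> 1" using p(1) by auto
      ultimately have "p \<in> {2,3,5,7}" using p(1) by auto
      moreover have "p \<noteq> 5" using that(3) p \<open>p \<le> 2 * k\<close> by auto
      moreover have "p \<noteq> 7" using that(4) p \<open>p \<le> 2 * k\<close> by auto
      ultimately show "p = 2 \<or> p = 3" by auto
    qed
    have no: False if "n < x + k" "n < y + k" "x < y" "y \<le> n" "smooth3 x" "smooth3 y" for x y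
      using smooth3_close[of x y] that False assms by simp
    consider "k = 2" | "k = 3" | "k = 4" using assms by linarith
    thus False
    proof cases
      case 1
      thus False using no[of "n - 1" n] s3[of n] s3[of "n - 1"] False by simp
    next
      case 2
      have "\<not> (5 dvd n \<and> 5 dvd n - 1)" "\<not> (5 dvd n \<and> 5 dvd n - 2)" "\<not> (5 dvd n - 1 \<and> 5 dvd n - 2)"
        using False by presburger+
      moreover have "n - 2 < n - 1" using False by simp
      ultimately show False using 2 no[of "n - 1" n] no[of "n - 2" n] no[of "n - 2" "n - 1"]
          s3[of n] s3[of "n - 1"] s3[of "n - 2"] False by auto
    next
      case 3
      have i5: "i = j" if "5 dvd n - i" "5 dvd n - j" "i \<le> 3" "j \<le> 3" for i j
        using that False by presburger
      have i7: "i = j" if "7 dvd n - i" "7 dvd n - j" "i \<le> 3" "j \<le> 3" for i j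
        using that False by presburger
      have ok: "5 dvd n - i \<or> 7 dvd n - i \<or> 5 dvd n - j \<or> 7 dvd n - j" if "i < j" "j \<le> 3" for i j
      proof -
        have "n < n - i + k" "n < n - j + k" "n - j < n - i" using that 3 False by linarith+
        thus ?thesis using no[of "n - j" "n - i"] s3[of "n - i"] s3[of "n - j"] diff_le_self by blast
      qed
      show False
        using ok[of 0 1] ok[of 0 2] ok[of 0 3] ok[of 1 2] ok[of 1 3] ok[of 2 3]
          i5[of 0 1] i5[of 0 2] i5[of 0 3] i5[of 1 2] i5[of 1 3] i5[of 2 3]
          i7[of 0 1] i7[of 0 2] i7[of 0 3] i7[of 1 2] i7[of 1 3] i7[of 2 3] by simp argo
    qed
  qed
qed

text \<open>Prime-free windows are short: k <= n - p for every prime p <= n. For k >= 20 and n <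
  40000 the list of primes then gives k^2 < 4n. From 40000 on a prime above 4n/5 gives 5k <= n, and
  \<open>large_window_prime\<close> takes the case k^2 > 4n.\<close>

theorem window_large_prime:
  fixes k n :: nat
  assumes "11 \<le> n" "2 \<le> k" "k \<le> n"
    and no_prime: "\<And>m. n < m + k \<Longrightarrow> m \<le> n \<Longrightarrow> \<not> prime m"
  shows "\<exists>m p. n < m + k \<and> m \<le> n \<and> prime p \<and> p dvd m \<and> 2 * k < p"
proof (cases "k < 20")
  case True
  have "\<exists>m p. n < m + k \<and> m \<le> n \<and> prime p \<and> p dvd m \<and> (2 * k < p \<or> p = m)"
    using window_2_4[of k n] window_5_20[of k n] assms True by (cases "k < 5") simp_all
  thus ?thesis using no_prime by blast
next
  case False
  have leibniz: ?thesis if "\<exists>p. prime p \<and> p dvd leibniz n k \<and> 2 * k < p"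
    using that leibniz_dvd_window[of k n] assms by (metis le_trans one_le_numeral)
  have small: ?thesis if "k\<^sup>2 \<le> 4 * n" "900 \<le> n"
    using that window_20_70[of k n] mid_window_prime[of k n] leibniz assms False by (cases "k < 70") simp_all
  show ?thesis
  proof (cases "n < 40000")
    case True
    obtain p where p: "prime p" "p \<le> n" "n < p + 20 \<or> 900 \<le> n \<and> (n - p)\<^sup>2 < 4 * n"
      using prime_below[of n] True assms by auto
    have "p + k \<le> n" using no_prime[of p] p by force
    hence kp: "k \<le> n - p" by simp
    hence "k\<^sup>2 \<le> (n - p)\<^sup>2" by (intro power_mono) auto
    moreover have "900 \<le> n" "(n - p)\<^sup>2 < 4 * n" using p(3) kp False by auto
    ultimately show ?thesis using small order.trans[OF _ less_imp_le] by blast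
  next
    case n: False
    obtain p where p: "prime p" "p \<le> n" "4 * n < 5 * p" using exists_prime_four_fifths[of n] n by auto
    have "p + k \<le> n" using no_prime[of p] p by force
    hence "5 * k \<le> n" using p by simp
    thus ?thesis using small large_window_prime[of n k] leibniz n by (cases "k\<^sup>2 \<le> 4 * n") auto
  qed
qed

theorem bertrand:
  assumes "2 \<le> n"
  shows "\<exists>p. prime p \<and> p \<le> n \<and> n < 2 * (p::nat)"
proof (cases "n < 40000")
  case True
  thus ?thesis using prime_below[of n] assms by blast
next
  case False
  then obtain p where "prime p" "p \<le> n" "4 * n < 5 * p" using exists_prime_four_fifths[of n] by auto
  thus ?thesis by (intro exI[of _ p]) auto
qed

section \<open>Exponents of divisors of powers of binomial polynomials\<close>

lemma prod_falling: "n \<le> z \<Longrightarrow> (\<Prod>i<n. z - i) * fact (z - n) = (fact z :: nat)"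
proof (induction n)
  case (Suc n)
  have "fact (z - n) = (z - n) * (fact (z - Suc n) :: nat)"
    using Suc.prems by (simp add: fact_reduce[of "z - n"])
  thus ?case using Suc by (simp add: mult_ac)
qed simp

lemma prod_falling_choose:
  assumes "n \<le> z"
  shows "(\<Prod>i<n. z - i) = fact n * (z choose n)"
proof -
  have "(\<Prod>i<n. z - i) * fact (z - n) = fact n * (z choose n) * fact (z - n)"
    using prod_falling[OF assms] binomial_fact_lemma[OF assms] by (simp add: mult_ac)
  thus ?thesis by simp
qed

lemma sum_multiplicity_falling:
  assumes "prime p" "n \<le> z" "\<not> p dvd (z choose n)"
  shows "(\<Sum>i<n. multiplicity p (z - i)) = multiplicity p (fact n)"
proof -
  have "(\<Sum>i<n. multiplicity p (z - i)) = multiplicity p (\<Prod>i<n. z - i)"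
    using assms by (subst prime_elem_multiplicity_prod_distrib) auto
  also have "\<dots> = multiplicity p (fact n) + multiplicity p (z choose n)"
    using assms unfolding prod_falling_choose[OF assms(2)]
    by (subst prime_elem_multiplicity_mult_distrib) auto
  also have "multiplicity p (z choose n) = 0" using assms(3) by (rule not_dvd_imp_multiplicity_0)
  finally show ?thesis by simp
qed

lemma multiplicity_fact_add:
  assumes "prime p" "t < p"
  shows "multiplicity p (fact (q * p + t) :: nat) = multiplicity p (fact (q * p) :: nat)"
  using assms(2)
proof (induction t)
  case (Suc t)
  have "fact (q * p + Suc t) = (q * p + Suc t) * (fact (q * p + t) :: nat)" by simp
  hence "multiplicity p (fact (q * p + Suc t) :: nat) =
      multiplicity p (q * p + Suc t) + multiplicity p (fact (q * p + t) :: nat)"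
    using assms(1) by (simp only:) (subst prime_elem_multiplicity_mult_distrib; simp)
  moreover have "\<not> p dvd q * p + Suc t"
    using Suc.prems by (subst dvd_add_right_iff) (auto dest: dvd_imp_le)
  ultimately show ?case using Suc by (simp add: not_dvd_imp_multiplicity_0)
qed simp

text \<open>An instance of Kummer's criterion: n and z - n are added in base p without a carry.
  Directly, no multiple of p lies in (n, z] and z - n < p, so n! and z! have equal valuation and (z
  - n)! has valuation 0.\<close>

lemma not_dvd_choose:
  assumes "prime p" "n mod p \<le> t" "t < p"
  shows "\<not> p dvd ((n div p * p + t) choose n)"
proof
  define z where "z = n div p * p + t"
  assume dvd: "p dvd ((n div p * p + t) choose n)"
  have n: "n = n div p * p + n mod p" by simp
  have nz: "n \<le> z" unfolding z_def using assms n by linarith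
  have zn: "z - n = t - n mod p" unfolding z_def using n by linarith
  let ?v = "multiplicity p"
  have "?v (fact n) + ?v (fact (z - n)) + ?v (z choose n) = ?v (fact n * fact (z - n) * (z choose n))"
    using assms(1) nz by (simp add: prime_elem_multiplicity_mult_distrib)
  also have "\<dots> = ?v (fact z)" using binomial_fact_lemma[OF nz] by simp
  also have "\<dots> = ?v (fact n)"
    using multiplicity_fact_add[OF assms(1,3), of "n div p"]
      multiplicity_fact_add[OF assms(1), of "n mod p" "n div p"] assms(1) n
    by (simp add: z_def prime_gt_0_nat)
  finally have "?v (z choose n) = 0" by simp
  thus False using dvd assms(1) nz unfolding z_def[symmetric]
    by (simp add: prime_elem_multiplicity_eq_zero_iff)
qed

text \<open>The exponents are integers so that a constant can be subtracted from them; z >= n keeps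
  every z - i positive.\<close>

definition balanced_at :: "nat \<Rightarrow> (nat \<Rightarrow> int) \<Rightarrow> nat \<Rightarrow> int \<Rightarrow> bool" where
  "balanced_at n a p \<kappa> \<longleftrightarrow> (\<forall>z\<ge>n. \<not> p dvd (z choose n) \<longrightarrow>
     (\<Sum>i<n. a i * int (multiplicity p (z - i))) = \<kappa>)"

definition balanced :: "nat \<Rightarrow> (nat \<Rightarrow> int) \<Rightarrow> bool" where
  "balanced n a \<longleftrightarrow> (\<forall>p. prime p \<longrightarrow> (\<exists>\<kappa>. balanced_at n a p \<kappa>))"

lemma balanced_atD:
  "balanced_at n a p \<kappa> \<Longrightarrow> n \<le> z \<Longrightarrow> \<not> p dvd (z choose n) \<Longrightarrow>
     (\<Sum>i<n. a i * int (multiplicity p (z - i))) = \<kappa>"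
  by (simp add: balanced_at_def)

lemma balancedE:
  assumes "balanced n a" "prime p"
  obtains \<kappa> where "balanced_at n a p \<kappa>"
  using assms by (auto simp: balanced_def)

text \<open>Constant sequences satisfy the equations, because z (z - 1) ... (z - n + 1) is n! times
  the binomial coefficient; so the exponents can be normalised to vanish in the middle.\<close>

lemma balanced_diff_const:
  assumes "balanced n a"
  shows "balanced n (\<lambda>i. a i - c)"
  unfolding balanced_def
proof (intro allI impI)
  fix p :: nat assume p: "prime p"
  obtain \<kappa> where "balanced_at n a p \<kappa>"
    by (rule balancedE[OF assms p])
  note \<kappa> = balanced_atD[OF this]
  have "balanced_at n (\<lambda>i. a i - c) p (\<kappa> - c * int (multiplicity p (fact n)))"
    unfolding balanced_at_def
  proof (intro allI impI)
    fix z assume z: "n \<le> z" "\<not> p dvd (z choose n)"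
    have "(\<Sum>i<n. (a i - c) * int (multiplicity p (z - i))) =
        (\<Sum>i<n. a i * int (multiplicity p (z - i))) - c * int (\<Sum>i<n. multiplicity p (z - i))"
      by (simp add: left_diff_distrib sum_subtractf sum_distrib_left)
    thus "(\<Sum>i<n. (a i - c) * int (multiplicity p (z - i))) = \<kappa> - c * int (multiplicity p (fact n))"
      using \<kappa>[OF z] sum_multiplicity_falling[OF p z] by simp
  qed
  thus "\<exists>\<kappa>. balanced_at n (\<lambda>i. a i - c) p \<kappa>" by blast
qed

lemma sum_single_multiple:
  fixes a :: "nat \<Rightarrow> int"
  assumes "j < n" "\<And>i. i < n \<Longrightarrow> a i \<noteq> 0 \<Longrightarrow> p dvd z - i \<Longrightarrow> i = j"
  shows "(\<Sum>i<n. a i * int (multiplicity p (z - i))) = a j * int (multiplicity p (z - j))"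
proof -
  have "(\<Sum>i<n. a i * int (multiplicity p (z - i))) = (\<Sum>i\<in>{j}. a i * int (multiplicity p (z - i)))"
  proof (rule sum.mono_neutral_right)
    show "\<forall>i\<in>{..<n} - {j}. a i * int (multiplicity p (z - i)) = 0"
    proof
      fix i assume i: "i \<in> {..<n} - {j}"
      show "a i * int (multiplicity p (z - i)) = 0"
      proof (cases "a i = 0")
        case False
        hence "\<not> p dvd z - i" using assms(2)[of i] i by auto
        thus ?thesis by (simp add: not_dvd_imp_multiplicity_0)
      qed simp
    qed
  qed (use assms in auto)
  thus ?thesis by simp
qed

definition supported_ends :: "nat \<Rightarrow> nat \<Rightarrow> (nat \<Rightarrow> int) \<Rightarrow> bool" where
  "supported_ends n k e \<longleftrightarrow> (\<forall>i<n. e i \<noteq> 0 \<longrightarrow> i < k \<or> n \<le> i + k)"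

text \<open>A prime \<open>p > 2 * k\<close> dividing \<open>n - r\<close> with \<open>r < k\<close> separates the at most \<open>2 * k\<close> indices at
  the two ends modulo \<open>p\<close>, and the residue class of \<open>k\<close> contains none of them.\<close>

lemma supported_ends_step:
  assumes bal: "balanced n e" and supp: "supported_ends n k e"
    and p: "prime p" "2 * k < p" "p dvd m" "n < m + k" "m \<le> n" and m0: "0 < m"
  shows "supported_ends n (n - m) e"
proof -
  define r where "r = n - m"
  have r: "r < k" "n = m + r" using p by (auto simp: r_def)
  have m: "m = n div p * p" "n mod p = r"
  proof -
    obtain c where c: "m = p * c" using p(3) by auto
    have "r < p" using r p by simp
    thus "m = n div p * p" "n mod p = r" unfolding r(2) c by auto
  qed
  obtain \<kappa> where "balanced_at n e p \<kappa>"
    by (rule balancedE[OF bal p(1)])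
  note \<kappa> = balanced_atD[OF this]
  have S: "(\<Sum>i<n. e i * int (multiplicity p (m + t - i))) = \<kappa>" if "r \<le> t" "t < p" for t
  proof (rule \<kappa>)
    show "n \<le> m + t" using r(2) that by simp
    show "\<not> p dvd ((m + t) choose n)"
      using not_dvd_choose[of p n t] that p(1) m(2) unfolding m(1)[symmetric] by simp
  qed
  have dvd_m: "p dvd m + x \<longleftrightarrow> p dvd x" for x using p(3) by (simp add: dvd_add_right_iff)
  have small: False if "p dvd x" "0 < x" "x < p" for x using that by (auto dest: dvd_imp_le)
  have ends: "i < k \<or> n \<le> i + k" if "i < n" "e i \<noteq> 0" for i
    using supp that unfolding supported_ends_def by auto
  have p_le: "p \<le> m" using p(3) m0 by (rule dvd_imp_le)
  \<comment> \<open>For i at the left end, z - i differs from the multiple m of p by t - i, which is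
    less than p in absolute value.\<close>
  have low: "i = t" if "i < k" "t < p" "p dvd m + t - i" for i t
  proof (cases i t rule: linorder_cases)
    case less
    hence "p dvd m + (t - i)" using that by simp
    hence "p dvd t - i" by (simp only: dvd_m)
    moreover have "0 < t - i" "t - i < p" using less that by simp_all
    ultimately show ?thesis using small by blast
  next
    case greater
    have eq: "m + t - i = m - (i - t)" using greater by simp
    have "p dvd m - (m - (i - t))" using dvd_diff_nat[OF p(3) that(3)] unfolding eq .
    moreover have "i - t \<le> m" using that p p_le by simp
    ultimately have "p dvd i - t" by simp
    moreover have "0 < i - t" "i - t < p" using greater that p by linarith+
    ultimately show ?thesis using small by blast
  qed
  have "\<kappa> = 0"
  proof -
    have e0: "p dvd m + k - i \<Longrightarrow> e i = 0" if i: "i < n" for i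
    proof (rule ccontr)
      assume d: "p dvd m + k - i" "e i \<noteq> 0"
      show False
      proof (cases "i < k")
        case True
        thus False using low[of i k] d p by simp
      next
        case False
        hence "n \<le> i + k" using ends[OF i d(2)] by simp
        hence "m + k - i < p" "0 < m + k - i" using i r p by linarith+
        thus False using small[OF d(1)] by simp
      qed
    qed
    have "(\<Sum>i<n. e i * int (multiplicity p (m + k - i))) = 0"
    proof (rule sum.neutral, rule ballI)
      fix i assume "i \<in> {..<n}"
      thus "e i * int (multiplicity p (m + k - i)) = 0"
        using e0[of i] by (cases "p dvd m + k - i") (simp_all add: not_dvd_imp_multiplicity_0)
    qed
    thus ?thesis using S[of k] r p by simp
  qed
  \<comment> \<open>For z = m + j the index j gives z - j = m, and no other index of the support
    gives a multiple of p.\<close>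
  have left: "e j = 0" if j: "r \<le> j" "j < k" for j
  proof -
    have "(\<Sum>i<n. e i * int (multiplicity p (m + j - i))) = e j * int (multiplicity p (m + j - j))"
    proof (rule sum_single_multiple)
      show "j < n" using j p p_le by simp
      fix i assume i: "i < n" "e i \<noteq> 0" "p dvd m + j - i"
      show "i = j"
      proof (cases "i < k")
        case True
        thus ?thesis using low[of i j] i j p by simp
      next
        case False
        hence "n \<le> i + k" using ends[OF i(1,2)] by simp
        hence "m + j - i < p" "0 < m + j - i" using i j r p by linarith+
        thus ?thesis using small[OF i(3)] by simp
      qed
    qed
    hence "e j * int (multiplicity p m) = 0" using S[of j] j p \<open>\<kappa> = 0\<close> by simp
    moreover have "multiplicity p m \<noteq> 0"
      using p m0 by (simp add: prime_elem_multiplicity_eq_zero_iff)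
    ultimately show ?thesis by simp
  qed
  have right: "e j = 0" if j: "n \<le> j + k" "j < m" for j
  proof -
    \<comment> \<open>Chosen so that z - j = p for z = m + t; t < p because j < m, and r <= t
      because j >= n - k and p > 2k.\<close>
    define t where "t = p + j - m"
    have t: "r \<le> t" "t < p" "m + t - j = p" using j r p p_le by (auto simp: t_def)
    have "(\<Sum>i<n. e i * int (multiplicity p (m + t - i))) = e j * int (multiplicity p (m + t - j))"
    proof (rule sum_single_multiple)
      show "j < n" using j p by simp
      fix i assume i: "i < n" "e i \<noteq> 0" "p dvd m + t - i"
      show "i = j"
      proof (cases "i < k")
        case True
        hence "i = t" using low[of i t] i t by simp
        thus ?thesis using True j r p p_le by (simp add: t_def)
      next
        case False
        hence "n \<le> i + k" using ends[OF i(1,2)] by simp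
        have eq: "m + t = p + j" using t p_le j by (simp add: t_def)
        show ?thesis
        proof (cases i j rule: linorder_cases)
          case less
          hence "p dvd p + (j - i)" using i(3) eq by simp
          hence "p dvd j - i" by (simp add: dvd_add_right_iff)
          moreover have "0 < j - i" "j - i < p" using less j \<open>n \<le> i + k\<close> p by linarith+
          ultimately show ?thesis using small by blast
        next
          case greater
          have "p + j - i < p" "0 < p + j - i" using greater j i p r by linarith+
          thus ?thesis using small[of "p + j - i"] i(3) eq by simp
        qed
      qed
    qed
    hence "e j * int (multiplicity p p) = 0" using S[of t] t \<open>\<kappa> = 0\<close> by simp
    thus ?thesis using p(1) by simp
  qed
  show ?thesis unfolding supported_ends_def r_def[symmetric]
  proof (intro allI impI)
    fix i assume i: "i < n" "e i \<noteq> 0"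
    show "i < r \<or> n \<le> i + r"
      using ends[OF i] left[of i] right[of i] i r by force
  qed
qed

lemma multiplicity_two_power: "multiplicity 2 ((2::nat) ^ m) = m"
  by (simp add: multiplicity_same_power)

text \<open>No prime above 2 divides n, so the equations at 2 are used for z = n, n + 1, n + 2; the
  binomial coefficients are odd since 4 divides n. They read \<open>m * e 0 = \<kappa>\<close>,
  \<open>e (n - 1) = \<kappa>\<close> and \<open>e 0 = \<kappa>\<close>, and m >= 2 forces
  zero.\<close>

lemma supported_ends_power_two:
  assumes bal: "balanced n e" and supp: "supported_ends n 1 e" and n: "n = 2 ^ m" "m \<ge> 2"
  shows "supported_ends n 0 e"
proof -
  have "(2::nat) ^ 2 \<le> 2 ^ m" using n by (intro power_increasing) auto
  hence n4: "n \<ge> 4" using n by simp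
  have "(2::nat) ^ 2 dvd n" unfolding n(1) using n(2) by (rule le_imp_power_dvd)
  then obtain c where c: "n = 4 * c" by auto
  obtain \<kappa> where "balanced_at n e 2 \<kappa>"
    by (rule balancedE[OF bal two_is_prime_nat])
  note \<kappa> = balanced_atD[OF this]
  have sum: "(\<Sum>i<n. e i * int (multiplicity 2 (z - i))) =
      e 0 * int (multiplicity 2 z) + e (n - 1) * int (multiplicity 2 (z - (n - 1)))" for z
  proof -
    have "(\<Sum>i<n. e i * int (multiplicity 2 (z - i))) = (\<Sum>i\<in>{0, n - 1}. e i * int (multiplicity 2 (z - i)))"
      using supp n4 by (intro sum.mono_neutral_right) (auto simp: supported_ends_def)
    thus ?thesis using n4 by simp
  qed
  have "e 0 * int m = \<kappa>"
    using \<kappa>[of n] sum[of n] n4 multiplicity_two_power[of m] n(1) by simp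
  moreover have "e (n - 1) = \<kappa>"
  proof -
    have "\<not> 2 dvd (n + 1)" using c by simp
    moreover have "(n + 1) choose n = n + 1" by simp
    moreover have "n + 1 - (n - 1) = 2" using n4 by simp
    ultimately show ?thesis using \<kappa>[of "n + 1"] sum[of "n + 1"]
      by (simp add: not_dvd_imp_multiplicity_0)
  qed
  moreover have "e 0 = \<kappa>"
  proof -
    have "(n + 2) choose n = (2 * c + 1) * (4 * c + 1)"
      using binomial_symmetric[of n "n + 2"] c by (simp add: choose_two algebra_simps)
    moreover have "multiplicity 2 (n + 2) = 1"
    proof -
      have "n + 2 = 2 * (2 * c + 1)" using c by simp
      thus ?thesis by (simp only:) (subst multiplicity_times_same; simp add: not_dvd_imp_multiplicity_0)
    qed
    moreover have "n + 2 - (n - 1) = 3" using n4 by simp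
    ultimately show ?thesis using \<kappa>[of "n + 2"] sum[of "n + 2"]
      by (simp add: not_dvd_imp_multiplicity_0)
  qed
  ultimately have "e 0 * (int m - 1) = 0" "e (n - 1) = e 0" by (auto simp: algebra_simps)
  hence "e 0 = 0" "e (n - 1) = 0" using n(2) by auto
  thus ?thesis using supp unfolding supported_ends_def
    by (metis One_nat_def Suc_eq_plus1 add_diff_cancel_right' le_antisym less_Suc0 less_Suc_eq_le not_le add.right_neutral)
qed

lemma supported_ends_one:
  assumes bal: "balanced n e" and supp: "supported_ends n 1 e" and n: "n \<ge> 3"
  shows "supported_ends n 0 e"
proof (cases "\<exists>p. prime p \<and> p dvd n \<and> p \<noteq> 2")
  case True
  then obtain p where p: "prime p" "p dvd n" "p \<noteq> 2" by blast
  hence "2 < p" using prime_ge_2_nat[of p] by simp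
  thus ?thesis using supported_ends_step[OF bal supp p(1) _ p(2)] n by simp
next
  case False
  obtain m where m: "n = 2 ^ m"
  proof -
    have "\<exists>p. prime p \<and> p dvd n \<and> p \<noteq> 2" if "\<not> (\<exists>k. n = 2 ^ k)"
      using that Ex_other_prime_factor[of n 2] n by (auto simp: normalize_nat_def)
    thus ?thesis using False that by blast
  qed
  have "m \<ge> 2"
  proof (rule ccontr)
    assume "\<not> m \<ge> 2"
    hence "m = 0 \<or> m = 1" by auto
    thus False using m n by auto
  qed
  thus ?thesis using supported_ends_power_two[OF bal supp m] by simp
qed

lemma multiplicity_numerals: "multiplicity 3 (9::nat) = 2" "multiplicity 3 (3::nat) = 1" "multiplicity 3 (6::nat) = 1"
  "multiplicity 3 (12::nat) = 1" "multiplicity 5 (5::nat) = 1" "multiplicity 5 (10::nat) = 1"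
proof -
  have three: "multiplicity 3 (3 * x) = Suc (multiplicity 3 x)" if "x \<noteq> 0" for x :: nat
    using that by (intro multiplicity_times_same) auto
  have five: "multiplicity 5 (5 * x) = Suc (multiplicity 5 x)" if "x \<noteq> 0" for x :: nat
    using that by (intro multiplicity_times_same) auto
  show "multiplicity 3 (9::nat) = 2" "multiplicity 3 (3::nat) = 1" "multiplicity 3 (6::nat) = 1"
    "multiplicity 3 (12::nat) = 1" "multiplicity 5 (5::nat) = 1" "multiplicity 5 (10::nat) = 1"
    using three[of 3] three[of 1] three[of 2] three[of 4] five[of 1] five[of 2]
    by (simp_all add: not_dvd_imp_multiplicity_0)
qed

text \<open>The window 9, 8 has no prime factor above 4. The equations at 3 for z = 9, ..., 13,
  where the binomial coefficients 1, 10, 55, 220, 715 are prime to 3, determine the four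
  unknowns.\<close>

lemma supported_ends_9:
  assumes bal: "balanced 9 e" and supp: "supported_ends 9 2 e"
  shows "supported_ends 9 0 e"
proof -
  have z: "e 2 = 0" "e 3 = 0" "e 4 = 0" "e 5 = 0" "e 6 = 0"
    using supp[unfolded supported_ends_def, rule_format, of 2] supp[unfolded supported_ends_def, rule_format, of 3]
      supp[unfolded supported_ends_def, rule_format, of 4] supp[unfolded supported_ends_def, rule_format, of 5]
      supp[unfolded supported_ends_def, rule_format, of 6] by auto
  have three: "prime (3::nat)" by simp
  obtain \<kappa> where "balanced_at 9 e 3 \<kappa>"
    by (rule balancedE[OF bal three])
  note \<kappa> = balanced_atD[OF this]
  have sum: "(\<Sum>i<9. e i * int (multiplicity 3 (z - i))) =
      e 0 * int (multiplicity 3 z) + e 1 * int (multiplicity 3 (z - 1))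
      + e 7 * int (multiplicity 3 (z - 7)) + e 8 * int (multiplicity 3 (z - 8))" for z
    using z by (simp add: eval_nat_numeral)
  have ch: "10 choose 9 = (10::nat)" "11 choose 9 = (55::nat)" "12 choose 9 = (220::nat)" "13 choose 9 = (715::nat)"
    by (simp_all add: binomial_fact' fact_numeral)
  have "2 * e 0 = \<kappa>" using \<kappa>[of 9] sum[of 9] by (simp add: multiplicity_numerals not_dvd_imp_multiplicity_0)
  moreover have "e 0 = \<kappa>" using \<kappa>[of 12] sum[of 12] ch by (simp add: multiplicity_numerals not_dvd_imp_multiplicity_0)
  moreover have "e 8 = \<kappa>" using \<kappa>[of 11] sum[of 11] ch by (simp add: multiplicity_numerals not_dvd_imp_multiplicity_0)
  moreover have "2 * e 1 + e 7 = \<kappa>" using \<kappa>[of 10] sum[of 10] ch by (simp add: multiplicity_numerals not_dvd_imp_multiplicity_0)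
  moreover have "e 1 + e 7 = \<kappa>" using \<kappa>[of 13] sum[of 13] ch by (simp add: multiplicity_numerals not_dvd_imp_multiplicity_0)
  ultimately have "e 0 = 0" "e 1 = 0" "e 7 = 0" "e 8 = 0" by auto
  hence "\<forall>i\<in>{..<9}. e i = 0" using z by (simp add: lessThan_nat_numeral lessThan_Suc)
  thus ?thesis by (auto simp: supported_ends_def)
qed

text \<open>The window 10, 9, 8 has no prime factor above 6. The equations at 5 for z = 10, ..., 14
  identify most unknowns with each other; those at 3 for z = 10, 11, 13 then make all of them
  vanish.\<close>

lemma supported_ends_10:
  assumes bal: "balanced 10 e" and supp: "supported_ends 10 3 e"
  shows "supported_ends 10 0 e"
proof -
  have z: "e 3 = 0" "e 4 = 0" "e 5 = 0" "e 6 = 0"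
    using supp[unfolded supported_ends_def, rule_format, of 3]
      supp[unfolded supported_ends_def, rule_format, of 4] supp[unfolded supported_ends_def, rule_format, of 5]
      supp[unfolded supported_ends_def, rule_format, of 6] by auto
  have prime: "prime (3::nat)" "prime (5::nat)" by simp_all
  obtain \<kappa> where "balanced_at 10 e 3 \<kappa>"
    by (rule balancedE[OF bal prime(1)])
  note \<kappa> = balanced_atD[OF this]
  obtain \<kappa>' where "balanced_at 10 e 5 \<kappa>'"
    by (rule balancedE[OF bal prime(2)])
  note \<kappa>' = balanced_atD[OF this]
  have sum: "(\<Sum>i<10. e i * int (multiplicity p (z - i))) =
      e 0 * int (multiplicity p z) + e 1 * int (multiplicity p (z - 1)) + e 2 * int (multiplicity p (z - 2))
      + e 7 * int (multiplicity p (z - 7)) + e 8 * int (multiplicity p (z - 8)) + e 9 * int (multiplicity p (z - 9))" for z p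
    using z by (simp add: eval_nat_numeral)
  have ch: "11 choose 10 = (11::nat)" "12 choose 10 = (66::nat)" "13 choose 10 = (286::nat)" "14 choose 10 = (1001::nat)"
    by (simp_all add: binomial_fact' fact_numeral)
  have "e 0 = \<kappa>'" using \<kappa>'[of 10] sum[of 5 10] by (simp add: multiplicity_numerals not_dvd_imp_multiplicity_0)
  moreover have "e 1 = \<kappa>'" using \<kappa>'[of 11] sum[of 5 11] ch by (simp add: multiplicity_numerals not_dvd_imp_multiplicity_0)
  moreover have "e 2 + e 7 = \<kappa>'" using \<kappa>'[of 12] sum[of 5 12] ch by (simp add: multiplicity_numerals not_dvd_imp_multiplicity_0)
  moreover have "e 8 = \<kappa>'" using \<kappa>'[of 13] sum[of 5 13] ch by (simp add: multiplicity_numerals not_dvd_imp_multiplicity_0)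
  moreover have "e 9 = \<kappa>'" using \<kappa>'[of 14] sum[of 5 14] ch by (simp add: multiplicity_numerals not_dvd_imp_multiplicity_0)
  moreover have "2 * e 1 + e 7 = \<kappa>" using \<kappa>[of 10] sum[of 3 10] by (simp add: multiplicity_numerals not_dvd_imp_multiplicity_0)
  moreover have "2 * e 2 + e 8 = \<kappa>" using \<kappa>[of 11] sum[of 3 11] ch by (simp add: multiplicity_numerals not_dvd_imp_multiplicity_0)
  moreover have "e 1 + e 7 = \<kappa>" using \<kappa>[of 13] sum[of 3 13] ch by (simp add: multiplicity_numerals not_dvd_imp_multiplicity_0)
  ultimately have "e 0 = 0" "e 1 = 0" "e 2 = 0" "e 7 = 0" "e 8 = 0" "e 9 = 0" by auto
  hence "\<forall>i\<in>{..<10}. e i = 0" using z by (simp add: lessThan_nat_numeral lessThan_Suc)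
  thus ?thesis by (auto simp: supported_ends_def)
qed

theorem balanced_imp_const:
  assumes bal: "balanced n a" and n: "n \<ge> 1"
  shows "\<exists>c. \<forall>i<n. a i = c"
proof (cases "n = 1")
  case True
  thus ?thesis by (intro exI[of _ "a 0"]) auto
next
  case False
  hence n2: "n \<ge> 2" using n by simp
  define q where "q = (GREATEST q. prime q \<and> q \<le> n)"
  obtain q0 where q0: "prime q0" "q0 \<le> n" "n < 2 * q0" using bertrand[OF n2] by blast
  have q: "prime q" "q \<le> n"
    using GreatestI_nat[of "\<lambda>q. prime q \<and> q \<le> n" q0 n] q0 by (auto simp: q_def)
  have q_max: "q' \<le> q" if "prime q'" "q' \<le> n" for q'
    using Greatest_le_nat[of "\<lambda>q. prime q \<and> q \<le> n" q' n] that by (auto simp: q_def)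
  have qn: "n < 2 * q" using q_max[OF q0(1,2)] q0(3) by simp
  \<comment> \<open>The common exponent is read off from the equations at q: for z = q + t only the
    index t gives a multiple of q, namely q itself, of valuation 1.\<close>
  obtain c where "balanced_at n a q c"
    by (rule balancedE[OF bal q(1)])
  note c = balanced_atD[OF this]
  define e where "e = (\<lambda>i. a i - c)"
  have e: "balanced n e" unfolding e_def by (rule balanced_diff_const[OF bal])
  have "n div q = 1" "n mod q = n - q"
    using q qn by (auto simp: div_nat_eqI mod_if le_mod_geq)
  hence mid: "a t = c" if "n - q \<le> t" "t < q" for t
  proof -
    have "(\<Sum>i<n. a i * int (multiplicity q (q + t - i))) = a t * int (multiplicity q (q + t - t))"
    proof (rule sum_single_multiple)
      fix i assume i: "i < n" "q dvd q + t - i"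
      then obtain d where d: "q + t - i = q * d" by auto
      have "0 < q + t - i" "q + t - i < q * 2" using i that q by auto
      hence "d = 1" unfolding d by (cases d) auto
      thus "i = t" using d i that by simp
    qed (use that q in simp)
    moreover have "\<not> q dvd ((q + t) choose n)"
      using not_dvd_choose[of q n t] q that \<open>n div q = 1\<close> \<open>n mod q = n - q\<close> by simp
    ultimately show ?thesis using c[of "q + t"] that q(1) by simp
  qed
  have supp: "supported_ends n (n - q) e"
    unfolding supported_ends_def e_def
  proof (intro allI impI)
    fix i assume "a i - c \<noteq> 0"
    thus "i < n - q \<or> n \<le> i + (n - q)" using mid[of i] q by (cases "n - q \<le> i"; cases "i < q") auto
  qed
  have "supported_ends n 0 e" if "k \<le> n - q" "supported_ends n k e" for k
    using that
  proof (induction k rule: less_induct)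
    case (less k)
    \<comment> \<open>The bound k <= n - q keeps the window above the largest prime q; it persists
      because the new length is smaller.\<close>
    have np: "\<not> prime m" if "n < m + k" "m \<le> n" for m
      using q_max[of m] that less.prems by force
    consider "k = 0" | "k = 1" | "k \<ge> 2" "n \<ge> 11" | "k \<ge> 2" "n \<le> 10" by linarith
    thus ?case
    proof cases
      case 1
      thus ?thesis using less.prems by simp
    next
      case 2
      hence "n \<ge> 3" using less.prems qn q prime_ge_2_nat[of q] by linarith
      thus ?thesis using supported_ends_one[OF e] less.prems 2 by simp
    next
      case 3
      have "k \<le> n" using less.prems by simp
      then obtain m p where mp: "n < m + k" "m \<le> n" "prime p" "p dvd m" "2 * k < p"
        using window_large_prime[OF 3(2,1)] np by blast
      have "supported_ends n (n - m) e"
        using mp \<open>k \<le> n\<close>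
        by (intro supported_ends_step[OF e less.prems(2) mp(3,5,4,1,2)]) linarith
      thus ?thesis using less.IH[of "n - m"] mp less.prems by simp
    next
      case 4
      have "q \<in> {..8}" using less.prems 4 by simp
      have pr: "prime (2::nat)" "prime (3::nat)" "prime (5::nat)" "prime (7::nat)" by simp_all
      \<comment> \<open>Up to n = 8 the largest prime is at least n - 1, so k >= 2 is possible only
        for n = 9 and n = 10.\<close>
      have "n \<in> {9, 10} \<and> q = 7"
      proof -
        have "n \<le> q + 1" if "n \<le> 8"
        proof -
          have "n \<in> {2,3,4,5,6,7,8}" using that n2 by auto
          thus ?thesis using q_max[OF pr(1)] q_max[OF pr(2)] q_max[OF pr(3)] q_max[OF pr(4)] by auto
        qed
        moreover have "q + 2 \<le> n" using less.prems 4 by simp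
        ultimately have "n = 9 \<or> n = 10" using 4 by linarith
        moreover have "q \<ge> 7" using q_max[OF pr(4)] calculation by auto
        moreover have "\<not> prime (8::nat)" by simp
        hence "q \<noteq> 8" using q(1) by auto
        ultimately show ?thesis using \<open>q \<in> {..8}\<close> by auto
      qed
      hence "(n = 9 \<and> k = 2) \<or> (n = 10 \<and> k \<le> 3)" using less.prems 4 by auto
      moreover have "supported_ends 10 3 e" if "n = 10" "k \<le> 3"
        using less.prems that by (force simp: supported_ends_def)
      ultimately show ?thesis using supported_ends_9[of e] supported_ends_10[of e] e less.prems by auto
    qed
  qed
  hence "supported_ends n 0 e" using supp by blast
  hence "\<forall>i<n. a i = c" by (auto simp: supported_ends_def e_def)
  thus ?thesis by blast
qed

section \<open>Monoids of signed powers\<close>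

text \<open>Over an integral domain, since it is used both for polynomials and in their field of
  fractions.\<close>

definition signed_powers :: "'a::idom \<Rightarrow> 'a set" where
  "signed_powers F = {s * F ^ k | s k. s \<in> {1, - 1}}"

lemma signed_powersI: "s \<in> {1, - 1} \<Longrightarrow> s * F ^ k \<in> signed_powers F"
  by (auto simp: signed_powers_def)

lemma signed_powersE:
  assumes "x \<in> signed_powers F"
  obtains s k where "s \<in> {1, - 1}" "x = s * F ^ k"
  using assms by (auto simp: signed_powers_def)

lemma sign_mult: "s \<in> {1, - 1} \<Longrightarrow> t \<in> {1, - 1} \<Longrightarrow> s * t \<in> {1, - 1 :: 'a::ring_1}"
  by auto

lemma sign_square: "s \<in> {1, - 1} \<Longrightarrow> s * s = (1 :: 'a::ring_1)"
  by auto

text \<open>The powers of F are distinct up to sign, so divisibility is the order of exponents.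
  Hence divisor chains terminate, and the irreducible elements are F and -F, which are
  prime.\<close>

lemma factorial_monoid_signed_powers:
  fixes F :: "'a::idom"
  assumes F: "F \<noteq> 0" and inj: "\<And>i j s. s \<in> {1, - 1} \<Longrightarrow> F ^ i = s * F ^ j \<Longrightarrow> i = j"
  shows "factorial_monoid \<lparr>carrier = signed_powers F, mult = (*), one = 1\<rparr>"
proof -
  define G where "G = \<lparr>carrier = signed_powers F, mult = (*), one = (1 :: 'a)\<rparr>"
  have sel: "carrier G = signed_powers F" "\<And>x y. x \<otimes>\<^bsub>G\<^esub> y = x * y" "\<one>\<^bsub>G\<^esub> = 1"
    by (simp_all add: G_def)
  have nz: "x \<noteq> 0" if "x \<in> signed_powers F" for x using that F by (auto elim!: signed_powersE)
  have one: "1 \<in> signed_powers F" using signed_powersI[of 1 F 0] by simp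
  have mult: "x * y \<in> signed_powers F" if x: "x \<in> signed_powers F" and y: "y \<in> signed_powers F" for x y
  proof -
    from x obtain s i where s: "s \<in> {1, - 1}" "x = s * F ^ i" by (rule signed_powersE)
    from y obtain t j where t: "t \<in> {1, - 1}" "y = t * F ^ j" by (rule signed_powersE)
    have "x * y = (s * t) * F ^ (i + j)" by (simp add: s(2) t(2) power_add mult_ac)
    thus ?thesis using signed_powersI[OF sign_mult[OF s(1) t(1)]] by simp
  qed
  have "comm_monoid G"
    by (rule comm_monoidI) (auto simp: sel one mult mult_ac)
  hence cancel: "comm_monoid_cancel G"
    by (rule comm_monoid_cancelI) (use nz in \<open>auto simp: sel\<close>)
  interpret comm_monoid_cancel G by (rule cancel)
  have dvd_iff: "(s * F ^ i) divides\<^bsub>G\<^esub> (t * F ^ j) \<longleftrightarrow> i \<le> j"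
    if st: "s \<in> {1, - 1}" "t \<in> {1, - 1}" for s t i j
  proof
    assume "i \<le> j"
    hence "t * F ^ j = (s * F ^ i) * ((s * t) * F ^ (j - i))"
      using sign_square[OF st(1)] by (metis (no_types, lifting) mult.assoc mult.commute mult_1 le_add_diff_inverse power_add)
    moreover have "(s * t) * F ^ (j - i) \<in> signed_powers F" by (intro signed_powersI sign_mult st)
    ultimately show "(s * F ^ i) divides\<^bsub>G\<^esub> (t * F ^ j)" by (auto simp only: factor_def sel)
  next
    assume "(s * F ^ i) divides\<^bsub>G\<^esub> (t * F ^ j)"
    then obtain c where c: "c \<in> signed_powers F" "t * F ^ j = (s * F ^ i) * c" by (auto simp: factor_def sel)
    from c(1) obtain u k where u: "u \<in> {1, - 1}" "c = u * F ^ k" by (rule signed_powersE)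
    have "F ^ j = (t * s * u) * F ^ (i + k)"
    proof -
      have "F ^ j = (t * t) * F ^ j" using sign_square[OF st(2)] by simp
      also have "\<dots> = t * (t * F ^ j)" by (simp add: mult.assoc)
      also have "\<dots> = (t * s * u) * F ^ (i + k)" unfolding c(2) u(2) by (simp add: power_add mult_ac)
      finally show ?thesis .
    qed
    moreover have "t * s * u \<in> {1, - 1}" by (intro sign_mult st u)
    ultimately have "j = i + k" by (intro inj)
    thus "i \<le> j" by simp
  qed
  have unit_iff: "s * F ^ i \<in> Units G \<longleftrightarrow> i = 0" if s: "s \<in> {1, - 1}" for s i
  proof -
    have "s * F ^ i \<in> Units G \<longleftrightarrow> (s * F ^ i) divides\<^bsub>G\<^esub> \<one>\<^bsub>G\<^esub>"
      using signed_powersI[OF s] Unit_eq_dividesone[of "s * F ^ i"] by (simp add: sel)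
    also have "\<dots> \<longleftrightarrow> i = 0" using dvd_iff[of s 1 i 0] s by (simp add: sel)
    finally show ?thesis .
  qed
  have "divisor_chain_condition_monoid G"
  proof
    \<comment> \<open>The exponent strictly increases from a proper factor to its multiple, so it
      serves as a measure.\<close>
    define e where "e x = (THE k. \<exists>s\<in>{1, - 1}. x = s * F ^ k)" for x
    have e: "e (s * F ^ k) = k" if s: "s \<in> {1, - 1}" for s k
      unfolding e_def
    proof (rule the_equality)
      show "\<exists>t\<in>{1, - 1}. s * F ^ k = t * F ^ k" using s by blast
      fix j assume "\<exists>t\<in>{1, - 1}. s * F ^ k = t * F ^ j"
      then obtain t where t: "t \<in> {1, - 1}" "s * F ^ k = t * F ^ j" by blast
      have "F ^ k = (s * s) * F ^ k" using sign_square[OF s] by simp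
      also have "\<dots> = s * (s * F ^ k)" by (simp add: mult.assoc)
      also have "\<dots> = (s * t) * F ^ j" unfolding t(2) by (simp add: mult.assoc)
      finally show "j = k" by (rule inj[OF sign_mult[OF s t(1)], symmetric])
    qed
    have "{(x, y). x \<in> carrier G \<and> y \<in> carrier G \<and> properfactor G x y} \<subseteq> measure e"
    proof clarify
      fix x y assume xy: "x \<in> carrier G" "y \<in> carrier G" "properfactor G x y"
      from xy(1) obtain s i where s: "s \<in> {1, - 1}" "x = s * F ^ i" unfolding sel by (rule signed_powersE)
      from xy(2) obtain t j where t: "t \<in> {1, - 1}" "y = t * F ^ j" unfolding sel by (rule signed_powersE)
      show "(x, y) \<in> measure e"
        using xy(3) dvd_iff[OF s(1) t(1), of i j] dvd_iff[OF t(1) s(1), of j i]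
        by (simp add: properfactor_def s(2) t(2) e[OF s(1)] e[OF t(1)])
    qed
    thus "wf {(x, y). x \<in> carrier G \<and> y \<in> carrier G \<and> properfactor G x y}"
      by (rule wf_subset[rotated]) simp
  qed
  moreover have "primeness_condition_monoid G"
  proof
    fix x assume x: "x \<in> carrier G" "Divisibility.irreducible G x"
    from x(1) obtain s k where s: "s \<in> {1, - 1}" "x = s * F ^ k" unfolding sel by (rule signed_powersE)
    have "k \<noteq> 0" using x(2) unit_iff[OF s(1), of k] by (auto simp: Divisibility.irreducible_def s(2))
    moreover have "\<not> 1 < k"
    proof
      assume "1 < k"
      hence "properfactor G (1 * F ^ 1) x"
        unfolding properfactor_def s(2) using dvd_iff[of 1 s 1 k] dvd_iff[of s 1 k 1] s(1) by simp
      moreover have "1 * F ^ 1 \<in> carrier G" unfolding sel by (rule signed_powersI) simp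
      ultimately have "1 * F ^ 1 \<in> Units G" using x(2) unfolding Divisibility.irreducible_def by blast
      thus False using unit_iff[of 1 1] by simp
    qed
    ultimately have k: "k = 1" by simp
    show "Divisibility.prime G x"
      unfolding Divisibility.prime_def
    proof (intro conjI ballI impI)
      show "x \<notin> Units G" using unit_iff[OF s(1), of k] k by (simp add: s(2))
      fix a b assume ab: "a \<in> carrier G" "b \<in> carrier G" "x divides\<^bsub>G\<^esub> (a \<otimes>\<^bsub>G\<^esub> b)"
      from ab(1) obtain t i where t: "t \<in> {1, - 1}" "a = t * F ^ i" unfolding sel by (rule signed_powersE)
      from ab(2) obtain u j where u: "u \<in> {1, - 1}" "b = u * F ^ j" unfolding sel by (rule signed_powersE)
      have "a \<otimes>\<^bsub>G\<^esub> b = (t * u) * F ^ (i + j)" by (simp add: sel t(2) u(2) power_add mult_ac)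
      hence "k \<le> i + j" using ab(3) dvd_iff[OF s(1) sign_mult[OF t(1) u(1)], of k "i + j"] by (simp add: s(2))
      hence "k \<le> i \<or> k \<le> j" using k by linarith
      thus "x divides\<^bsub>G\<^esub> a \<or> x divides\<^bsub>G\<^esub> b"
        unfolding s(2) t(2) u(2) using dvd_iff[OF s(1) t(1), of k i] dvd_iff[OF s(1) u(1), of k j] by simp
    qed
  qed
  ultimately show ?thesis using factorial_condition_one[of G] unfolding G_def by simp
qed

section \<open>Divisorial ideals of a monoid of signed powers\<close>

definition power_ideal :: "'a::field \<Rightarrow> int \<Rightarrow> 'a set" where
  "power_ideal F i = {s * F powi k | s k. s \<in> {1, - 1} \<and> i \<le> k}"

locale signed_power_monoid =
  fixes F :: "'a::field"
  assumes F_nz: "F \<noteq> 0" and F_inj: "\<And>i j s. s \<in> {1, - 1} \<Longrightarrow> F ^ i = s * F ^ j \<Longrightarrow> i = j"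
begin

abbreviation "H \<equiv> signed_powers F"
abbreviation "I \<equiv> power_ideal F"

lemma powi_inj:
  assumes s: "s \<in> {1, - 1}" "t \<in> {1, - 1}" and eq: "s * F powi i = t * F powi j"
  shows "i = j"
proof -
  \<comment> \<open>A shift making both exponents nonnegative, so that \<open>F_inj\<close>
    applies.\<close>
  define N where "N = nat \<bar>i\<bar> + nat \<bar>j\<bar>"
  have N: "F powi x * F ^ N = F ^ nat (x + int N)" if "\<bar>x\<bar> \<le> int N" for x
  proof -
    have "F powi x * F ^ N = F powi (x + int N)" using F_nz by (simp add: power_int_add)
    also have "\<dots> = F ^ nat (x + int N)" using that by (simp add: power_int_def)
    finally show ?thesis .
  qed
  have "F ^ nat (i + int N) = (s * s) * F ^ nat (i + int N)" using sign_square[OF s(1)] by simp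
  also have "\<dots> = s * (s * F powi i) * F ^ N" using N[of i] by (simp add: N_def mult_ac)
  also have "\<dots> = (s * t) * (F powi j * F ^ N)" unfolding eq by (simp add: mult_ac)
  also have "F powi j * F ^ N = F ^ nat (j + int N)" using N[of j] by (simp add: N_def)
  finally have "nat (i + int N) = nat (j + int N)" using F_inj[OF sign_mult[OF s]] by blast
  moreover have "0 \<le> i + int N" "0 \<le> j + int N" by (simp_all add: N_def)
  ultimately show ?thesis by simp
qed

lemma power_ideal_iff: "s \<in> {1, - 1} \<Longrightarrow> s * F powi k \<in> I i \<longleftrightarrow> i \<le> k"
  unfolding power_ideal_def using powi_inj by blast

lemma power_idealE:
  assumes "x \<in> I i"
  obtains s k where "s \<in> {1, - 1}" "i \<le> k" "x = s * F powi k"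
  using assms by (auto simp: power_ideal_def)

lemma H_eq: "H = I 0"
proof (intro equalityI subsetI)
  fix x assume "x \<in> H"
  then obtain s k where "s \<in> {1, - 1}" "x = s * F ^ k" by (rule signed_powersE)
  thus "x \<in> I 0" using power_ideal_iff[of s "int k" 0] by simp
next
  fix x assume "x \<in> I 0"
  then obtain s k where "s \<in> {1, - 1}" "0 \<le> k" "x = s * F powi k" by (rule power_idealE)
  thus "x \<in> H" using signed_powersI[of s F "nat k"] by (simp add: power_int_def)
qed

lemma quotient_iff: "x \<in> quotient_group H \<longleftrightarrow> (\<exists>s\<in>{1, - 1}. \<exists>k. x = s * F powi k)"
proof
  assume "x \<in> quotient_group H"
  then obtain a b where ab: "a \<in> H" "b \<in> H" "x = a / b" by (auto simp: quotient_group_def)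
  from ab(1) obtain s i where s: "s \<in> {1, - 1}" "a = s * F ^ i" by (rule signed_powersE)
  from ab(2) obtain t j where t: "t \<in> {1, - 1}" "b = t * F ^ j" by (rule signed_powersE)
  have "x = (s * t) * F powi (int i - int j)"
    using t(1) F_nz by (auto simp: ab(3) s(2) t(2) power_int_diff)
  thus "\<exists>s\<in>{1, - 1}. \<exists>k. x = s * F powi k" using sign_mult[OF s(1) t(1)] by blast
next
  assume "\<exists>s\<in>{1, - 1}. \<exists>k. x = s * F powi k"
  then obtain s k where s: "s \<in> {1, - 1}" "x = s * F powi k" by blast
  have "x = (s * F ^ nat k) / (1 * F ^ nat (- k))"
    using F_nz s(2) by (cases "k \<ge> 0") (auto simp: power_int_def field_simps)
  thus "x \<in> quotient_group H"
    unfolding quotient_group_def using signed_powersI[OF s(1)] signed_powersI[of 1 F] by blast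
qed

lemma quotientE:
  assumes "x \<in> quotient_group H"
  obtains s k where "s \<in> {1, - 1}" "x = s * F powi k"
  using assms quotient_iff by blast

lemma mult_power_ideal_iff:
  assumes "s \<in> {1, - 1}" "t \<in> {1, - 1}"
  shows "(s * F powi k) * (t * F powi l) \<in> I i \<longleftrightarrow> i \<le> k + l"
proof -
  have eq: "(s * F powi k) * (t * F powi l) = (s * t) * F powi (k + l)"
    using F_nz by (simp add: power_int_add mult_ac)
  show ?thesis unfolding eq by (rule power_ideal_iff[OF sign_mult[OF assms]])
qed

text \<open>Only the lowest exponent in J matters, and it has to be attained. In this form the lemma
  applies to product sets as well as to ideals.\<close>

lemma ideal_inverse_eq:
  assumes J: "J \<subseteq> I i" and s: "s \<in> {1, - 1}" "s * F powi i \<in> J"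
  shows "ideal_inverse H J = I (- i)"
proof (intro equalityI subsetI)
  fix x assume "x \<in> ideal_inverse H J"
  hence x: "x \<in> quotient_group H" "x * (s * F powi i) \<in> I 0"
    using s(2) by (auto simp: ideal_inverse_def H_eq)
  from x(1) obtain t k where t: "t \<in> {1, - 1}" "x = t * F powi k" by (rule quotientE)
  have "0 \<le> k + i" using x(2) mult_power_ideal_iff[OF t(1) s(1)] by (simp add: t(2))
  thus "x \<in> I (- i)" using power_ideal_iff[OF t(1)] t(2) by simp
next
  fix x assume "x \<in> I (- i)"
  then obtain t k where t: "t \<in> {1, - 1}" "- i \<le> k" "x = t * F powi k" by (rule power_idealE)
  have "x * y \<in> H" if "y \<in> J" for y
  proof -
    have "y \<in> I i" using that J by blast
    then obtain u l where u: "u \<in> {1, - 1}" "i \<le> l" "y = u * F powi l" by (rule power_idealE)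
    show ?thesis unfolding t(3) u(3) H_eq using mult_power_ideal_iff[OF t(1) u(1)] t(2) u(2) by simp
  qed
  thus "x \<in> ideal_inverse H J" using t quotient_iff by (auto simp: ideal_inverse_def)
qed

lemma v_closure_eq:
  assumes "J \<subseteq> I i" "s \<in> {1, - 1}" "s * F powi i \<in> J"
  shows "v_closure H J = I i"
proof -
  have "1 * F powi (- i) \<in> I (- i)" by (subst power_ideal_iff) auto
  thus ?thesis
    unfolding v_closure_def ideal_inverse_eq[OF assms] using ideal_inverse_eq[of "I (- i)" "- i" 1] by simp
qed

text \<open>A common denominator bounds the exponents occurring in J from below. Their minimum i is
  attained in J, so the v-closure of J, which is J itself, equals \<open>I i\<close>.\<close>

lemma divisorial_iff: "divisorial_fractional_ideal H J \<longleftrightarrow> (\<exists>i. J = I i)"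
proof
  assume J: "divisorial_fractional_ideal H J"
  then obtain c x0 where c: "c \<in> H" "\<And>x. x \<in> J \<Longrightarrow> c * x \<in> H" and x0: "x0 \<in> J"
    and sub: "J \<subseteq> quotient_group H" and vJ: "v_closure H J = J"
    unfolding divisorial_fractional_ideal_def by (metis ex_in_conv)
  from c(1) obtain s i where s: "s \<in> {1, - 1}" "c = s * F ^ i" by (rule signed_powersE)
  \<comment> \<open>Since c is F^i up to sign and moves J into H, all exponents in J are at least
    -i; shifting by i makes the minimum one of natural numbers.\<close>
  define P where "P = (\<lambda>j::nat. \<exists>t\<in>{1, - 1}. t * F powi (int j - int i) \<in> J)"
  have P_ex: "\<exists>t\<in>{1, - 1}. x = t * F powi (int j - int i) \<and> P j" if "x \<in> J" "j = nat (k + int i)"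
      "t \<in> {1, - 1}" "x = t * F powi k" for x j t k
  proof -
    have "c * x \<in> I 0" using c(2)[OF that(1)] H_eq by simp
    hence "0 \<le> int i + k" using mult_power_ideal_iff[OF s(1) that(3), of "int i" k 0] s(2) that(4) by simp
    hence "int j - int i = k" using that(2) by simp
    thus ?thesis using that unfolding P_def by blast
  qed
  have ex: "\<exists>j. P j"
  proof -
    from x0 sub have "x0 \<in> quotient_group H" by blast
    then obtain t k where "t \<in> {1, - 1}" "x0 = t * F powi k" by (rule quotientE)
    thus ?thesis using P_ex[OF x0 refl] by blast
  qed
  define j0 where "j0 = (LEAST j. P j)"
  have "P j0" unfolding j0_def using ex by (rule LeastI_ex)
  then obtain t where t: "t \<in> {1, - 1}" "t * F powi (int j0 - int i) \<in> J" unfolding P_def by blast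
  have "J \<subseteq> I (int j0 - int i)"
  proof
    fix x assume x: "x \<in> J"
    hence "x \<in> quotient_group H" using sub by blast
    then obtain u k where u: "u \<in> {1, - 1}" "x = u * F powi k" by (rule quotientE)
    obtain u' where u': "u' \<in> {1, - 1}" "x = u' * F powi (int (nat (k + int i)) - int i)" "P (nat (k + int i))"
      using P_ex[OF x refl u] by blast
    have "j0 \<le> nat (k + int i)" unfolding j0_def using u'(3) by (rule Least_le)
    hence "int j0 - int i \<le> int (nat (k + int i)) - int i" by linarith
    thus "x \<in> I (int j0 - int i)" unfolding u'(2) power_ideal_iff[OF u'(1)] .
  qed
  from v_closure_eq[OF this t] show "\<exists>i. J = I i" using vJ by auto
next
  assume "\<exists>i. J = I i"
  then obtain i where J: "J = I i" by blast
  have mem: "1 * F powi i \<in> I i" by (subst power_ideal_iff) auto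
  have "I i \<subseteq> quotient_group H" using quotient_iff by (auto elim!: power_idealE)
  moreover have "\<exists>c\<in>H. \<forall>x\<in>I i. c * x \<in> H"
  proof (intro bexI ballI)
    show "1 * F powi \<bar>i\<bar> \<in> H" unfolding H_eq by (subst power_ideal_iff) auto
    fix x assume "x \<in> I i"
    then obtain s k where s: "s \<in> {1, - 1}" "i \<le> k" "x = s * F powi k" by (rule power_idealE)
    show "1 * F powi \<bar>i\<bar> * x \<in> H"
      unfolding H_eq s(3) using mult_power_ideal_iff[of 1 s] s by simp
  qed
  ultimately show "divisorial_fractional_ideal H J"
    unfolding divisorial_fractional_ideal_def J using mem v_closure_eq[of "I i" i 1] by auto
qed

lemma krull: "krull_monoid H"
  unfolding krull_monoid_def
proof (intro conjI)
  have "x * y \<in> H" if "x \<in> H" "y \<in> H" for x y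
  proof -
    from that obtain s k where s: "s \<in> {1, - 1}" "x = s * F ^ k" by (auto elim!: signed_powersE)
    from that(2) obtain t l where t: "t \<in> {1, - 1}" "y = t * F ^ l" by (rule signed_powersE)
    have "x * y = (s * t) * F ^ (k + l)" by (simp add: s(2) t(2) power_add mult_ac)
    thus ?thesis using signed_powersI[OF sign_mult[OF s(1) t(1)]] by simp
  qed
  thus "mult_submonoid H"
    unfolding mult_submonoid_def using signed_powersI[of 1 F 0] F_nz by (auto elim!: signed_powersE)
next
  show "completely_integrally_closed H"
    unfolding completely_integrally_closed_def
  proof (intro ballI impI)
    fix x assume x: "x \<in> quotient_group H" "\<exists>c\<in>H. \<forall>k::nat. c * x ^ k \<in> H"
    from x(1) obtain s k where s: "s \<in> {1, - 1}" "x = s * F powi k" by (rule quotientE)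
    from x(2) obtain c where c: "c \<in> I 0" "\<And>j::nat. c * x ^ j \<in> I 0" by (auto simp: H_eq)
    from c(1) obtain t l where t: "t \<in> {1, - 1}" "0 \<le> l" "c = t * F powi l" by (rule power_idealE)
    have "0 \<le> k"
    proof (rule ccontr)
      assume k: "\<not> 0 \<le> k"
      \<comment> \<open>With k <= -1 the exponent l + k * j of c * x^j is at most -1.\<close>
      define j where "j = nat (l + 1)"
      have "s ^ j \<in> {1, - 1}" using s(1) by (cases "even j") auto
      moreover have "x ^ j = s ^ j * F powi (k * int j)"
        by (simp add: s(2) power_mult_distrib power_int_mult)
      ultimately have "0 \<le> l + k * int j"
        using c(2)[of j] mult_power_ideal_iff[OF t(1), of "s ^ j" l "k * int j" 0] by (simp add: t(3))
      moreover have "k * int j \<le> - 1 * int j" using k by (intro mult_right_mono) auto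
      ultimately show False using t(2) by (simp add: j_def)
    qed
    thus "x \<in> H" unfolding H_eq s(2) using power_ideal_iff[OF s(1)] by simp
  qed
next
  show "acc_divisorial_ideals H"
    unfolding acc_divisorial_ideals_def
  proof (intro allI impI)
    fix J :: "nat \<Rightarrow> 'a set"
    assume J: "\<forall>i. divisorial_fractional_ideal H (J i) \<and> J i \<subseteq> H \<and> J i \<subseteq> J (Suc i)"
    hence "\<forall>i. \<exists>e. J i = I e" using divisorial_iff by blast
    then obtain e where e: "\<And>i. J i = I (e i)" by metis
    have sub: "j \<le> i" if "I i \<subseteq> I j" for i j
    proof -
      have "1 * F powi i \<in> I i" by (subst power_ideal_iff) auto
      hence "1 * F powi i \<in> I j" using that by blast
      thus ?thesis by (subst (asm) power_ideal_iff) auto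
    qed
    have e0: "0 \<le> e i" and e_Suc: "e (Suc i) \<le> e i" for i
      using J[rule_format, of i] sub e H_eq by auto
    have e_mono: "e j \<le> e i" if "i \<le> j" for i j
      using that by (induction j rule: dec_induct) (auto intro: order.trans[OF e_Suc])
    \<comment> \<open>The exponents e i decrease along the chain and are nonnegative, so the chain
      is constant from a minimal one on.\<close>
    define N where "N = arg_min (\<lambda>i. nat (e i)) (\<lambda>_. True)"
    have N: "nat (e N) \<le> nat (e i)" for i unfolding N_def by (rule arg_min_nat_le) simp
    have "J i = J N" if "i \<ge> N" for i
    proof -
      have "e i = e N" using e_mono[OF that] N[of i] e0[of i] e0[of N] by linarith
      thus ?thesis by (simp add: e)
    qed
    thus "\<exists>N. \<forall>i\<ge>N. J i = J N" by blast
  qed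
qed

lemma principal_eq: "principal_fractional_ideals H = range I"
proof (intro equalityI subsetI)
  have *: "(\<lambda>x. (s * F powi k) * x) ` H = I k" if s: "s \<in> {1, - 1}" for s k
  proof (intro equalityI subsetI)
    fix y assume "y \<in> (\<lambda>x. (s * F powi k) * x) ` H"
    then obtain x where x: "x \<in> I 0" "y = (s * F powi k) * x" by (auto simp: H_eq)
    from x(1) obtain t l where t: "t \<in> {1, - 1}" "0 \<le> l" "x = t * F powi l" by (rule power_idealE)
    show "y \<in> I k" unfolding x(2) t(3) using mult_power_ideal_iff[OF s t(1)] t(2) by simp
  next
    fix y assume "y \<in> I k"
    then obtain t l where t: "t \<in> {1, - 1}" "k \<le> l" "y = t * F powi l" by (rule power_idealE)
    have "(s * F powi k) * ((s * t) * F powi (l - k)) = (s * s) * t * (F powi k * F powi (l - k))"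
      by (simp add: mult_ac)
    also have "\<dots> = y" using sign_square[OF s] F_nz by (simp add: t(3) power_int_add[symmetric])
    finally have "y = (s * F powi k) * ((s * t) * F powi (l - k))" ..
    moreover have "(s * t) * F powi (l - k) \<in> H"
      unfolding H_eq using power_ideal_iff[OF sign_mult[OF s t(1)]] t(2) by simp
    ultimately show "y \<in> (\<lambda>x. (s * F powi k) * x) ` H" by blast
  qed
  {
    fix J assume "J \<in> principal_fractional_ideals H"
    then obtain a where a: "a \<in> quotient_group H" "J = (\<lambda>x. a * x) ` H"
      by (auto simp: principal_fractional_ideals_def)
    from a(1) obtain s k where "s \<in> {1, - 1}" "a = s * F powi k" by (rule quotientE)
    thus "J \<in> range I" using * a(2) by simp
  next
    fix J assume "J \<in> range I"
    then obtain k where k: "J = I k" by blast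
    have "1 * F powi k \<in> quotient_group H" using quotient_iff by blast
    thus "J \<in> principal_fractional_ideals H"
      unfolding principal_fractional_ideals_def k using *[of 1 k] by blast
  }
qed

lemma carrier_divisorial_group: "carrier (divisorial_group H) = range I"
  by (auto simp: divisorial_group_def divisorial_iff)

lemma mult_divisorial_group: "I i \<otimes>\<^bsub>divisorial_group H\<^esub> I j = I (i + j)"
proof -
  have "v_closure H {x * y |x y. x \<in> I i \<and> y \<in> I j} = I (i + j)"
  proof (rule v_closure_eq)
    show "{x * y |x y. x \<in> I i \<and> y \<in> I j} \<subseteq> I (i + j)"
    proof clarify
      fix x y assume "x \<in> I i" "y \<in> I j"
      from \<open>x \<in> I i\<close> obtain s k where s: "s \<in> {1, - 1}" "i \<le> k" "x = s * F powi k" by (rule power_idealE)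
      from \<open>y \<in> I j\<close> obtain t l where t: "t \<in> {1, - 1}" "j \<le> l" "y = t * F powi l" by (rule power_idealE)
      show "x * y \<in> I (i + j)" unfolding s(3) t(3) using mult_power_ideal_iff[OF s(1) t(1)] s(2) t(2) by simp
    qed
    have "1 * F powi i \<in> I i" "1 * F powi j \<in> I j" by (subst power_ideal_iff; auto)+
    moreover have "1 * F powi (i + j) = (1 * F powi i) * (1 * F powi j)"
      using F_nz by (simp add: power_int_add)
    ultimately show "1 * F powi (i + j) \<in> {x * y |x y. x \<in> I i \<and> y \<in> I j}" by blast
  qed simp
  thus ?thesis by (simp add: divisorial_group_def)
qed

text \<open>Every divisorial fractional ideal is some \<open>I i\<close>, hence principal, so the
  divisorial group is factored by itself.\<close>

lemma trivial_class_group: "trivial_group (divisor_class_group H)"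
proof -
  let ?D = "divisorial_group H"
  have one: "\<one>\<^bsub>?D\<^esub> = I 0" by (simp add: divisorial_group_def H_eq)
  have D: "comm_group ?D"
  proof (rule comm_groupI)
    fix x assume "x \<in> carrier ?D"
    then obtain i where i: "x = I i" by (auto simp: carrier_divisorial_group)
    show "\<exists>y\<in>carrier ?D. y \<otimes>\<^bsub>?D\<^esub> x = \<one>\<^bsub>?D\<^esub>"
      unfolding i one carrier_divisorial_group
      by (intro bexI[of _ "I (- i)"]) (auto simp: mult_divisorial_group)
  qed (auto simp: carrier_divisorial_group mult_divisorial_group one add_ac)
  interpret D: comm_group ?D by (rule D)
  have P: "principal_fractional_ideals H = carrier ?D"
    by (simp add: principal_eq carrier_divisorial_group)
  have normal: "carrier ?D \<lhd> ?D"
    by (rule D.subgroup_imp_normal[OF D.subgroup_self])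
  have coset: "carrier ?D #>\<^bsub>?D\<^esub> x = carrier ?D" if "x \<in> carrier ?D" for x
    using D.coset_join2[OF that D.subgroup_self that] .
  have "group (?D Mod carrier ?D)" by (rule normal.factorgroup_is_group[OF normal])
  moreover have "carrier (?D Mod carrier ?D) = {carrier ?D}"
    using coset D.one_closed unfolding FactGroup_def RCOSETS_def by auto
  ultimately show ?thesis
    unfolding divisor_class_group_def P trivial_group_def by (simp add: FactGroup_def)
qed

end

section \<open>Divisors of powers of binomial polynomials\<close>

lemma nat_pow_Int_Z: "f [^]\<^bsub>Int_Z\<^esub> (m::nat) = f ^ m"
  by (induction m) (simp_all add: nat_pow_def Int_Z_def mult.commute)

lemma Int_Z_mult: "g \<in> carrier Int_Z \<Longrightarrow> h \<in> carrier Int_Z \<Longrightarrow> g * h \<in> carrier Int_Z"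
  by (auto simp: Int_Z_def)

lemma Int_Z_power: "g \<in> carrier Int_Z \<Longrightarrow> g ^ k \<in> carrier Int_Z"
  by (auto simp: Int_Z_def)

lemma poly_binom_poly: "poly (binom_poly n) x = x gchoose n"
  by (simp add: binom_poly_def gbinomial_prod_rev poly_prod atLeast0LessThan)

lemma poly_binom_poly_nat: "poly (binom_poly n) (of_nat z) = of_nat (z choose n)"
  by (simp add: poly_binom_poly binomial_gbinomial)

lemma gbinomial_of_int_Ints: "(of_int z gchoose n :: rat) \<in> \<int>"
proof (cases "z \<ge> 0")
  case True
  hence "of_int z gchoose n = (of_nat (nat z choose n) :: rat)" by (simp add: binomial_gbinomial)
  thus ?thesis by simp
next
  case False
  have "(of_int z gchoose n :: rat) = (- 1) ^ n * ((- of_int z + of_nat n - 1) gchoose n)"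
    using gbinomial_minus[of "- of_int z :: rat" n] by simp
  also have "- of_int z + of_nat n - 1 = (of_nat (nat (- z + int n - 1)) :: rat)"
    using False by simp
  also have "(\<dots> gchoose n) = of_nat (nat (- z + int n - 1) choose n)"
    by (rule binomial_gbinomial[symmetric])
  finally show ?thesis by simp
qed

lemma binom_poly_Int_Z: "binom_poly n \<in> carrier Int_Z"
  by (simp add: Int_Z_def poly_binom_poly gbinomial_of_int_Ints)

text \<open>Induction on the total exponent: at a root of the product one linear factor divides g or
  h and is cancelled. If it divides g, one exponent of g goes up; if it divides h, g is
  unchanged.\<close>

lemma factor_of_linear_product:
  fixes g h :: "'a::field poly" and x :: "nat \<Rightarrow> 'a"
  assumes "g * h = smult c (\<Prod>i<n. [:- x i, 1:] ^ e i)" "c \<noteq> 0"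
  shows "\<exists>c' a. g = smult c' (\<Prod>i<n. [:- x i, 1:] ^ a i)"
  using assms
proof (induction "\<Sum>i<n. e i" arbitrary: e g h)
  case 0
  hence "e i = 0" if "i < n" for i using that by simp
  hence gh: "g * h = [:c:]" using 0 by simp
  hence "g \<noteq> 0" "h \<noteq> 0" using 0 by auto
  hence "degree g + degree h = degree (g * h)" by (simp add: degree_mult_eq)
  hence "degree g = 0" unfolding gh by simp
  then obtain c' where "g = [:c':]" by (rule degree_eq_zeroE)
  thus ?case by (intro exI[of _ c'] exI[of _ "\<lambda>_. 0"]) simp
next
  case (Suc s)
  then obtain j where j: "j < n" "e j > 0" by (metis Zero_not_Suc lessThan_iff neq0_conv sum.neutral)
  define e' where "e' = e(j := e j - 1)"
  define L where "L = [:- x j, 1:]"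
  have L: "L \<noteq> 0" by (simp add: L_def)
  have split: "(\<Prod>i<n. [:- x i, 1:] ^ b i) = L ^ b j * (\<Prod>i\<in>{..<n} - {j}. [:- x i, 1:] ^ b i)" for b
    using j by (subst prod.remove[of _ j]) (auto simp: L_def)
  have "(\<Prod>i\<in>{..<n} - {j}. [:- x i, 1:] ^ e' i) = (\<Prod>i\<in>{..<n} - {j}. [:- x i, 1:] ^ e i)"
    by (intro prod.cong) (auto simp: e'_def)
  hence P: "(\<Prod>i<n. [:- x i, 1:] ^ e i) = L * (\<Prod>i<n. [:- x i, 1:] ^ e' i)"
    using j unfolding split by (simp add: e'_def power_eq_if mult.assoc)
  have s: "s = (\<Sum>i<n. e' i)"
  proof -
    have "(\<Sum>i<n. e i) = e j + (\<Sum>i\<in>{..<n} - {j}. e i)" "(\<Sum>i<n. e' i) = e' j + (\<Sum>i\<in>{..<n} - {j}. e' i)"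
      using j by (simp_all add: sum.remove)
    moreover have "(\<Sum>i\<in>{..<n} - {j}. e' i) = (\<Sum>i\<in>{..<n} - {j}. e i)"
      by (intro sum.cong) (auto simp: e'_def)
    ultimately show ?thesis using Suc(2) j by (simp add: e'_def)
  qed
  have "poly (g * h) (x j) = 0" unfolding Suc.prems(1) P by (simp add: L_def)
  hence "L dvd g \<or> L dvd h" by (auto simp: L_def poly_eq_0_iff_dvd)
  thus ?case
  proof
    assume "L dvd g"
    then obtain g' where g': "g = L * g'" by auto
    have "L * (g' * h) = L * smult c (\<Prod>i<n. [:- x i, 1:] ^ e' i)"
      using Suc.prems(1) unfolding P g' by (simp add: mult_ac)
    hence "g' * h = smult c (\<Prod>i<n. [:- x i, 1:] ^ e' i)" using L by (simp only: mult_cancel_left) simp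
    from Suc.hyps(1)[OF s this Suc.prems(2)] obtain c' a where a: "g' = smult c' (\<Prod>i<n. [:- x i, 1:] ^ a i)"
      by blast
    have "(\<Prod>i\<in>{..<n} - {j}. [:- x i, 1:] ^ (a(j := Suc (a j))) i) = (\<Prod>i\<in>{..<n} - {j}. [:- x i, 1:] ^ a i)"
      by (intro prod.cong) auto
    hence "g = smult c' (\<Prod>i<n. [:- x i, 1:] ^ (a(j := Suc (a j))) i)"
      unfolding g' a split by (simp add: mult_ac)
    thus ?case by blast
  next
    assume "L dvd h"
    then obtain h' where h': "h = L * h'" by auto
    have "L * (g * h') = L * smult c (\<Prod>i<n. [:- x i, 1:] ^ e' i)"
      using Suc.prems(1) unfolding P h' by (simp add: mult_ac)
    hence "g * h' = smult c (\<Prod>i<n. [:- x i, 1:] ^ e' i)" using L by (simp only: mult_cancel_left) simp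
    from Suc.hyps(1)[OF s this Suc.prems(2)] show ?case .
  qed
qed

theorem divisor_of_binom_poly_power:
  assumes n: "n \<ge> 1" and g: "g \<in> carrier Int_Z" and h: "h \<in> carrier Int_Z"
    and gh: "g * h = binom_poly n ^ m"
  shows "\<exists>k. g = binom_poly n ^ k \<or> g = - (binom_poly n ^ k)"
proof -
  define X :: "nat \<Rightarrow> rat poly" where "X = (\<lambda>i. [:- of_nat i, 1:])"
  have f: "binom_poly n = smult (1 / fact n) (\<Prod>i<n. X i)" by (simp add: binom_poly_def X_def)
  have "binom_poly n ^ m = smult ((1 / fact n) ^ m) (\<Prod>i<n. X i ^ m)"
    unfolding f by (simp add: smult_power prod_power_distrib)
  then obtain c a where ga: "g = smult c (\<Prod>i<n. X i ^ a i)"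
    using factor_of_linear_product[where g = g and h = h and n = n and c = "(1 / fact n) ^ m"
        and x = of_nat and e = "\<lambda>_. m"] gh unfolding X_def by auto
  have int: "\<exists>y. poly g (of_nat z) = of_int y" "\<exists>y. poly h (of_nat z) = of_int y" for z :: nat
    using g h unfolding Int_Z_def by (auto elim!: Ints_cases dest: spec[of _ "int z"])
  define A where "A z = (\<Prod>i<n. (z - i) ^ a i)" for z :: nat
  have poly_g: "poly g (of_nat z) = c * of_nat (A z)" if "n \<le> z" for z
    using that unfolding ga A_def by (simp add: poly_prod X_def of_nat_diff)
  have A_pos: "A z > 0" if "n \<le> z" for z
    using that unfolding A_def by (intro prod_pos) auto
  have poly_gh: "poly g (of_nat z) * poly h (of_nat z) = of_nat ((z choose n) ^ m)" for z
    unfolding poly_mult[symmetric] gh by (simp add: poly_binom_poly_nat)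
  \<comment> \<open>At z = n the binomial coefficient is 1, so g takes a value u = 1 or u = -1
    there. This eliminates the rational constant c: g(z) = u * A(z) / A(n), and all valuations are
    taken of natural numbers.\<close>
  obtain u where u: "poly g (of_nat n) = of_int u" using int by blast
  have u1: "\<bar>u\<bar> = 1"
  proof -
    obtain w where "poly h (of_nat n) = of_int w" using int by blast
    hence "of_int (u * w) = (of_int 1 :: rat)" using poly_gh[of n] u by simp
    hence "u * w = 1" by (simp only: of_int_eq_iff)
    thus ?thesis using zmult_eq_1_iff by auto
  qed
  have cA: "c * of_nat (A n) = of_int u" using poly_g[of n] u by simp
  have "balanced n (\<lambda>i. int (a i))"
    unfolding balanced_def
  proof (intro allI impI)
    fix p :: nat assume p: "prime p"
    have v_A: "multiplicity p (A z) = (\<Sum>i<n. a i * multiplicity p (z - i))" if "n \<le> z" for z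
    proof -
      have "multiplicity p (A z) = (\<Sum>i<n. multiplicity p ((z - i) ^ a i))"
        unfolding A_def using p that by (intro prime_elem_multiplicity_prod_distrib) auto
      also have "\<dots> = (\<Sum>i<n. a i * multiplicity p (z - i))"
        using p that by (intro sum.cong prime_elem_multiplicity_power_distrib) auto
      finally show ?thesis .
    qed
    have "balanced_at n (\<lambda>i. int (a i)) p (int (multiplicity p (A n)))"
      unfolding balanced_at_def
    proof (intro allI impI)
      fix z assume z: "n \<le> z" "\<not> p dvd (z choose n)"
      obtain y w where yw: "poly g (of_nat z) = of_int y" "poly h (of_nat z) = of_int w" using int by blast
      have "of_int (y * w) = (of_int (int ((z choose n) ^ m)) :: rat)" using poly_gh[of z] yw by simp
      hence "y * w = int ((z choose n) ^ m)" by (simp only: of_int_eq_iff)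
      moreover have "\<not> p dvd (z choose n) ^ m" using z(2) p prime_dvd_power by blast
      ultimately have "\<not> int p dvd y" by (metis dvd_mult2 int_dvd_int_iff)
      hence ndvd: "\<not> p dvd nat \<bar>y\<bar>" by (simp add: int_dvd_int_iff[symmetric])
      have "of_int (y * int (A n)) = (of_int (u * int (A z)) :: rat)"
        using poly_g[OF z(1)] yw(1) cA by (simp add: mult_ac)
      hence "y * int (A n) = u * int (A z)" by (simp only: of_int_eq_iff)
      hence "\<bar>y\<bar> * int (A n) = int (A z)" using u1 by (metis abs_mult abs_of_nat mult_1)
      hence eq: "nat \<bar>y\<bar> * A n = A z" by (metis int_nat_eq abs_ge_zero nat_int of_nat_mult int_eq_iff)
      have "nat \<bar>y\<bar> \<noteq> 0" using ndvd by (metis dvd_0_right)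
      hence "multiplicity p (A z) = multiplicity p (nat \<bar>y\<bar>) + multiplicity p (A n)"
        unfolding eq[symmetric] using p A_pos[of n] by (subst prime_elem_multiplicity_mult_distrib) auto
      also have "multiplicity p (nat \<bar>y\<bar>) = 0" using ndvd by (rule not_dvd_imp_multiplicity_0)
      finally have "int (\<Sum>i<n. a i * multiplicity p (z - i)) = int (multiplicity p (A n))"
        using v_A[OF z(1)] by simp
      thus "(\<Sum>i<n. int (a i) * int (multiplicity p (z - i))) = int (multiplicity p (A n))" by simp
    qed
    thus "\<exists>\<kappa>. balanced_at n (\<lambda>i. int (a i)) p \<kappa>" by blast
  qed
  then obtain k' where k': "\<And>i. i < n \<Longrightarrow> int (a i) = k'" using balanced_imp_const[OF _ n] by blast
  define k where "k = nat k'"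
  have "a i = k" if "i < n" for i using k'[OF that] by (simp add: k_def)
  hence "g = smult c (\<Prod>i<n. X i ^ k)" unfolding ga by (intro arg_cong[of _ _ "smult c"] prod.cong) auto
  hence "g = smult (c * fact n ^ k) (binom_poly n ^ k)"
    unfolding f by (simp add: smult_power prod_power_distrib power_divide)
  \<comment> \<open>Evaluation at n, where the binomial polynomial is 1, identifies the scalar with
    the sign u.\<close>
  moreover from this have "c * fact n ^ k = of_int u" using u poly_binom_poly_nat[of n n] by simp
  moreover have "u = 1 \<or> u = - 1" using u1 by auto
  ultimately show ?thesis by auto
qed

lemma monadic_submonoid_binom_poly:
  assumes "n \<ge> 1"
  shows "monadic_submonoid Int_Z (binom_poly n) =
    \<lparr>carrier = signed_powers (binom_poly n), mult = (*), one = 1\<rparr>"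
proof -
  let ?f = "binom_poly n"
  have "{g \<in> carrier Int_Z. \<exists>m::nat. g divides\<^bsub>Int_Z\<^esub> (?f [^]\<^bsub>Int_Z\<^esub> m)} = {s * ?f ^ k | s k. s \<in> {1, - 1}}"
  proof (intro equalityI subsetI)
    fix g assume "g \<in> {g \<in> carrier Int_Z. \<exists>m::nat. g divides\<^bsub>Int_Z\<^esub> (?f [^]\<^bsub>Int_Z\<^esub> m)}"
    then obtain m h where "g \<in> carrier Int_Z" "h \<in> carrier Int_Z" "?f ^ m = g \<otimes>\<^bsub>Int_Z\<^esub> h"
      by (auto simp: factor_def nat_pow_Int_Z)
    hence "\<exists>k. g = ?f ^ k \<or> g = - (?f ^ k)"
      using divisor_of_binom_poly_power[OF assms, of g h m] by (simp add: Int_Z_def)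
    then obtain k where "g = 1 * ?f ^ k \<or> g = - 1 * ?f ^ k" by auto
    thus "g \<in> {s * ?f ^ k | s k. s \<in> {1, - 1}}" by blast
  next
    fix g assume "g \<in> {s * ?f ^ k | s k. s \<in> {1, - 1}}"
    then obtain s k where g: "g = s * ?f ^ k" "s = 1 \<or> s = - 1" by auto
    have s: "s \<in> carrier Int_Z" "s * s = 1" using g(2) by (auto simp: Int_Z_def)
    have gc: "g \<in> carrier Int_Z" unfolding g(1) by (intro Int_Z_mult s Int_Z_power binom_poly_Int_Z)
    have "?f ^ k = g * s" unfolding g(1) using s(2) by (simp add: mult_ac)
    hence "g divides\<^bsub>Int_Z\<^esub> (?f [^]\<^bsub>Int_Z\<^esub> k)"
      unfolding nat_pow_Int_Z factor_def using s(1) by (intro bexI[of _ s]) (simp_all add: Int_Z_def)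
    thus "g \<in> {g \<in> carrier Int_Z. \<exists>m::nat. g divides\<^bsub>Int_Z\<^esub> (?f [^]\<^bsub>Int_Z\<^esub> m)}" using gc by blast
  qed
  thus ?thesis by (simp add: monadic_submonoid_def Int_Z_def signed_powers_def)
qed

lemma degree_binom_poly: "degree (binom_poly n) = n"
proof -
  have "degree (\<Prod>i<n. [:- of_nat i, 1 :: rat:]) = (\<Sum>i<n. 1)"
    by (subst degree_prod_eq_sum_degree) auto
  thus ?thesis by (simp add: binom_poly_def)
qed

lemma binom_poly_power_inj:
  assumes "n \<ge> 1" "s \<in> {1, - 1}" "binom_poly n ^ i = s * binom_poly n ^ j"
  shows "i = j"
proof -
  have "binom_poly n \<noteq> 0" using degree_binom_poly[of n] assms(1) by auto
  moreover have "degree s = 0" "s \<noteq> 0" using assms(2) by auto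
  ultimately have "i * n = j * n"
    using arg_cong[OF assms(3), of degree] by (simp add: degree_mult_eq degree_power_eq degree_binom_poly)
  thus ?thesis using assms(1) by simp
qed

lemma to_fract_power: "to_fract (x ^ k) = to_fract x ^ k"
  by (induction k) simp_all

lemma to_fract_signed_powers: "to_fract ` signed_powers F = signed_powers (to_fract F)"
proof (intro equalityI subsetI)
  fix x assume "x \<in> to_fract ` signed_powers F"
  then obtain y where y: "y \<in> signed_powers F" "x = to_fract y" by blast
  from y(1) obtain s k where s: "s \<in> {1, - 1}" "y = s * F ^ k" by (rule signed_powersE)
  have "to_fract s \<in> {1, - 1}" using s(1) by auto
  thus "x \<in> signed_powers (to_fract F)"
    using signed_powersI[of "to_fract s" "to_fract F" k] by (simp add: y(2) s(2) to_fract_power)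
next
  fix x assume "x \<in> signed_powers (to_fract F)"
  then obtain s k where s: "s \<in> {1, - 1}" "x = s * to_fract F ^ k" by (rule signed_powersE)
  then obtain t where t: "t \<in> {1, - 1}" "s = to_fract t" by (auto intro: that[of 1] that[of "- 1"])
  have "x = to_fract (t * F ^ k)" by (simp add: s(2) t(2) to_fract_power)
  thus "x \<in> to_fract ` signed_powers F" using signed_powersI[OF t(1)] by blast
qed

theorem corollary2p1:
  fixes n :: nat
  assumes "n \<ge> 1"
  shows "factorial_monoid (monadic_submonoid Int_Z (binom_poly n)) \<and>
         krull_monoid (to_fract ` carrier (monadic_submonoid Int_Z (binom_poly n))) \<and>
         trivial_group (divisor_class_group (to_fract ` carrier (monadic_submonoid Int_Z (binom_poly n))))"
proof -
  let ?f = "binom_poly n"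
  have f0: "?f \<noteq> 0" using degree_binom_poly[of n] assms by auto
  interpret signed_power_monoid "to_fract ?f"
  proof
    show "to_fract ?f \<noteq> 0" using f0 by simp
    fix i j and s :: "rat poly fract"
    assume s: "s \<in> {1, - 1}" "to_fract ?f ^ i = s * to_fract ?f ^ j"
    then obtain t where t: "t \<in> {1, - 1}" "s = to_fract t" by (auto intro: that[of 1] that[of "- 1"])
    hence "to_fract (?f ^ i) = to_fract (t * ?f ^ j)" using s(2) by (simp add: to_fract_power)
    hence "?f ^ i = t * ?f ^ j" by (simp only: to_fract_eq_iff)
    thus "i = j" by (rule binom_poly_power_inj[OF assms t(1)])
  qed
  show ?thesis
    unfolding monadic_submonoid_binom_poly[OF assms]
    using factorial_monoid_signed_powers[OF f0 binom_poly_power_inj[OF assms]] krull trivial_class_group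
    by (simp add: to_fract_signed_powers)
qed

end
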